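(* Let $E$ be a complex Banach lattice, let $u\in E_+$, and let $(T(t))_{t\ge0}$ be an immediately differentiable $C_0$-semigroup on $E$ with generator $A:\operatorname{dom}(A)\subseteq E\to E$; let $E_1$ denote $\operatorname{dom}(A)$ with the graph norm. Let $\{B(\kappa):\kappa\in B(0,1)\subset\mathbb{C}\}\subset\mathcal{L}(E_1,E)$ be a family of operators with $B(0)=0$. Assume that for each $\kappa\in B(0,1)$ the following conditions are fulfilled: 1. there exist $C\ge1$ and $\alpha>0$ such that $T(t)E\subseteq E_u$ and $\|T(t)\|_{E\to E_u}\le Ct^{-\alpha}$ for all $t\in(0,1]$; 2. for some $q\in(0,1)$ and $t_0>0$, $\int_0^{t_0}\|B(\kappa)T(s)x\|_E\,ds\le q\|x\|_E$ for all $x\in\operatorname{dom}(A)$; 3. there exist $C\ge1$ and $\beta\in[0,1)$ such that $\|T(t)\|_{E_u\to E_u}\le C$ for all $t\in(0,1]$, and $B(\kappa)T(t)x\in E_u$ with $\|B(\kappa)T(t)x\|_{E_u}\le Ct^{-\beta}\|x\|_{E_u}$ whenever $x\in E_u$ and $t\in(0,1]$ are such that $T(t)x\in\operatorname{dom}(B(\kappa))$. Set $A(\kappa):=A+B(\kappa)$ with domain $\operatorname{dom}(A)$ and assume that $B(0,1)\ni\kappa\mapsto A(\kappa)x\in E$ is holomorphic for each $x\in\operatorname{dom}(A)$. Assume further that $A$ is real and that $B(\kappa)$ is real for each $\kappa\in\mathbb{R}$ with $|\kappa|<1$. Suppose that $\lambda_0\in\sigma(A)\cap\mathbb{R}$ is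 a pole of the resolvent $\mathcal{R}(\cdot,A)$ and an algebraically simple eigenvalue of $A$ with an eigenvector $v_0$ satisfying $v_0\ge cu$ for some constant $c>0$. Fix $r>0$ such that $\overline{B(\lambda_0,r)}\cap\sigma(A)=\{\lambda_0\}$ and set \[ \beta_\kappa:=\sup_{|\lambda-\lambda_0|=r}\|B(\kappa)\mathcal{R}(\lambda,A)\| \] for each $\kappa\in\mathbb{R}$ with $|\kappa|<1$. If $\beta_\kappa\to0$ as $\kappa\to0$, then there exists $\delta>0$ such that for all $\kappa\in(-\delta,\delta)$ the following assertions hold: (a) The perturbed operator $A(\kappa)$ has a unique algebraically simple eigenvalue $\lambda(\kappa)$ in the open interval $(\lambda_0-r,\lambda_0+r)$ with an associated eigenvector $v(\kappa)\in E_u$. Moreover, $\overline{B(\lambda_0,r)}\cap\sigma(A(\kappa))=\{\lambda(\kappa)\}$. (b) One may choose an eigenvector $v(\kappa)$ corresponding to $\lambda(\kappa)$ such that $v(\kappa)\ge\frac{c}{2}u$.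
   Context: $B(\lambda_0,r)$ denotes the open disk in $\mathbb{C}$ with centre $\lambda_0$ and radius $r$ (not to be confused with the operators $B(\kappa)$). A complex Banach lattice $E$ is the complexification of a real Banach lattice, with real part $E_{\mathbb{R}}$ and positive cone $E_+$. A linear operator $A:\operatorname{dom}(A)\subseteq E\to E$ is real if $\operatorname{dom}(A)=\operatorname{dom}(A)\cap E_{\mathbb{R}}+i\operatorname{dom}(A)\cap E_{\mathbb{R}}$ and $A(\operatorname{dom}(A)\cap E_{\mathbb{R}})\subseteq E_{\mathbb{R}}$. For $u\in E_+$, $E_u=\{x\in E: |x|\le cu\text{ for some }c>0\}$ is the principal ideal generated by $u$, a Banach space with the gauge norm $\|x\|_{E_u}=\inf\{c>0:|x|\le cu\}$, embedding continuously into $E$. A $C_0$-semigroup is immediately differentiable if $T(t)E\subseteq\operatorname{dom}(A)$ for all $t>0$. $\mathcal{R}(\lambda,A)=(\lambda-A)^{-1}$; $\lambda_0\in\sigma(A)$ is a pole of the resolvent if $\lambda\mapsto\mathcal{R}(\lambda,A)$ has a pole there. An eigenvalue $\lambda_0$ of $A$ is algebraically simple if $\bigcup_{m\in\mathbb{N}}\ker[(\lambda_0-A)^m]$ is one-dimensional. Operators $B(\kappa)\in\mathcal{L}(E_1,E)$ are regarded as unbounded operators on $E$ with domain $\operatorname{dom}(A)$. *)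

theory Defs
  imports "HOL-Analysis.Analysis" "HOL-Library.Lattice_Algebras"
begin

section \<open>Complex normed spaces\<close>

class complex_normed_vector = real_normed_vector +
  fixes scaleC :: "complex \<Rightarrow> 'a \<Rightarrow> 'a"  (infixr "*\<^sub>C" 75)
  assumes scaleC_add_right: "a *\<^sub>C (x + y) = a *\<^sub>C x + a *\<^sub>C y"
    and scaleC_add_left: "(a + b) *\<^sub>C x = a *\<^sub>C x + b *\<^sub>C x"
    and scaleC_scaleC: "a *\<^sub>C b *\<^sub>C x = (a * b) *\<^sub>C x"
    and scaleC_of_real: "of_real t *\<^sub>C x = t *\<^sub>R x"
    and norm_scaleC: "norm (a *\<^sub>C x) = cmod a * norm x"

global_interpretation complex_vector:
  vector_space "scaleC :: complex \<Rightarrow> 'a \<Rightarrow> 'a::complex_normed_vector"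
proof
  show "1 *\<^sub>C x = x" for x :: 'a
    using scaleC_of_real [of 1 x] by simp
qed (simp_all add: scaleC_add_right scaleC_add_left scaleC_scaleC)

definition bounded_clinear ::
    "('a::complex_normed_vector \<Rightarrow> 'b::complex_normed_vector) \<Rightarrow> bool" where
  "bounded_clinear f \<longleftrightarrow> bounded_linear f \<and> (\<forall>c x. f (c *\<^sub>C x) = c *\<^sub>C f x)"

text \<open>The bounded \<^emph>\<open>real\<close>-linear operators into a complex normed space form a complex normed
  space; this is only used to speak of operator-valued holomorphic functions.\<close>

instantiation blinfun :: (real_normed_vector, complex_normed_vector) complex_normed_vector
begin

lift_definition scaleC_blinfun :: "complex \<Rightarrow> 'a \<Rightarrow>\<^sub>L 'b \<Rightarrow> 'a \<Rightarrow>\<^sub>L 'b"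
  is "\<lambda>c f x. c *\<^sub>C f x"
proof -
  fix c :: complex and f :: "'a \<Rightarrow> 'b"
  assume "bounded_linear f"
  then interpret bounded_linear f .
  obtain K where K: "\<And>x. norm (f x) \<le> norm x * K"
    using bounded by blast
  show "bounded_linear (\<lambda>x. c *\<^sub>C f x)"
  proof (rule bounded_linear_intro)
    show "c *\<^sub>C f (x + y) = c *\<^sub>C f x + c *\<^sub>C f y" for x y
      by (simp add: add scaleC_add_right)
    show "c *\<^sub>C f (r *\<^sub>R x) = r *\<^sub>R c *\<^sub>C f x" for r x
      by (simp add: scale scaleC_scaleC mult.commute flip: scaleC_of_real)
    show "norm (c *\<^sub>C f x) \<le> norm x * (cmod c * K)" for x
      using mult_left_mono [OF K [of x], of "cmod c"] by (simp add: norm_scaleC mult_ac)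
  qed
qed

instance
proof
  fix a b :: complex and t :: real and f g :: "'a \<Rightarrow>\<^sub>L 'b"
  show "a *\<^sub>C (f + g) = a *\<^sub>C f + a *\<^sub>C g"
    by transfer (simp add: scaleC_add_right)
  show "(a + b) *\<^sub>C f = a *\<^sub>C f + b *\<^sub>C f"
    by transfer (simp add: scaleC_add_left)
  show "a *\<^sub>C b *\<^sub>C f = (a * b) *\<^sub>C f"
    by transfer (simp add: scaleC_scaleC)
  show "of_real t *\<^sub>C f = t *\<^sub>R f"
    by transfer (simp add: scaleC_of_real)
  have le: "norm (c *\<^sub>C h) \<le> cmod c * norm h" for c and h :: "'a \<Rightarrow>\<^sub>L 'b"
  proof (rule norm_blinfun_bound)
    show "norm (blinfun_apply (c *\<^sub>C h) x) \<le> cmod c * norm h * norm x" for x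
      using mult_left_mono [OF norm_blinfun [of h x], of "cmod c"]
      by (simp add: scaleC_blinfun.rep_eq norm_scaleC mult_ac)
  qed simp
  show "norm (a *\<^sub>C f) = cmod a * norm f"
  proof (cases "a = 0")
    case True
    then show ?thesis using le [of a f] by simp
  next
    case False
    have "inverse a *\<^sub>C a *\<^sub>C f = f"
      using False by transfer (simp add: scaleC_scaleC)
    then have "norm f \<le> inverse (cmod a) * norm (a *\<^sub>C f)"
      using le [of "inverse a" "a *\<^sub>C f"] by (simp add: norm_inverse)
    then have "cmod a * norm f \<le> norm (a *\<^sub>C f)"
      using False by (simp add: field_simps)
    then show ?thesis using le [of a f] by simp
  qed
qed

end

definition vholomorphic_on ::
    "(complex \<Rightarrow> 'a::complex_normed_vector) \<Rightarrow> complex set \<Rightarrow> bool"  (infix "vholomorphic'_on" 50)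
  where "f vholomorphic_on S \<longleftrightarrow>
    (\<forall>z\<in>S. \<exists>D. ((\<lambda>w. inverse (w - z) *\<^sub>C (f w - f z)) \<longlongrightarrow> D) (at z within S))"

text \<open>The library's \<open>is_pole\<close> (the norm tends to infinity) is not adequate for vector-valued
  functions: the norm of a resolvent tends to infinity at every isolated spectral point, also at
  essential singularities.  A pole is a singularity with finite, nonzero principal part.\<close>

definition vpole_at :: "(complex \<Rightarrow> 'a::complex_normed_vector) \<Rightarrow> complex \<Rightarrow> bool" where
  "vpole_at f z0 \<longleftrightarrow> (\<exists>n\<ge>1. \<exists>e>0. \<exists>g. g vholomorphic_on ball z0 e \<and> g z0 \<noteq> 0 \<and>
     (\<forall>z\<in>ball z0 e - {z0}. f z = inverse ((z - z0) ^ n) *\<^sub>C g z))"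


section \<open>Banach lattices and their complexifications\<close>

class banach_lattice = banach + ordered_real_vector + lattice_ab_group_add_abs +
  assumes norm_mono_abs: "\<bar>x\<bar> \<le> \<bar>y\<bar> \<Longrightarrow> norm x \<le> norm y"

lemma norm_abs_lattice [simp]: "norm \<bar>x::'a::banach_lattice\<bar> = norm x"
  by (rule antisym; rule norm_mono_abs) simp_all

lemma lattice_nonneg_closed:
  fixes x :: "'a::banach_lattice"
  assumes lim: "X \<longlonglongrightarrow> x" and nn: "\<And>n. 0 \<le> X n"
  shows "0 \<le> x"
proof -
  have "norm (sup (-x) 0) \<le> norm (X n - x)" for n
  proof (rule norm_mono_abs)
    have "-x \<le> X n - x" using nn [of n] by simp
    also have "\<dots> \<le> \<bar>X n - x\<bar>" by (rule abs_ge_self)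
    finally show "\<bar>sup (-x) 0\<bar> \<le> \<bar>X n - x\<bar>" by simp
  qed
  moreover have "(\<lambda>n. norm (X n - x)) \<longlonglongrightarrow> 0"
    using lim by (simp add: LIM_zero_iff tendsto_norm_zero_iff)
  ultimately have "norm (sup (-x) 0) \<le> 0"
    by (meson LIMSEQ_le_const)
  then have "sup (-x) 0 = 0" by simp
  then have "-x \<le> 0" by (metis sup.cobounded1)
  then show ?thesis by simp
qed

lemma lattice_tendsto_le:
  fixes x :: "'a::banach_lattice"
  assumes "X \<longlonglongrightarrow> x" "Y \<longlonglongrightarrow> y" "\<And>n. X n \<le> Y n"
  shows "x \<le> y"
  using lattice_nonneg_closed [OF tendsto_diff [OF assms(2,1)]] assms(3) by simp

abbreviation rotated :: "'a::real_vector \<Rightarrow> 'a \<Rightarrow> real \<Rightarrow> 'a" where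
  "rotated x y \<theta> \<equiv> cos \<theta> *\<^sub>R x + sin \<theta> *\<^sub>R y"

text \<open>The modulus of \<open>x + i y\<close> is the supremum over \<open>\<theta>\<close> of \<open>cos \<theta> x + sin \<theta> y\<close>.\<close>

definition is_modulus :: "'a::banach_lattice \<Rightarrow> 'a \<Rightarrow> 'a \<Rightarrow> bool" where
  "is_modulus x y s \<longleftrightarrow>
     (\<forall>\<theta>. rotated x y \<theta> \<le> s) \<and> (\<forall>b. (\<forall>\<theta>. rotated x y \<theta> \<le> b) \<longrightarrow> s \<le> b)"

definition modulus :: "'a::banach_lattice \<Rightarrow> 'a \<Rightarrow> 'a" where
  "modulus x y = (THE s. is_modulus x y s)"

lemma scaleR_le_abs:
  fixes x :: "'a::banach_lattice"
  assumes "\<bar>a\<bar> \<le> b"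
  shows "a *\<^sub>R x \<le> b *\<^sub>R \<bar>x\<bar>"
proof -
  have "a *\<^sub>R x \<le> \<bar>a\<bar> *\<^sub>R \<bar>x\<bar>"
  proof (cases "a \<ge> 0")
    case True
    then show ?thesis by (simp add: scaleR_left_mono abs_ge_self)
  next
    case False
    then have "(-a) *\<^sub>R (-x) \<le> (-a) *\<^sub>R \<bar>x\<bar>"
      by (intro scaleR_left_mono) (auto simp: abs_ge_minus_self)
    then show ?thesis using False by simp
  qed
  also have "\<dots> \<le> b *\<^sub>R \<bar>x\<bar>"
    using assms by (intro scaleR_right_mono) auto
  finally show ?thesis .
qed

lemma abs_cos_diff_le: "\<bar>cos a - cos b\<bar> \<le> \<bar>a - b\<bar>" for a b :: real
proof -
  have "\<bar>cos a - cos b\<bar> = 2 * \<bar>sin ((a + b) / 2)\<bar> * \<bar>sin ((b - a) / 2)\<bar>"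
    by (simp add: cos_diff_cos abs_mult)
  also have "\<dots> \<le> 2 * 1 * \<bar>(b - a) / 2\<bar>"
    by (intro mult_mono abs_sin_x_le_abs_x) auto
  finally show ?thesis by simp
qed

lemma abs_sin_diff_le: "\<bar>sin a - sin b\<bar> \<le> \<bar>a - b\<bar>" for a b :: real
  using abs_cos_diff_le [of "pi/2 - a" "pi/2 - b"] by (simp add: cos_diff)

lemma rotated_lipschitz:
  fixes x y :: "'a::banach_lattice"
  assumes "\<bar>a - b\<bar> \<le> e"
  shows "rotated x y a \<le> rotated x y b + e *\<^sub>R (\<bar>x\<bar> + \<bar>y\<bar>)"
proof -
  have "(cos a - cos b) *\<^sub>R x \<le> e *\<^sub>R \<bar>x\<bar>" "(sin a - sin b) *\<^sub>R y \<le> e *\<^sub>R \<bar>y\<bar>"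
    using assms abs_cos_diff_le [of a b] abs_sin_diff_le [of a b] by (auto intro!: scaleR_le_abs)
  from add_mono [OF this] show ?thesis
    by (simp add: algebra_simps)
qed

lemma modulus_exists: "\<exists>s. is_modulus x y (s::'a::banach_lattice)"
proof -
  define w where "w = \<bar>x\<bar> + \<bar>y\<bar>"
  define G where "G n = (\<lambda>k. rotated x y (real k / real (Suc n))) ` {..<7 * Suc n}" for n
  define s where "s n = Sup_fin (G n)" for n
  have fin: "finite (G n)" and ne: "G n \<noteq> {}" for n
    by (auto simp: G_def lessThan_empty_iff)
  have w0: "0 \<le> w" by (simp add: w_def)
  have up: "rotated x y \<theta> \<le> s n + (1 / real (Suc n)) *\<^sub>R w" for \<theta> n
  proof -
    obtain t where t: "0 \<le> t" "t < 2 * pi" "cos \<theta> = cos t" "sin \<theta> = sin t"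
      using sincos_total_2pi [of "cos \<theta>" "sin \<theta>"] sin_cos_squared_add2 [of \<theta>] by metis
    define k where "k = nat \<lfloor>t * real (Suc n)\<rfloor>"
    have k: "real k \<le> t * real (Suc n)" "t * real (Suc n) < real k + 1"
      using t(1) by (auto simp: k_def of_nat_nat)
    have "t < 7" using t(2) pi_approx by (simp add: divide_simps)
    then have "t * real (Suc n) < 7 * real (Suc n)" by (rule mult_strict_right_mono) simp
    with k have "real k < real (7 * Suc n)" by simp
    then have "rotated x y (real k / real (Suc n)) \<in> G n"
      unfolding G_def of_nat_less_iff by blast
    then have 1: "rotated x y (real k / real (Suc n)) \<le> s n"
      unfolding s_def using fin by (intro Sup_fin.coboundedI)
    have "\<bar>t - real k / real (Suc n)\<bar> \<le> 1 / real (Suc n)"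
    proof -
      have "t - real k / real (Suc n) = (t * real (Suc n) - real k) / real (Suc n)"
        by (simp add: diff_divide_distrib del: of_nat_Suc)
      then show ?thesis
        using k by (simp add: abs_of_nonneg divide_right_mono del: of_nat_Suc)
    qed
    from rotated_lipschitz [OF this, of x y] 1
    show ?thesis unfolding t w_def by (meson add_right_mono order_trans)
  qed
  have below: "s n \<le> b" if "\<And>\<theta>. rotated x y \<theta> \<le> b" for n b
    unfolding s_def using fin ne that by (intro Sup_fin.boundedI) (auto simp: G_def)
  have s1: "s m - s n \<le> (1 / real (Suc N)) *\<^sub>R w" if "N \<le> n" for m n N
  proof -
    have "s m - s n \<le> (1 / real (Suc n)) *\<^sub>R w"
      using below [OF up, of m n] by (simp add: algebra_simps)
    also have "\<dots> \<le> (1 / real (Suc N)) *\<^sub>R w"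
      using that w0 by (intro scaleR_right_mono) (auto simp: field_simps)
    finally show ?thesis .
  qed
  have s2: "norm (s m - s n) \<le> (1 / real (Suc N)) * norm w" if "N \<le> n" "N \<le> m" for m n N
  proof -
    have "\<bar>s m - s n\<bar> \<le> (1 / real (Suc N)) *\<^sub>R w"
      using s1 [of N n m] s1 [of N m n] that by (intro abs_leI) auto
    then have "norm (s m - s n) \<le> norm ((1 / real (Suc N)) *\<^sub>R w)"
      by (intro norm_mono_abs) (meson abs_ge_self order_trans)
    then show ?thesis by simp
  qed
  have inv0: "(\<lambda>n. 1 / real (Suc n)) \<longlonglongrightarrow> 0"
    using LIMSEQ_inverse_real_of_nat by (simp add: inverse_eq_divide)
  have "Cauchy s"
  proof (rule CauchyI)
    fix e :: real assume "0 < e"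
    have "(\<lambda>n. (1 / real (Suc n)) * norm w) \<longlonglongrightarrow> 0"
      using tendsto_mult_left_zero [OF inv0] .
    from order_tendstoD(2) [OF this \<open>0 < e\<close>] obtain N
      where "(1 / real (Suc N)) * norm w < e"
      by (meson eventually_sequentially order_refl)
    then show "\<exists>M. \<forall>m\<ge>M. \<forall>n\<ge>M. norm (s m - s n) < e"
      using s2 by (meson order_le_less_trans)
  qed
  then obtain l where l: "s \<longlonglongrightarrow> l"
    using Cauchy_convergent convergent_def by blast
  have "(\<lambda>n. s n + (1 / real (Suc n)) *\<^sub>R w) \<longlonglongrightarrow> l + 0 *\<^sub>R w"
    by (intro tendsto_intros l inv0)
  then have "rotated x y \<theta> \<le> l" for \<theta>
    using lattice_tendsto_le [OF tendsto_const, of _ l "rotated x y \<theta>"] up by simp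
  moreover have "l \<le> b" if "\<And>\<theta>. rotated x y \<theta> \<le> b" for b
    using lattice_tendsto_le [OF l tendsto_const] below [OF that] by blast
  ultimately show ?thesis
    unfolding is_modulus_def by blast
qed

lemma is_modulus_modulus: "is_modulus x y (modulus x y)"
proof -
  obtain s where s: "is_modulus x y s" using modulus_exists by blast
  show ?thesis
    unfolding modulus_def
  proof (rule theI [where P = "is_modulus x y", OF s])
    show "t = s" if "is_modulus x y t" for t
      using that s unfolding is_modulus_def by (meson antisym)
  qed
qed

lemma modulus_upper:
  fixes x y :: "'a::banach_lattice" and \<theta> :: real
  shows "rotated x y \<theta> \<le> modulus x y"
  using is_modulus_modulus unfolding is_modulus_def by blast

lemma modulus_least: "(\<And>\<theta>. rotated x y \<theta> \<le> b) \<Longrightarrow> modulus x y \<le> b"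
  using is_modulus_modulus unfolding is_modulus_def by blast

lemma abs_le_modulus1: "\<bar>x\<bar> \<le> modulus x y"
  using modulus_upper [of 0 x y] modulus_upper [of pi x y] by (auto intro: abs_leI)

lemma abs_le_modulus2: "\<bar>y\<bar> \<le> modulus x y"
  using modulus_upper [of "pi/2" x y] modulus_upper [of "-pi/2" x y] by (auto intro: abs_leI)

lemma modulus_nonneg: "0 \<le> modulus x y"
  using abs_le_modulus1 [of x y] abs_ge_zero [of x] by (rule order_trans [rotated])

lemma modulus_le_add: "modulus x y \<le> \<bar>x\<bar> + \<bar>y\<bar>"
proof (rule modulus_least)
  show "rotated x y \<theta> \<le> \<bar>x\<bar> + \<bar>y\<bar>" for \<theta>
    using add_mono [OF scaleR_le_abs [of "cos \<theta>" 1 x] scaleR_le_abs [of "sin \<theta>" 1 y]] by simp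
qed

lemma modulus_triangle: "modulus (x + x') (y + y') \<le> modulus x y + modulus x' y'"
proof (rule modulus_least)
  show "rotated (x + x') (y + y') \<theta> \<le> modulus x y + modulus x' y'" for \<theta>
    using add_mono [OF modulus_upper [of \<theta> x y] modulus_upper [of \<theta> x' y']]
    by (simp add: algebra_simps)
qed

lemma modulus_scale_le:
  "modulus (Re c *\<^sub>R x - Im c *\<^sub>R y) (Re c *\<^sub>R y + Im c *\<^sub>R x) \<le> cmod c *\<^sub>R modulus x y"
proof (rule modulus_least)
  fix \<theta>
  define \<phi> where "\<phi> = Arg c"
  have c: "Re c = cmod c * cos \<phi>" "Im c = cmod c * sin \<phi>"
    unfolding \<phi>_def using Re_rcis [of "cmod c" "Arg c"] Im_rcis [of "cmod c" "Arg c"]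
    by (simp_all add: rcis_cmod_Arg)
  have "rotated (Re c *\<^sub>R x - Im c *\<^sub>R y) (Re c *\<^sub>R y + Im c *\<^sub>R x) \<theta>
      = cmod c *\<^sub>R rotated x y (\<theta> - \<phi>)"
    unfolding c by (simp add: cos_diff sin_diff algebra_simps)
  then show "rotated (Re c *\<^sub>R x - Im c *\<^sub>R y) (Re c *\<^sub>R y + Im c *\<^sub>R x) \<theta>
      \<le> cmod c *\<^sub>R modulus x y"
    by (simp add: scaleR_left_mono modulus_upper)
qed

datatype 'a complexification = Cplx (re_part: 'a) (im_part: 'a)

instantiation complexification :: (banach_lattice) real_normed_vector
begin

definition "0 = Cplx 0 0"
definition "z + w = Cplx (re_part z + re_part w) (im_part z + im_part w)"
definition "- z = Cplx (- re_part z) (- im_part z)"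
definition "z - w = Cplx (re_part z - re_part w) (im_part z - im_part w)"
definition "t *\<^sub>R z = Cplx (t *\<^sub>R re_part z) (t *\<^sub>R im_part z)"
definition "norm z = norm (modulus (re_part z) (im_part z))"
definition "dist z w = norm (z - w)" for z w :: "'a complexification"
definition "sgn z = inverse (norm z) *\<^sub>R z" for z :: "'a complexification"
definition "uniformity = (INF e\<in>{0 <..}. principal {(z :: 'a complexification, w). dist z w < e})"
definition "open U = (\<forall>z\<in>U. eventually (\<lambda>(z', w). z' = z \<longrightarrow> w \<in> U) uniformity)"
  for U :: "'a complexification set"

lemmas complexification_defs =
  zero_complexification_def plus_complexification_def uminus_complexification_def
  minus_complexification_def scaleR_complexification_def

lemma norm_le_of_modulus_le:
  "modulus x y \<le> b \<Longrightarrow> norm (modulus x y) \<le> norm b" for b :: 'a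
  by (rule norm_mono_abs) (metis abs_ge_self abs_of_nonneg modulus_nonneg order_trans)

lemma norm_complexification_scale_le:
  "norm (modulus (Re c *\<^sub>R x - Im c *\<^sub>R y) (Re c *\<^sub>R y + Im c *\<^sub>R x))
    \<le> cmod c * norm (modulus x y)" for x y :: 'a
  using norm_le_of_modulus_le [OF modulus_scale_le] by simp

lemma norm_re_le: "norm (re_part z) \<le> norm z" for z :: "'a complexification"
  unfolding norm_complexification_def
  by (rule norm_mono_abs) (metis abs_le_modulus1 abs_of_nonneg modulus_nonneg)

lemma norm_im_le: "norm (im_part z) \<le> norm z" for z :: "'a complexification"
  unfolding norm_complexification_def
  by (rule norm_mono_abs) (metis abs_le_modulus2 abs_of_nonneg modulus_nonneg)

lemma norm_le_re_im: "norm z \<le> norm (re_part z) + norm (im_part z)" for z :: "'a complexification"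
proof -
  have "norm z \<le> norm (\<bar>re_part z\<bar> + \<bar>im_part z\<bar>)"
    unfolding norm_complexification_def by (rule norm_le_of_modulus_le [OF modulus_le_add])
  also have "\<dots> \<le> norm (re_part z) + norm (im_part z)"
    using norm_triangle_ineq [of "\<bar>re_part z\<bar>" "\<bar>im_part z\<bar>"] by simp
  finally show ?thesis .
qed

lemma norm_scaleR_le: "norm (t *\<^sub>R z) \<le> \<bar>t\<bar> * norm z" for z :: "'a complexification"
  using norm_complexification_scale_le [of "of_real t" "re_part z" "im_part z"]
  by (simp add: norm_complexification_def scaleR_complexification_def)

instance
proof
  fix x y z :: "'a complexification" and a b :: real and U :: "'a complexification set"
  show "x + y + z = x + (y + z)" "x + y = y + x" "0 + x = x" "- x + x = 0" "x - y = x + - y"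
    "a *\<^sub>R (x + y) = a *\<^sub>R x + a *\<^sub>R y" "(a + b) *\<^sub>R x = a *\<^sub>R x + b *\<^sub>R x"
    "a *\<^sub>R b *\<^sub>R x = (a * b) *\<^sub>R x" "1 *\<^sub>R x = x"
    by (simp_all add: complexification_defs algebra_simps)
  show "dist x y = norm (x - y)" by (rule dist_complexification_def)
  show "sgn x = inverse (norm x) *\<^sub>R x" by (rule sgn_complexification_def)
  show "uniformity = (INF e\<in>{0 <..}. principal {(z :: 'a complexification, w). dist z w < e})"
    by (rule uniformity_complexification_def)
  show "open U \<longleftrightarrow> (\<forall>z\<in>U. eventually (\<lambda>(z', w). z' = z \<longrightarrow> w \<in> U) uniformity)"
    by (rule open_complexification_def)
  show "norm x = 0 \<longleftrightarrow> x = 0"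
  proof
    assume "norm x = 0"
    then have "re_part x = 0" "im_part x = 0"
      using norm_re_le [of x] norm_im_le [of x] by simp_all
    then show "x = 0" by (simp add: complexification_defs complexification.expand)
  next
    assume "x = 0"
    then show "norm x = 0"
      using norm_le_re_im [of x]
      by (simp add: complexification_defs norm_complexification_def)
  qed
  show "norm (x + y) \<le> norm x + norm y"
    using norm_le_of_modulus_le [OF modulus_triangle [of "re_part x" "re_part y" "im_part x" "im_part y"]]
      norm_triangle_ineq [of "modulus (re_part x) (im_part x)" "modulus (re_part y) (im_part y)"]
    by (simp add: norm_complexification_def complexification_defs)
  show "norm (a *\<^sub>R x) = \<bar>a\<bar> * norm x"
  proof (cases "a = 0")
    case True
    then show ?thesis
      using norm_scaleR_le [of a x] by (simp add: norm_complexification_def)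
  next
    case False
    have "inverse a *\<^sub>R a *\<^sub>R x = x"
      using False by (simp add: complexification_defs)
    then have "norm x \<le> inverse \<bar>a\<bar> * norm (a *\<^sub>R x)"
      using norm_scaleR_le [of "inverse a" "a *\<^sub>R x"] by simp
    then have "\<bar>a\<bar> * norm x \<le> norm (a *\<^sub>R x)"
      using False by (simp add: field_simps)
    then show ?thesis using norm_scaleR_le [of a x] by simp
  qed
qed

end

instance complexification :: (banach_lattice) banach
proof
  fix X :: "nat \<Rightarrow> 'a complexification"
  assume X: "Cauchy X"
  have re: "dist (re_part z) (re_part w) \<le> dist z w"
    and im: "dist (im_part z) (im_part w) \<le> dist z w"
    for z w :: "'a complexification"
    using norm_re_le [of "z - w"] norm_im_le [of "z - w"]
    by (simp_all add: dist_norm complexification_defs)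
  have "Cauchy (\<lambda>n. re_part (X n))" "Cauchy (\<lambda>n. im_part (X n))"
    using X re im unfolding Cauchy_def by (meson order_le_less_trans)+
  then obtain a b where ab: "(\<lambda>n. re_part (X n)) \<longlonglongrightarrow> a" "(\<lambda>n. im_part (X n)) \<longlonglongrightarrow> b"
    using Cauchy_convergent convergent_def by blast
  have "(\<lambda>n. norm (re_part (X n) - a) + norm (im_part (X n) - b)) \<longlonglongrightarrow> norm (a - a) + norm (b - b)"
    by (intro tendsto_intros ab)
  then have lim: "(\<lambda>n. norm (re_part (X n) - a) + norm (im_part (X n) - b)) \<longlonglongrightarrow> 0"
    by simp
  have "norm (X n - Cplx a b) \<le> norm (re_part (X n) - a) + norm (im_part (X n) - b)" for n
    using norm_le_re_im [of "X n - Cplx a b"] by (simp add: complexification_defs)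
  then have "(\<lambda>n. X n - Cplx a b) \<longlonglongrightarrow> 0"
    by (intro Lim_null_comparison [OF _ lim] always_eventually allI)
  then have "X \<longlonglongrightarrow> Cplx a b"
    by (rule LIM_zero_cancel)
  then show "convergent X" by (rule convergentI)
qed

instantiation complexification :: (banach_lattice) complex_normed_vector
begin

definition "c *\<^sub>C z = Cplx (Re c *\<^sub>R re_part z - Im c *\<^sub>R im_part z)
                         (Re c *\<^sub>R im_part z + Im c *\<^sub>R re_part z)"

lemma norm_scaleC_le: "norm (c *\<^sub>C z) \<le> cmod c * norm z" for z :: "'a complexification"
  using norm_complexification_scale_le [of c "re_part z" "im_part z"]
  by (simp add: norm_complexification_def scaleC_complexification_def)

instance
proof
  fix x y :: "'a complexification" and a b :: complex and t :: real
  show "a *\<^sub>C (x + y) = a *\<^sub>C x + a *\<^sub>C y" "(a + b) *\<^sub>C x = a *\<^sub>C x + b *\<^sub>C x"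
    "of_real t *\<^sub>C x = t *\<^sub>R x"
    by (simp_all add: complexification_defs scaleC_complexification_def algebra_simps)
  show assoc: "a *\<^sub>C b *\<^sub>C x = (a * b) *\<^sub>C x" for a b and x :: "'a complexification"
    by (simp add: complexification_defs scaleC_complexification_def algebra_simps)
  show "norm (a *\<^sub>C x) = cmod a * norm x"
  proof (cases "a = 0")
    case True
    then show ?thesis
      using norm_scaleC_le [of a x] by simp
  next
    case False
    have "inverse a *\<^sub>C a *\<^sub>C x = x"
      using False by (simp add: assoc) (simp add: scaleC_complexification_def)
    then have "norm x \<le> inverse (cmod a) * norm (a *\<^sub>C x)"
      using norm_scaleC_le [of "inverse a" "a *\<^sub>C x"] by (simp add: norm_inverse)
    then have "cmod a * norm x \<le> norm (a *\<^sub>C x)"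
      using False by (simp add: field_simps)
    then show ?thesis using norm_scaleC_le [of a x] by simp
  qed
qed

end

text \<open>The real part \<open>E\<^sub>\<real>\<close> consists of the elements with vanishing imaginary part.  As for
  complex numbers, \<open>x \<le> y\<close> means that \<open>y - x\<close> lies in the positive cone of the real part; in
  particular \<open>0 \<le> x\<close> entails that \<open>x\<close> is real.  The modulus of an element is again an element of
  the complexification, lying in its positive cone.\<close>

instantiation complexification :: (banach_lattice) ordered_real_vector
begin

definition "z \<le> w \<longleftrightarrow> re_part z \<le> re_part w \<and> im_part z = im_part w"
definition "z < w \<longleftrightarrow> z \<le> w \<and> \<not> w \<le> z" for z w :: "'a complexification"

instance
proof
  fix x y z :: "'a complexification" and a b :: real
  show "x < y \<longleftrightarrow> x \<le> y \<and> \<not> y \<le> x" by (rule less_complexification_def)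
  show "x \<le> x" by (simp add: less_eq_complexification_def)
  show "x \<le> y \<Longrightarrow> y \<le> z \<Longrightarrow> x \<le> z" by (auto simp: less_eq_complexification_def)
  show "x \<le> y \<Longrightarrow> y \<le> x \<Longrightarrow> x = y"
    by (auto simp: less_eq_complexification_def complexification.expand)
  show "x \<le> y \<Longrightarrow> z + x \<le> z + y"
    by (auto simp: less_eq_complexification_def complexification_defs)
  show "x \<le> y \<Longrightarrow> 0 \<le> a \<Longrightarrow> a *\<^sub>R x \<le> a *\<^sub>R y"
    by (auto simp: less_eq_complexification_def complexification_defs scaleR_left_mono)
  show "a \<le> b \<Longrightarrow> 0 \<le> x \<Longrightarrow> a *\<^sub>R x \<le> b *\<^sub>R x"
    by (cases x) (auto simp: less_eq_complexification_def complexification_defs scaleR_right_mono)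
qed

end

instantiation complexification :: (banach_lattice) abs
begin
definition "\<bar>z\<bar> = Cplx (modulus (re_part z) (im_part z)) 0"
instance ..
end

definition real_elements :: "'a::banach_lattice complexification set" where
  "real_elements = {z. im_part z = 0}"

definition principal_ideal ::
    "'a::banach_lattice complexification \<Rightarrow> 'a complexification set" where
  "principal_ideal u = {x. \<exists>c>0. \<bar>x\<bar> \<le> c *\<^sub>R u}"

definition gauge_norm ::
    "'a::banach_lattice complexification \<Rightarrow> 'a complexification \<Rightarrow> real" where
  "gauge_norm u x = Inf {c. c > 0 \<and> \<bar>x\<bar> \<le> c *\<^sub>R u}"


section \<open>Unbounded operators\<close>

text \<open>An unbounded operator is given by its domain \<open>D\<close> and a function \<open>A\<close> whose values outside
  of \<open>D\<close> are irrelevant.\<close>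

definition clinear_on ::
    "'a::complex_normed_vector set \<Rightarrow> ('a \<Rightarrow> 'b::complex_normed_vector) \<Rightarrow> bool" where
  "clinear_on D F \<longleftrightarrow> complex_vector.subspace D \<and>
     (\<forall>x\<in>D. \<forall>y\<in>D. F (x + y) = F x + F y) \<and> (\<forall>c. \<forall>x\<in>D. F (c *\<^sub>C x) = c *\<^sub>C F x)"

text \<open>\<open>F \<in> \<L>(E\<^sub>1, E)\<close>, where \<open>E\<^sub>1\<close> is \<open>D = dom A\<close> with the graph norm.\<close>

definition graph_bounded ::
    "'a::complex_normed_vector set \<Rightarrow> ('a \<Rightarrow> 'a) \<Rightarrow> ('a \<Rightarrow> 'a) \<Rightarrow> bool" where
  "graph_bounded D A F \<longleftrightarrow> clinear_on D F \<and>
     (\<exists>K. \<forall>x\<in>D. norm (F x) \<le> K * (norm x + norm (A x)))"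

definition real_operator ::
    "'a::banach_lattice complexification set \<Rightarrow> ('a complexification \<Rightarrow> 'a complexification) \<Rightarrow> bool"
  where "real_operator D A \<longleftrightarrow>
    D = {x + \<i> *\<^sub>C y | x y. x \<in> D \<inter> real_elements \<and> y \<in> D \<inter> real_elements} \<and>
    A ` (D \<inter> real_elements) \<subseteq> real_elements"

definition resolvent ::
    "'a::complex_normed_vector set \<Rightarrow> ('a \<Rightarrow> 'a) \<Rightarrow> complex \<Rightarrow> 'a \<Rightarrow> 'a" where
  "resolvent D A l = inv_into D (\<lambda>x. l *\<^sub>C x - A x)"

definition resolvent_set :: "'a::complex_normed_vector set \<Rightarrow> ('a \<Rightarrow> 'a) \<Rightarrow> complex set" where
  "resolvent_set D A =
     {l. bij_betw (\<lambda>x. l *\<^sub>C x - A x) D UNIV \<and> bounded_clinear (resolvent D A l)}"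

definition spectrum :: "'a::complex_normed_vector set \<Rightarrow> ('a \<Rightarrow> 'a) \<Rightarrow> complex set" where
  "spectrum D A = - resolvent_set D A"

definition resolvent_pole ::
    "'a::complex_normed_vector set \<Rightarrow> ('a \<Rightarrow> 'a) \<Rightarrow> complex \<Rightarrow> bool" where
  "resolvent_pole D A l0 \<longleftrightarrow> l0 \<in> spectrum D A \<and>
     (\<forall>\<^sub>F l in at l0. l \<in> resolvent_set D A) \<and>
     vpole_at (\<lambda>l. Blinfun (resolvent D A l)) l0"

definition eigenvector ::
    "'a::complex_normed_vector set \<Rightarrow> ('a \<Rightarrow> 'a) \<Rightarrow> complex \<Rightarrow> 'a \<Rightarrow> bool" where
  "eigenvector D A l v \<longleftrightarrow> v \<in> D \<and> v \<noteq> 0 \<and> A v = l *\<^sub>C v"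

definition eigenvalue :: "'a::complex_normed_vector set \<Rightarrow> ('a \<Rightarrow> 'a) \<Rightarrow> complex \<Rightarrow> bool" where
  "eigenvalue D A l \<longleftrightarrow> (\<exists>v. eigenvector D A l v)"

fun power_dom :: "'a set \<Rightarrow> ('a \<Rightarrow> 'a) \<Rightarrow> nat \<Rightarrow> 'a set" where
  "power_dom D F 0 = UNIV"
| "power_dom D F (Suc m) = {x \<in> D. F x \<in> power_dom D F m}"

definition power_ker :: "'a::complex_normed_vector set \<Rightarrow> ('a \<Rightarrow> 'a) \<Rightarrow> nat \<Rightarrow> 'a set" where
  "power_ker D F m = {x \<in> power_dom D F m. (F ^^ m) x = 0}"

text \<open>\<open>dim\<close> is \<open>0\<close> for infinite-dimensional spaces, so \<open>dim = 1\<close> does mean one-dimensional.\<close>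

definition alg_simple_eigenvalue ::
    "'a::complex_normed_vector set \<Rightarrow> ('a \<Rightarrow> 'a) \<Rightarrow> complex \<Rightarrow> bool" where
  "alg_simple_eigenvalue D A l \<longleftrightarrow> eigenvalue D A l \<and>
     complex_vector.dim (\<Union>m. power_ker D (\<lambda>x. l *\<^sub>C x - A x) m) = 1"


section \<open>Operator semigroups\<close>

definition c0_semigroup :: "(real \<Rightarrow> 'a::complex_normed_vector \<Rightarrow> 'a) \<Rightarrow> bool" where
  "c0_semigroup T \<longleftrightarrow>
     (\<forall>t\<ge>0. bounded_clinear (T t)) \<and>
     T 0 = id \<and>
     (\<forall>s\<ge>0. \<forall>t\<ge>0. T (s + t) = T s \<circ> T t) \<and>
     (\<forall>x. ((\<lambda>t. T t x) \<longlongrightarrow> x) (at_right 0))"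

definition is_generator ::
    "(real \<Rightarrow> 'a::complex_normed_vector \<Rightarrow> 'a) \<Rightarrow> 'a set \<Rightarrow> ('a \<Rightarrow> 'a) \<Rightarrow> bool" where
  "is_generator T D A \<longleftrightarrow>
     D = {x. \<exists>y. ((\<lambda>h. (T h x - x) /\<^sub>R h) \<longlongrightarrow> y) (at_right 0)} \<and>
     (\<forall>x\<in>D. ((\<lambda>h. (T h x - x) /\<^sub>R h) \<longlongrightarrow> A x) (at_right 0))"

definition immediately_differentiable :: "(real \<Rightarrow> 'a \<Rightarrow> 'a) \<Rightarrow> 'a set \<Rightarrow> bool" where
  "immediately_differentiable T D \<longleftrightarrow> (\<forall>t>0. range (T t) \<subseteq> D)"

end

theory Submission
  imports Defs "HOL-Complex_Analysis.Complex_Analysis"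
begin

text \<open>At a simple pole the resolvent splits as \<open>P / (\<lambda> - \<lambda>\<^sub>0) + H \<lambda>\<close> with \<open>P\<close> of rank one, and for small
  \<open>B(\<kappa>)\<close> the spectrum of \<open>A + B(\<kappa>)\<close> in the disc is the zero set of a scalar function
  \<open>\<lambda> - \<lambda>\<^sub>0 - f \<lambda>\<close> with \<open>f\<close> a contraction. The eigenvector \<open>v(\<kappa>)\<close>, normalised by
  \<open>P v(\<kappa>) = v\<^sub>0\<close>, is holomorphic in \<open>\<kappa>\<close> with values in \<open>E\<close> only, while the lower bound by \<open>u\<close> requires
  \<open>v(\<kappa>) \<rightarrow> v\<^sub>0\<close> in \<open>E\<^sub>u\<close>. By Duhamel's formula this follows from an integrable bound, uniform in \<open>\<kappa>\<close>, of
  \<open>T(s) B(\<kappa>) v(\<kappa>)\<close> in \<open>E\<^sub>u\<close>. The constants in the hypotheses are not uniform in \<open>\<kappa>\<close>: for each fixed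
  complex \<open>\<kappa>\<close> this vector is bounded in \<open>E\<^sub>u\<close> as \<open>s \<rightarrow> 0\<close>, but uniformly in \<open>\<kappa>\<close> one only has the possibly
  non-integrable bound \<open>C s\<^sup>-\<^sup>\<alpha>\<close>. Hartogs' lemma for the subharmonic functions
  \<open>log \<bar>\<psi> (T(s) B(\<kappa>) v(\<kappa>))\<bar> / log (1/s)\<close>, \<open>\<psi>\<close> in the polar of the order ball, turns the two bounds into
  \<open>s powr (- 1/2)\<close> near \<open>\<kappa> = 0\<close>.\<close>


section \<open>Hahn--Banach and uniform boundedness\<close>

text \<open>Although the conclusion concerns real \<kappa>, the argument needs complex \<kappa>:
  bounds known at each single parameter become uniform only through holomorphy. Membership in an
  order ball is tested by the functionals of the polar, and each of these is continuous on
  \<open>E\<close>; so holomorphy with values in \<open>E\<close> is enough, and Hartogs' lemma is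
  applied to one family indexed by both \<open>s\<close> and \<psi>. Any exponent strictly between
  \<open>-1\<close> and \<open>0\<close> would serve in place of \<open>-1/2\<close>: pointwise the
  quotients of logarithms have limit superior at most 0, and all that matters is integrability at
  \<open>s = 0\<close>. No integral is taken in \<open>E_u\<close>: integrals are differences of
  values of a primitive that is continuous in \<open>E\<close>, obtained by factoring
  \<open>B(\<kappa>)\<close> as the bounded operator \<open>B(\<kappa>) R(\<mu>, A)\<close> after
  \<open>\<mu> - A\<close>, and they are estimated one functional at a time. The final eigenvector
  is the real part of \<open>v(\<kappa>)\<close>; \<open>c/2\<close> is what remains of
  \<open>v0 \<ge> c u\<close> after an error of at most \<open>(c/2) u\<close>.\<close>

definition sublinear :: "('a::real_vector \<Rightarrow> real) \<Rightarrow> bool" where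
  "sublinear q \<longleftrightarrow> (\<forall>x y. q (x + y) \<le> q x + q y) \<and> (\<forall>c\<ge>0. \<forall>x. q (c *\<^sub>R x) \<le> c * q x)"

lemma sublinearD:
  assumes "sublinear q"
  shows sublinear_add: "q (x + y) \<le> q x + q y"
    and sublinear_scale_le: "c \<ge> 0 \<Longrightarrow> q (c *\<^sub>R x) \<le> c * q x"
  using assms by (auto simp: sublinear_def)

lemma sublinear_zero: "sublinear q \<Longrightarrow> q 0 = 0"
  using sublinear_add [of q 0 0] sublinear_scale_le [of q 0 0] by simp

lemma sublinear_minus: "sublinear q \<Longrightarrow> - q (- x) \<le> q x"
  using sublinear_add [of q x "- x"] sublinear_zero [of q] by simp

lemma sublinear_scale:
  assumes "sublinear q" "c \<ge> 0"
  shows "q (c *\<^sub>R x) = c * q x"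
proof (cases "c = 0")
  case True
  then show ?thesis using sublinear_zero [OF assms(1)] by simp
next
  case False
  then have "c > 0" using assms(2) by simp
  have "q x = q (inverse c *\<^sub>R c *\<^sub>R x)" using False by simp
  also have "\<dots> \<le> inverse c * q (c *\<^sub>R x)"
    using \<open>c > 0\<close> by (intro sublinear_scale_le assms(1)) simp
  finally have "c * q x \<le> q (c *\<^sub>R x)"
    using \<open>c > 0\<close> by (simp add: field_simps)
  with sublinear_scale_le [OF assms, of x] show ?thesis by simp
qed

text \<open>Subtracting \<open>t * q a\<close> along the ray in direction \<open>a\<close> produces
  a functional below \<open>q\<close> whose value at \<open>- a\<close> is at most
  \<open>- q a\<close>. Invariance under this operation for every \<open>a\<close> is what separates
  linear functionals from sublinear ones.\<close>

definition tilt :: "('a::real_vector \<Rightarrow> real) \<Rightarrow> 'a \<Rightarrow> 'a \<Rightarrow> real" where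
  "tilt q a x = (INF t\<in>{0..}. q (x + t *\<^sub>R a) - t * q a)"

lemma tilt_bdd:
  assumes "sublinear q"
  shows "bdd_below ((\<lambda>t. q (x + t *\<^sub>R a) - t * q a) ` {0..})"
proof (rule bdd_belowI2)
  fix t :: real assume "t \<in> {0..}"
  then have "t * q a = q (- x + (x + t *\<^sub>R a))"
    using sublinear_scale [OF assms, of t a] by simp
  also have "\<dots> \<le> q (- x) + q (x + t *\<^sub>R a)" by (rule sublinear_add [OF assms])
  finally show "- q (- x) \<le> q (x + t *\<^sub>R a) - t * q a" by simp
qed

lemma tilt_le: "sublinear q \<Longrightarrow> t \<ge> 0 \<Longrightarrow> tilt q a x \<le> q (x + t *\<^sub>R a) - t * q a"
  unfolding tilt_def by (rule cINF_lower [OF tilt_bdd]) simp_all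

lemma tilt_le_self: "sublinear q \<Longrightarrow> tilt q a x \<le> q x"
  using tilt_le [of q 0 a x] by simp

lemma tilt_minus: "sublinear q \<Longrightarrow> tilt q a (- a) \<le> - q a"
  using tilt_le [of q 1 a "- a"] sublinear_zero [of q] by simp

text \<open>Parameters combine: \<open>s\<close> for \<open>x\<close> and \<open>t\<close> for
  \<open>y\<close> give the admissible parameter \<open>s + t\<close> for \<open>x + y\<close>, and
  \<open>c * t\<close> is admissible for \<open>c *\<^sub>R x\<close>.\<close>

lemma sublinear_tilt:
  assumes q: "sublinear q"
  shows "sublinear (tilt q a)"
  unfolding sublinear_def
proof (intro conjI allI impI)
  fix x y :: 'a
  have "tilt q a (x + y) - (q (x + s *\<^sub>R a) - s * q a) \<le> tilt q a y" if "s \<ge> 0" for s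
    unfolding tilt_def [of q a y]
  proof (rule cINF_greatest)
    fix t :: real assume "t \<in> {0..}"
    then have "tilt q a (x + y) \<le> q ((x + y) + (s + t) *\<^sub>R a) - (s + t) * q a"
      using that by (intro tilt_le q) simp
    also have "(x + y) + (s + t) *\<^sub>R a = (x + s *\<^sub>R a) + (y + t *\<^sub>R a)"
      by (simp add: algebra_simps)
    also have "q \<dots> \<le> q (x + s *\<^sub>R a) + q (y + t *\<^sub>R a)" by (rule sublinear_add [OF q])
    finally show "tilt q a (x + y) - (q (x + s *\<^sub>R a) - s * q a) \<le> q (y + t *\<^sub>R a) - t * q a"
      by (simp add: algebra_simps)
  qed simp
  then have "tilt q a (x + y) - tilt q a y \<le> tilt q a x"
    unfolding tilt_def [of q a x] by (intro cINF_greatest) (auto simp: algebra_simps)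
  then show "tilt q a (x + y) \<le> tilt q a x + tilt q a y" by simp
next
  fix c :: real and x :: 'a
  assume c: "0 \<le> c"
  show "tilt q a (c *\<^sub>R x) \<le> c * tilt q a x"
  proof (cases "c = 0")
    case True
    then show ?thesis using tilt_le_self [OF q, of a 0] sublinear_zero [OF q] by simp
  next
    case False
    with c have c: "c > 0" by simp
    have "tilt q a (c *\<^sub>R x) / c \<le> tilt q a x"
      unfolding tilt_def [of q a x]
    proof (rule cINF_greatest)
      fix t :: real assume t: "t \<in> {0..}"
      then have "tilt q a (c *\<^sub>R x) \<le> q (c *\<^sub>R x + (c * t) *\<^sub>R a) - (c * t) * q a"
        using c by (intro tilt_le q) simp
      also have "c *\<^sub>R x + (c * t) *\<^sub>R a = c *\<^sub>R (x + t *\<^sub>R a)" by (simp add: algebra_simps)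
      also have "q \<dots> = c * q (x + t *\<^sub>R a)" using c by (intro sublinear_scale q) simp
      finally show "tilt q a (c *\<^sub>R x) / c \<le> q (x + t *\<^sub>R a) - t * q a"
        using c by (simp add: field_simps)
    qed simp
    then show ?thesis using c by (simp add: field_simps)
  qed
qed

text \<open>Zorn's lemma is applied to sublinear functionals instead of partially defined linear ones:
  a minimal \<open>q\<close> equals all its tilts, which forces \<open>q (- a) \<le> - q a\<close>.\<close>

theorem hahn_banach_sublinear:
  fixes p :: "'a::real_vector \<Rightarrow> real"
  assumes p: "sublinear p"
  shows "\<exists>f. linear f \<and> (\<forall>x. f x \<le> p x) \<and> f y = p y"
proof -
  \<comment> \<open>Zorn's lemma is started below \<open>tilt p y\<close> rather than below
    \<open>p\<close>: this builds in \<open>f (- y) \<le> - p y\<close>, hence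
    \<open>f y = p y\<close> once \<open>f\<close> is linear.\<close>
  define Q where "Q = {q. sublinear q \<and> q \<le> tilt p y}"
  have "\<exists>m\<in>Q. \<forall>q\<in>Q. q \<le> m \<longrightarrow> q = m"
  proof (rule predicate_Zorn [where P = "\<lambda>a b. b \<le> a"])
    show "partial_order_on Q (relation_of (\<lambda>a b. b \<le> a) Q)"
      by (rule partial_order_on_relation_ofI) auto
  next
    fix C assume C: "C \<in> Chains (relation_of (\<lambda>a b. b \<le> a) Q)"
    then have CQ: "C \<subseteq> Q" and ch: "q \<le> q' \<or> q' \<le> q" if "q \<in> C" "q' \<in> C" for q q'
      using that by (auto simp: Chains_def relation_of_def)
    then have sub: "sublinear q" and leq: "q \<le> tilt p y" if "q \<in> C" for q
      using that by (auto simp: Q_def Chains_def relation_of_def)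
    show "\<exists>m\<in>Q. \<forall>q\<in>C. m \<le> q"
    proof (cases "C = {}")
      case True
      then show ?thesis using sublinear_tilt [OF p] by (auto simp: Q_def intro!: bexI [of _ "tilt p y"])
    next
      case False
      define m where "m x = (INF q\<in>C. q x)" for x
      have bdd: "bdd_below ((\<lambda>q. q x) ` C)" for x
      proof (rule bdd_belowI2)
        fix q assume q: "q \<in> C"
        show "- tilt p y (- x) \<le> q x"
          using leq [OF q] sublinear_minus [OF sub [OF q], of x]
          by (meson le_funD neg_le_iff_le order_trans)
      qed
      have le: "m x \<le> q x" if "q \<in> C" for q x
        unfolding m_def by (rule cINF_lower [OF bdd that])
      have great: "b \<le> m x" if "\<And>q. q \<in> C \<Longrightarrow> b \<le> q x" for b x
        unfolding m_def using False that by (intro cINF_greatest) auto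
      have "sublinear m"
        unfolding sublinear_def
      proof (intro conjI allI impI)
        fix x z :: 'a
        \<comment> \<open>Two members of a chain are comparable, so the smaller one serves both
          arguments.\<close>
        have "m (x + z) \<le> q x + q' z" if "q \<in> C" "q' \<in> C" for q q'
          using ch [OF that]
        proof
          assume "q \<le> q'"
          then show ?thesis
            using le [OF that(1), of "x + z"] sublinear_add [OF sub [OF that(1)], of x z]
            by (smt (verit) le_funD)
        next
          assume "q' \<le> q"
          then show ?thesis
            using le [OF that(2), of "x + z"] sublinear_add [OF sub [OF that(2)], of x z]
            by (smt (verit) le_funD)
        qed
        then have "m (x + z) - q x \<le> m z" if "q \<in> C" for q
          using that using that by (intro great) (smt (verit))
        have "m (x + z) - m z \<le> q x" if "q \<in> C" for q
          using \<open>\<And>q. q \<in> C \<Longrightarrow> m (x + z) - q x \<le> m z\<close> [OF that] by simp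
        then have "m (x + z) - m z \<le> m x" by (rule great)
        then show "m (x + z) \<le> m x + m z" by simp
      next
        fix c :: real and x :: 'a
        assume c: "0 \<le> c"
        obtain q0 where q0: "q0 \<in> C" using False by blast
        show "m (c *\<^sub>R x) \<le> c * m x"
        proof (cases "c = 0")
          case True
          then show ?thesis using le [OF q0, of 0] sublinear_zero [OF sub [OF q0]] by simp
        next
          case False
          have "m (c *\<^sub>R x) / c \<le> m x"
          proof (rule great)
            fix q assume q: "q \<in> C"
            have "m (c *\<^sub>R x) \<le> c * q x"
              using le [OF q, of "c *\<^sub>R x"] sublinear_scale [OF sub [OF q] c, of x] by simp
            then show "m (c *\<^sub>R x) / c \<le> q x" using c False by (simp add: field_simps)
          qed
          then show ?thesis using c False by (simp add: field_simps)
        qed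
      qed
      moreover have "m \<le> tilt p y"
      proof (rule le_funI)
        fix x
        obtain q where q: "q \<in> C" using False by blast
        show "m x \<le> tilt p y x" using le [OF q, of x] leq [OF q] by (meson le_funD order_trans)
      qed
      ultimately have "m \<in> Q" by (simp add: Q_def)
      then show ?thesis using le by (auto simp: le_fun_def)
    qed
  qed
  then obtain f where f: "sublinear f" "f \<le> tilt p y"
    and min: "\<And>q. sublinear q \<Longrightarrow> q \<le> tilt p y \<Longrightarrow> q \<le> f \<Longrightarrow> q = f"
    unfolding Q_def by blast
  have neg: "f (- a) = - f a" for a
  proof -
    have "tilt f a \<le> f" by (simp add: le_fun_def tilt_le_self [OF f(1)])
    then have "tilt f a = f"
      using f(2) by (intro min sublinear_tilt f(1)) auto
    then have "f (- a) \<le> - f a" using tilt_minus [OF f(1), of a] by simp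
    with sublinear_minus [OF f(1), of a] show ?thesis by simp
  qed
  have "linear f"
  proof (rule linearI)
    fix x z :: 'a
    show "f (x + z) = f x + f z"
      using sublinear_add [OF f(1), of x z] sublinear_add [OF f(1), of "x + z" "- z"] neg [of z]
      by simp
  next
    fix c :: real and x :: 'a
    show "f (c *\<^sub>R x) = c *\<^sub>R f x"
    proof (cases "c \<ge> 0")
      case True
      then show ?thesis using sublinear_scale [OF f(1)] by simp
    next
      case False
      then have "f ((- c) *\<^sub>R x) = - c * f x" by (intro sublinear_scale f(1)) simp
      then show ?thesis using neg [of "c *\<^sub>R x"] by simp
    qed
  qed
  moreover have le: "f x \<le> p x" for x
    using f(2) tilt_le_self [OF p, of y x] by (meson le_funD order_trans)
  moreover have "f y = p y"
    using neg [of y] f(2) tilt_minus [OF p, of y] le [of y] by (smt (verit) le_funD)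
  ultimately show ?thesis by blast
qed

text \<open>Spelled out instead of \<open>bounded_clinear\<close>, since the scalars
  \<open>complex\<close> are not made an instance of \<open>complex_normed_vector\<close>.\<close>

definition functional :: "('a::complex_normed_vector \<Rightarrow> complex) \<Rightarrow> bool" where
  "functional f \<longleftrightarrow> bounded_linear f \<and> (\<forall>c x. f (c *\<^sub>C x) = c * f x)"

lemma scaleR_scaleC_assoc: "c *\<^sub>C (t *\<^sub>R x) = (c * of_real t) *\<^sub>C x"
  and scaleR_scaleC_assoc': "t *\<^sub>R (c *\<^sub>C x) = (of_real t * c) *\<^sub>C x"
  by (simp_all flip: scaleC_of_real add: scaleC_scaleC)

lemma scaleC_one [simp]: "1 *\<^sub>C x = x"
  and scaleC_zero_left [simp]: "0 *\<^sub>C x = 0"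
  and scaleC_zero_right [simp]: "c *\<^sub>C 0 = 0"
  and scaleC_minus_left: "(- c) *\<^sub>C x = - (c *\<^sub>C x)"
  and scaleC_minus_right: "c *\<^sub>C (- x) = - (c *\<^sub>C x)"
  and scaleC_diff_left: "(c - d) *\<^sub>C x = c *\<^sub>C x - d *\<^sub>C x"
  and scaleC_diff_right: "c *\<^sub>C (x - y) = c *\<^sub>C x - c *\<^sub>C y"
  by (rule complex_vector.scale_one complex_vector.scale_zero_left
      complex_vector.scale_zero_right complex_vector.scale_minus_left complex_vector.scale_minus_right
      complex_vector.scale_left_diff_distrib complex_vector.scale_right_diff_distrib)+

text \<open>A real functional \<open>g\<close> dominated by \<open>p\<close> is made complex linear
  by f x = g x - i g (i x). Rotating \<open>x\<close> by a unimodular scalar gives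
  \<open>cmod (f x) \<le> p x\<close>, and the bound \<open>N\<close> supplies continuity. At
  \<open>y\<close> the real part already equals \<open>p y\<close>, so the imaginary part
  vanishes.\<close>

theorem hahn_banach_seminorm:
  fixes p :: "'a::complex_normed_vector \<Rightarrow> real"
  assumes add: "\<And>x y. p (x + y) \<le> p x + p y"
    and scale: "\<And>c x. p (c *\<^sub>C x) \<le> cmod c * p x"
    and bound: "\<And>x. p x \<le> N * norm x"
  shows "\<exists>f. functional f \<and> (\<forall>x. cmod (f x) \<le> p x) \<and> f y = of_real (p y)"
proof -
  have "sublinear p"
    unfolding sublinear_def
  proof (intro conjI allI impI add)
    show "p (c *\<^sub>R x) \<le> c * p x" if "0 \<le> c" for c x
      using scale [of "of_real c" x] that by (simp add: scaleC_of_real)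
  qed
  from hahn_banach_sublinear [OF this, of y] obtain g
    where g: "linear g" "\<And>x. g x \<le> p x" "g y = p y" by blast
  define f where "f x = Complex (g x) (- g (\<i> *\<^sub>C x))" for x
  have scaleC: "f (c *\<^sub>C x) = c * f x" for c x
  proof -
    have "of_real (Re c) + of_real (Im c) * \<i> = c" by (simp add: complex_eq_iff)
    then have 1: "c *\<^sub>C x = Re c *\<^sub>R x + Im c *\<^sub>R \<i> *\<^sub>C x"
      unfolding scaleC_of_real [symmetric] scaleC_scaleC scaleC_add_left [symmetric] by simp
    have "of_real (Re c) * \<i> - of_real (Im c) = \<i> * c" by (simp add: complex_eq_iff)
    then have 2: "\<i> *\<^sub>C c *\<^sub>C x = Re c *\<^sub>R \<i> *\<^sub>C x - Im c *\<^sub>R x"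
      unfolding scaleC_of_real [symmetric] scaleC_scaleC scaleC_diff_left [symmetric] by simp
    show ?thesis
      unfolding f_def 2 unfolding 1
      by (simp add: complex_eq_iff linear_add [OF g(1)] linear_diff [OF g(1)] linear_scale [OF g(1)])
  qed
  have le: "cmod (f x) \<le> p x" for x
  proof (cases "f x = 0")
    case True
    then show ?thesis using \<open>sublinear p\<close> scale [of 0 x] add [of x "- x"] scale [of "-1" x]
        sublinear_zero [OF \<open>sublinear p\<close>]
      by (simp add: scaleC_minus_left)
  next
    case False
    define c where "c = cnj (f x) / of_real (cmod (f x))"
    have c: "cmod c = 1" using False by (simp add: c_def norm_divide)
    have "c * f x = of_real (cmod (f x))"
      using False by (simp add: c_def complex_norm_square [symmetric] power2_eq_square mult.commute)
    then have "of_real (cmod (f x)) = f (c *\<^sub>C x)" by (simp add: scaleC)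
    then have "cmod (f x) = g (c *\<^sub>C x)" unfolding f_def by (metis Re_complex_of_real complex.sel(1))
    also have "\<dots> \<le> p x" using g(2) [of "c *\<^sub>C x"] scale [of c x] c by simp
    finally show ?thesis .
  qed
  have bl: "bounded_linear f"
  proof (rule bounded_linear_intro)
    show "f (x + z) = f x + f z" for x z
      by (simp add: f_def complex_eq_iff scaleC_add_right linear_add [OF g(1)])
    show "f (r *\<^sub>R x) = r *\<^sub>R f x" for r x
      using scaleC [of "of_real r" x] by (simp add: scaleC_of_real scaleR_conv_of_real)
    show "norm (f x) \<le> norm x * N" for x
      using le [of x] bound [of x] by (simp add: mult.commute)
  qed
  have "f y = of_real (p y)"
  proof -
    have "Re (f y) = p y" by (simp add: f_def g)
    moreover have "cmod (f y) \<le> p y" by (rule le)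
    ultimately have "Im (f y) = 0"
      using cmod_power2 [of "f y"] power_mono [of "cmod (f y)" "p y" 2] by simp
    with \<open>Re (f y) = p y\<close> show ?thesis by (simp add: complex_eq_iff)
  qed
  with bl scaleC le show ?thesis unfolding functional_def by blast
qed

lemma norming_functional:
  fixes y :: "'a::complex_normed_vector"
  shows "\<exists>f. functional f \<and> (\<forall>x. cmod (f x) \<le> norm x) \<and> f y = of_real (norm y)"
  by (rule hahn_banach_seminorm [where N = 1]) (simp_all add: norm_triangle_ineq norm_scaleC)

text \<open>Baire: the closed level sets \<open>G n\<close> cover the space, so one of them contains
  a ball of radius \<open>e\<close>. Scaling \<open>z\<close> to length \<open>e / 2\<close> and
  subtracting the values at two points of the ball gives the factor
  \<open>4 * n / e\<close>.\<close>

theorem uniform_boundedness: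
  fixes F :: "('a::banach \<Rightarrow> 'b::real_normed_vector) set"
  assumes lin: "\<And>f. f \<in> F \<Longrightarrow> bounded_linear f"
    and pw: "\<And>x. \<exists>K. \<forall>f\<in>F. norm (f x) \<le> K"
  shows "\<exists>K. \<forall>f\<in>F. \<forall>x. norm (f x) \<le> K * norm x"
proof -
  define G where "G n = {x. \<forall>f\<in>F. norm (f x) \<le> real n}" for n
  have clG: "closed (G n)" for n
  proof -
    have "closed {x. norm (f x) \<le> real n}" if "f \<in> F" for f
      using bounded_linear.continuous_on [OF lin [OF that] continuous_on_id]
      by (intro closed_Collect_le continuous_intros) auto
    moreover have "G n = (\<Inter>f\<in>F. {x. norm (f x) \<le> real n})" by (auto simp: G_def)
    ultimately show ?thesis by (simp add: closed_INT)
  qed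
  have "\<Union>(range G) = UNIV"
  proof -
    have "x \<in> \<Union>(range G)" for x
    proof -
      obtain K where K: "\<And>f. f \<in> F \<Longrightarrow> norm (f x) \<le> K" using pw by blast
      obtain n where "K \<le> real n" using real_arch_simple by blast
      then have "x \<in> G n" using K unfolding G_def by (auto intro: order_trans)
      then show ?thesis by blast
    qed
    then show ?thesis by blast
  qed
  moreover have "interior (\<Union>(range G)) = {}" if none: "\<And>n. interior (G n) = {}"
  proof -
    have "(euclidean :: 'a topology) interior_of \<Union>(range G) = {}"
    proof (rule Baire_category_alt)
      show "completely_metrizable_space (euclidean :: 'a topology) \<or>
          locally_compact_space (euclidean :: 'a topology) \<and> regular_space (euclidean :: 'a topology)"
        using completely_metrizable_space_euclidean by blast
      show "closedin euclidean S \<and> euclidean interior_of S = {}" if S: "S \<in> range G" for S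
        using S none clG by (metis closed_closedin euclidean_interior_of imageE)
    qed simp
    then show ?thesis by simp
  qed
  ultimately have "\<exists>n. interior (G n) \<noteq> {}"
    by (metis interior_UNIV UNIV_not_empty)
  then obtain n where "interior (G n) \<noteq> {}" by blast
  then obtain x where "x \<in> interior (G n)" by blast
  then obtain e where e: "e > 0" "ball x e \<subseteq> G n" by (auto simp: mem_interior)
  have "norm (f z) \<le> (4 * real n / e) * norm z" if f: "f \<in> F" for f z
  proof (cases "z = 0")
    case True
    then show ?thesis using linear_0 bounded_linear.linear [OF lin [OF f]] by fastforce
  next
    case False
    interpret bounded_linear f by (rule lin [OF f])
    define s where "s = e / (2 * norm z)"
    have s: "s > 0" using e False by (simp add: s_def)
    have "norm (s *\<^sub>R z) < e" using e False by (simp add: s_def)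
    then have "x + s *\<^sub>R z \<in> ball x e" "x \<in> ball x e" using e by (auto simp: dist_norm)
    then have "x + s *\<^sub>R z \<in> G n" "x \<in> G n" using e by blast+
    then have "norm (f (x + s *\<^sub>R z)) \<le> n" "norm (f x) \<le> n" using f by (auto simp: G_def)
    then have "norm (f (x + s *\<^sub>R z) - f x) \<le> 2 * n"
      using norm_triangle_ineq4 [of "f (x + s *\<^sub>R z)" "f x"] by linarith
    then have "s * norm (f z) \<le> 2 * n" using s by (simp add: add scale)
    then show ?thesis using e False by (simp add: s_def field_simps)
  qed
  then show ?thesis by blast
qed


section \<open>Hartogs' lemma\<close>

text \<open>On the unit circle \<open>cnj z\<close> is the inverse of \<open>z\<close>, so paired
  powers cancel and only one-sided powers remain, up to conjugation. This closes the real parts of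
  polynomials under multiplication on the circle.\<close>

lemma circle_Re_cnj:
  fixes p q :: "complex poly"
  shows "\<exists>r. \<forall>z\<in>sphere 0 1. Re (poly p z * cnj (poly q z)) = Re (poly r z)"
proof (induction p arbitrary: q)
  case 0
  show ?case by (rule exI [of _ 0]) simp
next
  case (pCons a p)
  obtain b q' where q: "q = pCons b q'" by (rule pCons_cases)
  obtain r where r: "\<And>z. z \<in> sphere 0 1 \<Longrightarrow> Re (poly p z * cnj (poly q' z)) = Re (poly r z)"
    using pCons.IH [of q'] by blast
  show ?case
  proof (intro exI ballI)
    fix z :: complex assume z: "z \<in> sphere 0 1"
    then have "z * cnj z = 1" by (simp add: complex_norm_square [symmetric])
    then have "poly (pCons a p) z * cnj (poly q z) =
        a * cnj (poly q z) + z * poly p z * cnj b + poly p z * cnj (poly q' z)"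
      by (simp add: q algebra_simps)
    moreover have "Re (a * cnj (poly q z)) = Re (poly (smult (cnj a) q) z)" by simp
    moreover have "Re (z * poly p z * cnj b) = Re (poly (smult (cnj b) (pCons 0 p)) z)" by (simp add: algebra_simps)
    ultimately show "Re (poly (pCons a p) z * cnj (poly q z))
        = Re (poly (smult (cnj a) q + smult (cnj b) (pCons 0 p) + r) z)"
      using r [OF z] by simp
  qed
qed

lemma Re_mult_Re: "Re a * Re b = Re (a * b + a * cnj b) / 2"
  by simp

text \<open>Stone--Weierstrass for real trigonometric polynomials. They are kept as real parts of
  complex polynomials because these come with a harmonic extension to the disc.\<close>

lemma circle_approx_Re_poly:
  fixes f :: "complex \<Rightarrow> real"
  assumes f: "continuous_on (sphere 0 1) f" and e: "e > 0"
  shows "\<exists>p. \<forall>z\<in>sphere 0 1. \<bar>f z - Re (poly p z)\<bar> < e"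
proof -
  define P where "P f \<longleftrightarrow> (\<exists>p. \<forall>z\<in>sphere 0 1. f z = Re (poly p z))" for f :: "complex \<Rightarrow> real"
  have 1: "P (\<lambda>x. c)" for c
    unfolding P_def by (intro exI [of _ "[:complex_of_real c:]"] ballI) simp
  have 2: "continuous_on (sphere 0 1) g" if "P g" for g
  proof -
    obtain p where "\<forall>z\<in>sphere 0 1. g z = Re (poly p z)" using \<open>P g\<close> unfolding P_def by (elim exE)
    moreover have "continuous_on (sphere 0 1) (\<lambda>z. Re (poly p z))" by (intro continuous_intros)
    ultimately show ?thesis by (metis (no_types, lifting) continuous_on_cong)
  qed
  have 3: "P (\<lambda>x. g x + h x)" if "P g \<and> P h" for g h
  proof -
    obtain p where "\<forall>z\<in>sphere 0 1. g z = Re (poly p z)"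
      using \<open>P g \<and> P h\<close> [THEN conjunct1] unfolding P_def by (elim exE)
    moreover obtain q where "\<forall>z\<in>sphere 0 1. h z = Re (poly q z)"
      using \<open>P g \<and> P h\<close> [THEN conjunct2] unfolding P_def by (elim exE)
    ultimately show ?thesis unfolding P_def by (intro exI [of _ "p + q"]) simp
  qed
  have 4: "P (\<lambda>x. g x * h x)" if "P g \<and> P h" for g h
  proof -
    obtain p where p: "\<forall>z\<in>sphere 0 1. g z = Re (poly p z)"
      using \<open>P g \<and> P h\<close> [THEN conjunct1] unfolding P_def by (elim exE)
    obtain q where q: "\<forall>z\<in>sphere 0 1. h z = Re (poly q z)"
      using \<open>P g \<and> P h\<close> [THEN conjunct2] unfolding P_def by (elim exE)
    obtain r where r: "\<forall>z\<in>sphere 0 1. Re (poly p z * cnj (poly q z)) = Re (poly r z)"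
      using circle_Re_cnj by blast
    have "g z * h z = Re (poly (smult (1/2) (p * q + r)) z)" if "z \<in> sphere 0 1" for z
      using p q r that Re_mult_Re [of "poly p z" "poly q z"] by simp
    then show ?thesis unfolding P_def by (intro exI ballI)
  qed
  have 5: "\<exists>g. P g \<and> g x \<noteq> g y" if "x \<in> sphere 0 1 \<and> y \<in> sphere 0 1 \<and> x \<noteq> y" for x y
  proof (cases "Re x = Re y")
    case True
    with that have "Im x \<noteq> Im y" by (auto simp: complex_eq_iff)
    moreover have "P Im" unfolding P_def by (intro exI [of _ "[:0, -\<i>:]"]) simp
    ultimately show ?thesis by (intro exI [of _ Im] conjI)
  next
    case False
    moreover have "P Re" unfolding P_def by (intro exI [of _ "[:0, 1:]"]) simp
    ultimately show ?thesis by (intro exI [of _ Re] conjI)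
  qed
  have "\<exists>g. P g \<and> (\<forall>x\<in>sphere 0 1. \<bar>f x - g x\<bar> < e)"
    by (rule Stone_Weierstrass_HOL [of "sphere 0 1" P f e, OF compact_sphere 1 2 3 4 5 f e]) auto
  then show ?thesis unfolding P_def by metis
qed

text \<open>Mean value property of a harmonic polynomial, from Cauchy's formula at the centre of the
  disc.\<close>

lemma circle_mean_Re_poly:
  "((\<lambda>t. Re (poly p (cis t))) has_integral 2 * pi * Re (poly p 0)) {0..2 * pi}"
proof -
  have "((\<lambda>w. poly p w / (w - 0)) has_contour_integral 2 * of_real pi * \<i> * poly p 0) (circlepath 0 1)"
    by (rule Cauchy_integral_circlepath_simple) (auto intro!: holomorphic_intros)
  then have "((\<lambda>t. poly p (cis t) / cis t * (\<i> * cis t)) has_integral 2 * of_real pi * \<i> * poly p 0) {0..2 * pi}"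
    unfolding circlepath_def
    by (subst (asm) has_contour_integral_part_circlepath_iff) (simp_all add: mult_ac)
  then have "((\<lambda>t. - \<i> * (poly p (cis t) / cis t * (\<i> * cis t))) has_integral
      - \<i> * (2 * of_real pi * \<i> * poly p 0)) {0..2 * pi}"
    by (rule has_integral_mult_right)
  then have "((\<lambda>t. poly p (cis t)) has_integral 2 * of_real pi * poly p 0) {0..2 * pi}"
    by (simp add: mult_ac)
  from has_integral_linear [OF this bounded_linear_Re] show ?thesis
    by (simp add: o_def)
qed

text \<open>Harnack's inequality with constant \<open>3 = (1 + 1/2) / (1 - 1/2)\<close>, by the
  Schwarz lemma after a Cayley transform of the right half-plane.\<close>

lemma harnack_half:
  assumes hol: "f holomorphic_on ball 0 1" and pos: "\<And>z. norm z < 1 \<Longrightarrow> 0 < Re (f z)"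
    and z: "norm z \<le> 1/2"
  shows "Re (f z) \<le> 3 * Re (f 0)"
proof -
  define a where "a = Re (f 0)"
  \<comment> \<open>Removing the imaginary part at 0 makes \<open>h 0\<close> the positive real
    \<open>a\<close>, the point that the Cayley transform \<open>F\<close> sends to 0.\<close>
  define h where "h w = f w - \<i> * of_real (Im (f 0))" for w
  have h0: "h 0 = of_real a" by (simp add: h_def a_def complex_eq_iff)
  have hpos: "0 < Re (h w)" if "norm w < 1" for w using pos [OF that] by (simp add: h_def)
  have a: "a > 0" using pos [of 0] by (simp add: a_def)
  have nz: "h w + of_real a \<noteq> 0" if "norm w < 1" for w
    using hpos [OF that] a by (auto simp: complex_eq_iff)
  define F where "F w = (h w - of_real a) / (h w + of_real a)" for w
  have "norm (F z) \<le> norm z"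
  proof (rule Schwarz_Lemma(1))
    show "F holomorphic_on ball 0 1"
      unfolding F_def h_def using nz
      by (intro holomorphic_intros hol) (auto simp: h_def dist_norm)
    show "F 0 = 0" by (simp add: F_def h0)
    show "norm (F w) < 1" if "norm w < 1" for w
    proof -
      have "(norm (h w - of_real a))\<^sup>2 < (norm (h w + of_real a))\<^sup>2"
        using hpos [OF that] a unfolding cmod_power2 by (simp add: power2_eq_square algebra_simps)
      then have "norm (h w - of_real a) < norm (h w + of_real a)" by (simp add: power_less_imp_less_base)
      then show ?thesis using nz [OF that] by (simp add: F_def norm_divide)
    qed
    show "norm z < 1" using z by simp
  qed
  with z have "norm (F z) \<le> 1/2" by simp
  then have "norm (h z - of_real a) \<le> norm (h z + of_real a) / 2"
    using nz [of z] z by (simp add: F_def norm_divide field_simps)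
  also have "h z + of_real a = (h z - of_real a) + of_real (2 * a)" by simp
  also have "norm \<dots> \<le> norm (h z - of_real a) + 2 * a"
    using a by (intro order_trans [OF norm_triangle_ineq]) simp
  finally have "norm (h z - of_real a) \<le> 2 * a" by simp
  then have "Re (h z - of_real a) \<le> 2 * a" using complex_Re_le_cmod order_trans by blast
  then show ?thesis by (simp add: h_def a_def)
qed

text \<open>Subharmonicity of \<open>ln |F|\<close> in quantitative form. A polynomial
  \<open>p\<close> with real part slightly above \<phi> on the circle gives a harmonic majorant
  \<open>L * Re p\<close>; the maximum principle for \<open>F * exp (- L * p)\<close> moves the
  bound inside, and Harnack's inequality compares it with its value at 0, which is a circle
  mean.\<close>

lemma log_subharmonic_bound:
  assumes F: "F holomorphic_on ball 0 1" "continuous_on (cball 0 1) F"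
    and phi: "continuous_on (sphere 0 1) \<phi>" "\<And>z. z \<in> sphere 0 1 \<Longrightarrow> 0 \<le> \<phi> z"
    and le: "\<And>z. z \<in> sphere 0 1 \<Longrightarrow> cmod (F z) \<le> exp (L * \<phi> z)" and L: "L > 0"
    and z: "norm z \<le> 1/2"
  shows "cmod (F z) \<le> exp (L * (3 * (integral {0..2 * pi} (\<lambda>t. \<phi> (cis t)) / (2 * pi))))"
proof -
  define m where "m = integral {0..2 * pi} (\<lambda>t. \<phi> (cis t)) / (2 * pi)"
  have "cmod (F z) \<le> exp (L * (3 * (m + 2 * e)))" if e: "e > 0" for e
  proof -
    obtain p0 where p0: "\<And>z. z \<in> sphere 0 1 \<Longrightarrow> \<bar>\<phi> z - Re (poly p0 z)\<bar> < e / 2"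
      using circle_approx_Re_poly [OF phi(1), of "e / 2"] e by (metis half_gt_zero)
    \<comment> \<open>The shift by \<open>e\<close> exceeds the approximation error
      \<open>e / 2\<close>, so \<open>Re p\<close> stays above \<open>\<phi> + e / 2\<close>; this
      gives the strict positivity that Harnack's inequality requires.\<close>
    define p where "p = p0 + [:of_real e:]"
    have p: "\<phi> z + e / 2 < Re (poly p z)" "Re (poly p z) \<le> \<phi> z + 2 * e" if "z \<in> sphere 0 1" for z
      using p0 [OF that] unfolding p_def poly_add plus_complex.sel by (simp_all add: abs_if split: if_splits)
    have pos: "0 < Re (poly p w)" if w: "norm w < 1" for w
    proof -
      \<comment> \<open>Minimum principle for the harmonic function \<open>Re p\<close>, read off
        from the modulus of \<open>exp (- p)\<close>.\<close>
      have "norm (exp (- poly p w)) \<le> exp (- (e / 2))"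
      proof (rule maximum_modulus_frontier [where S = "ball 0 1" and f = "\<lambda>w. exp (- poly p w)", OF _ _ bounded_ball])
        show "(\<lambda>w. exp (- poly p w)) holomorphic_on interior (ball 0 1)"
          by (intro holomorphic_intros)
        show "norm (exp (- poly p x)) \<le> exp (- (e / 2))" if "x \<in> frontier (ball (0::complex) 1)" for x
          using that p(1) [of x] phi(2) [of x] by (simp add: frontier_ball)
      qed (use w in \<open>auto intro!: continuous_intros\<close>)
      then have "e / 2 \<le> Re (poly p w)" by simp
      then have "0 < Re (poly p w)" using e by simp
      then show ?thesis by simp
    qed
    have zl: "norm z < 1" using z by simp
    have "norm (F z * exp (- (of_real L * poly p z))) \<le> 1"
    proof (rule maximum_modulus_frontier [where S = "ball 0 1" and f = "\<lambda>w. F w * exp (- (of_real L * poly p w))", OF _ _ bounded_ball])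
      show "(\<lambda>w. F w * exp (- (of_real L * poly p w))) holomorphic_on interior (ball 0 1)"
        using F(1) by (auto intro!: holomorphic_intros)
      show "continuous_on (closure (ball 0 1)) (\<lambda>w. F w * exp (- (of_real L * poly p w)))"
        using F(2) by (auto intro!: continuous_intros)
      show "norm (F x * exp (- (of_real L * poly p x))) \<le> 1" if "x \<in> frontier (ball (0::complex) 1)" for x
      proof -
        have x: "x \<in> sphere 0 1" using that by (simp add: frontier_ball)
        have "norm (F x * exp (- (of_real L * poly p x))) \<le> exp (L * \<phi> x) * exp (- (L * Re (poly p x)))"
          using le [OF x] by (simp add: norm_mult)
        also have "\<dots> = exp (L * (\<phi> x - Re (poly p x)))" by (simp add: exp_add [symmetric] algebra_simps)
        also have "\<dots> \<le> 1" using L p(1) [OF x] e by (simp add: mult_le_0_iff)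
        finally show ?thesis .
      qed
    qed (use zl in auto)
    then have "cmod (F z) \<le> exp (L * Re (poly p z))"
      by (simp add: exp_minus norm_divide divide_simps flip: divide_inverse)
    also have "\<dots> \<le> exp (L * (3 * Re (poly p 0)))"
      using harnack_half [of "poly p" z] pos z L by (simp add: holomorphic_intros)
    also have "\<dots> \<le> exp (L * (3 * (m + 2 * e)))"
    proof -
      have "continuous_on {0..2 * pi} (\<lambda>t. \<phi> (cis t))"
        by (rule continuous_on_compose2 [OF phi(1)]) (auto intro!: continuous_intros)
      then have "((\<lambda>t. \<phi> (cis t)) has_integral 2 * pi * m) {0..2 * pi}"
        by (simp add: m_def integrable_continuous_interval integrable_integral)
      from has_integral_add [OF this has_integral_const_real [of "2 * e" 0 "2 * pi"]]
      have "((\<lambda>t. \<phi> (cis t) + 2 * e) has_integral 2 * pi * m + 2 * pi * (2 * e)) {0..2 * pi}"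
        by simp
      from has_integral_le [OF circle_mean_Re_poly [of p] this]
      have "2 * pi * Re (poly p 0) \<le> 2 * pi * (m + 2 * e)"
        using p(2) by (simp add: algebra_simps)
      then have "Re (poly p 0) \<le> m + 2 * e" by simp
      then show ?thesis using L by simp
    qed
    finally show ?thesis .
  qed
  then have ev: "\<forall>\<^sub>F e in at_right 0. cmod (F z) \<le> exp (L * (3 * (m + 2 * e)))"
    by (simp add: eventually_at_filter)
  have "((\<lambda>e. exp (L * (3 * (m + 2 * e)))) \<longlongrightarrow> exp (L * (3 * (m + 2 * 0)))) (at_right 0)"
    by (intro tendsto_intros)
  from tendsto_lowerbound [OF this ev] show ?thesis
    by (simp add: m_def)
qed


text \<open>On a fixed circle the positive parts of \<open>ln |F n|\<close>, divided by
  \<open>L n = ln (1 / s n)\<close>, are bounded by the growth rate and tend to 0 at each point.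
  Dominated convergence makes their means tend to 0, and three times the mean is eventually below
  \<open>1/2\<close>. The bound \<open>s n \<le> 1/2\<close> keeps \<open>L n \<ge> ln 2\<close>,
  which makes the dominating constant finite.\<close>

lemma hartogs_sequence:
  fixes F :: "nat \<Rightarrow> complex \<Rightarrow> complex" and s :: "nat \<Rightarrow> real"
  assumes rho: "\<rho> > 0" and hol: "\<And>n. F n holomorphic_on ball 0 \<rho>"
    and s: "\<And>n. 0 < s n" "\<And>n. s n \<le> 1/2" "s \<longlonglongrightarrow> 0"
    and growth: "\<And>n z. z \<in> ball 0 \<rho> \<Longrightarrow> cmod (F n z) \<le> C * s n powr (- \<alpha>)"
    and C: "C \<ge> 1" and alpha: "\<alpha> \<ge> 0"
    and pw: "\<And>z. z \<in> ball 0 \<rho> \<Longrightarrow> \<exists>K. \<forall>n. cmod (F n z) \<le> K"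
  shows "\<forall>\<^sub>F n in sequentially. \<forall>z\<in>cball 0 (\<rho>/4). cmod (F n z) \<le> s n powr (- (1/2))"
proof -
  define L where "L n = - ln (s n)" for n
  have L2: "ln 2 \<le> L n" for n
    using s(1,2) [of n] ln_mono [of "s n" "1/2"] by (simp add: L_def ln_div)
  then have L: "L n > 0" for n using ln_gt_zero [of 2] by (smt (verit))
  have powr: "s n powr (- a) = exp (L n * a)" for n a
    using s(1) [of n] by (simp add: powr_def L_def mult.commute)
  have Linf: "filterlim L at_top sequentially"
    unfolding L_def filterlim_uminus_at_bot [symmetric]
    using s(1,3) by (intro filterlim_compose [OF ln_at_0]) (auto simp: filterlim_at less_imp_neq [THEN not_sym])
  \<comment> \<open>Rescaling takes the circle of radius \<open>\<rho> / 2\<close> to the unit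
    circle; the disc of radius \<open>1/2\<close> inside it corresponds to
    \<open>cball 0 (\<rho>/4)\<close>.\<close>
  define G where "G n z = F n (of_real (\<rho>/2) * z)" for n z
  \<comment> \<open>Truncation at 1 keeps \<phi> nonnegative, and continuous at zeros of
    \<open>G n\<close>.\<close>
  define \<phi> where "\<phi> n z = ln (max 1 (cmod (G n z))) / L n" for n z
  have inb: "of_real (\<rho>/2) * z \<in> ball 0 \<rho>" if "norm z \<le> 1" for z :: complex
    using that rho mult_left_mono [OF that, of "\<rho>/2"] by (simp add: norm_mult)
  have Ghol: "G n holomorphic_on cball 0 1" for n
  proof -
    have "(F n \<circ> (\<lambda>z. of_real (\<rho>/2) * z)) holomorphic_on cball 0 1"
      using inb by (intro holomorphic_on_compose_gen [OF _ hol]) (auto intro!: holomorphic_intros)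
    then show ?thesis by (simp add: G_def [abs_def] o_def)
  qed
  have Gcont: "continuous_on (cball 0 1) (G n)" for n
    by (rule holomorphic_on_imp_continuous_on [OF Ghol])
  have phi_cont: "continuous_on (sphere 0 1) (\<phi> n)" for n
    unfolding \<phi>_def using L [of n]
    by (intro continuous_intros continuous_on_subset [OF Gcont]) auto
  have phi0: "0 \<le> \<phi> n z" for n z
    using L [of n] by (simp add: \<phi>_def)
  have lim: "(\<lambda>n. integral {0..2 * pi} (\<lambda>t. \<phi> n (cis t))) \<longlonglongrightarrow> integral {0..2 * pi} (\<lambda>t. 0)"
  proof (rule dominated_convergence(2))
    show "(\<lambda>t. \<phi> n (cis t)) integrable_on {0..2 * pi}" for n
      by (intro integrable_continuous_interval continuous_on_compose2 [OF phi_cont])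
        (auto intro!: continuous_intros)
    show "(\<lambda>t. \<alpha> + ln C / ln 2) integrable_on {0..2 * pi}" by (rule integrable_const_ivl)
    show "norm (\<phi> n (cis t)) \<le> \<alpha> + ln C / ln 2" for n t
    proof -
      have "max 1 (cmod (G n (cis t))) \<le> C * exp (L n * \<alpha>)"
        using growth [OF inb, of "cis t" n] powr [of n \<alpha>] C alpha L [of n] mult_mono [of 1 C 1 "exp (L n * \<alpha>)"]
        by (simp add: G_def)
      then have "ln (max 1 (cmod (G n (cis t)))) \<le> ln (C * exp (L n * \<alpha>))"
        by (intro ln_mono) auto
      also have "\<dots> = ln C + L n * \<alpha>" using C by (simp add: ln_mult)
      finally have "\<phi> n (cis t) \<le> ln C / L n + \<alpha>"
        using L [of n] by (simp add: \<phi>_def field_simps)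
      also have "ln C / L n \<le> ln C / ln 2"
        using L2 [of n] C by (intro divide_left_mono) (auto intro: mult_pos_pos L)
      finally show ?thesis using phi0 by simp
    qed
    show "(\<lambda>n. \<phi> n (cis t)) \<longlonglongrightarrow> 0" for t
    proof -
      obtain K where K: "\<And>n. cmod (G n (cis t)) \<le> K"
        using pw [OF inb, of "cis t"] by (auto simp: G_def)
      have "(\<lambda>n. ln (max 1 K) / L n) \<longlonglongrightarrow> 0"
        by (rule real_tendsto_divide_at_top [OF tendsto_const Linf])
      then show ?thesis
      proof (rule Lim_null_comparison [rotated], intro always_eventually allI)
        fix n
        have "ln (max 1 (cmod (G n (cis t)))) \<le> ln (max 1 K)"
          using K [of n] by (intro ln_mono) auto
        then show "norm (\<phi> n (cis t)) \<le> ln (max 1 K) / L n"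
          using phi0 [of n "cis t"] L [of n] by (simp add: \<phi>_def divide_right_mono)
      qed
    qed
  qed
  then have "(\<lambda>n. 3 * (integral {0..2 * pi} (\<lambda>t. \<phi> n (cis t)) / (2 * pi))) \<longlonglongrightarrow> 3 * (0 / (2 * pi))"
    by (intro tendsto_intros) auto
  then have "\<forall>\<^sub>F n in sequentially. 3 * (integral {0..2 * pi} (\<lambda>t. \<phi> n (cis t)) / (2 * pi)) < 1/2"
    by (rule order_tendstoD) simp
  then show ?thesis
  proof eventually_elim
    case (elim n)
    show ?case
    proof
      fix z :: complex assume z: "z \<in> cball 0 (\<rho>/4)"
      define w where "w = z / of_real (\<rho>/2)"
      have w: "norm w \<le> 1/2" using z rho by (simp add: w_def norm_divide)
      have "cmod (G n w) \<le> exp (L n * (3 * (integral {0..2 * pi} (\<lambda>t. \<phi> n (cis t)) / (2 * pi))))"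
      proof (rule log_subharmonic_bound [OF _ Gcont phi_cont _ _ L w])
        show "G n holomorphic_on ball 0 1"
          by (rule holomorphic_on_subset [OF Ghol]) auto
        show "cmod (G n x) \<le> exp (L n * \<phi> n x)" for x
          using L [of n] by (simp add: \<phi>_def)
      qed (rule phi0)
      also have "\<dots> \<le> exp (L n * (1/2))"
        using elim L [of n] by (simp add: field_simps)
      also have "\<dots> = s n powr (- (1/2))" by (rule powr [symmetric])
      finally show "cmod (F n z) \<le> s n powr (- (1/2))"
        using rho by (simp add: G_def w_def)
    qed
  qed
qed

text \<open>The pointwise bounds in \<open>pw\<close> need not be locally uniform in \<open>z\<close>; the polynomial growth rate
  in \<open>1/s\<close> is what makes this harmless (Hartogs' lemma for \<open>log |F| / log (1/s)\<close>).\<close>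

theorem hartogs_family:
  fixes F :: "real \<Rightarrow> 'i \<Rightarrow> complex \<Rightarrow> complex"
  assumes rho: "\<rho> > 0" and hol: "\<And>s i. s \<in> {0<..1} \<Longrightarrow> i \<in> I \<Longrightarrow> F s i holomorphic_on ball 0 \<rho>"
    and growth: "\<And>s i z. s \<in> {0<..1} \<Longrightarrow> i \<in> I \<Longrightarrow> z \<in> ball 0 \<rho> \<Longrightarrow>
      cmod (F s i z) \<le> C * s powr (- \<alpha>)"
    and C: "C \<ge> 1" and alpha: "\<alpha> \<ge> 0"
    and pw: "\<And>z. z \<in> ball 0 \<rho> \<Longrightarrow> \<exists>K. \<forall>s\<in>{0<..1}. \<forall>i\<in>I. cmod (F s i z) \<le> K"
  shows "\<exists>s0\<in>{0<..1}. \<forall>s\<in>{0<..s0}. \<forall>i\<in>I. \<forall>z\<in>cball 0 (\<rho>/4). cmod (F s i z) \<le> s powr (- (1/2))"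
proof (rule ccontr)
  assume neg: "\<not> ?thesis"
  \<comment> \<open>A failure for every \<open>s0\<close> yields bad pairs \<open>(s n, i n)\<close>
    with \<open>s n\<close> tending to 0; the index \<open>n + 2\<close> forces
    \<open>s n \<le> 1/2\<close>. Letting \<open>i n\<close> vary with \<open>n\<close> is what
    gives uniformity over the index set.\<close>
  have "\<forall>n. \<exists>s i. s \<in> {0<..inverse (real (n + 2))} \<and> i \<in> I \<and>
      (\<exists>z\<in>cball 0 (\<rho>/4). \<not> cmod (F s i z) \<le> s powr (- (1/2)))"
  proof (intro allI)
    fix n
    have "inverse (real (n + 2)) \<in> {0<..1}" by (simp add: field_simps)
    with neg show "\<exists>s i. s \<in> {0<..inverse (real (n + 2))} \<and> i \<in> I \<and>
      (\<exists>z\<in>cball 0 (\<rho>/4). \<not> cmod (F s i z) \<le> s powr (- (1/2)))"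
      by meson
  qed
  then obtain s i where si: "\<And>n. s n \<in> {0<..inverse (real (n + 2))}" "\<And>n. i n \<in> I"
    and bad: "\<And>n. \<exists>z\<in>cball 0 (\<rho>/4). \<not> cmod (F (s n) (i n) z) \<le> s n powr (- (1/2))"
    by metis
  have half: "s n \<le> 1/2" for n
  proof -
    have "s n \<le> inverse (real (n + 2))" using si by simp
    also have "\<dots> \<le> 1/2" by (simp add: field_simps)
    finally show ?thesis .
  qed
  have s1: "s n \<in> {0<..1}" for n
    using si(1) [of n] order_trans [OF half [of n], of 1] by simp
  have "(\<lambda>n. inverse (real (n + 2))) \<longlonglongrightarrow> 0"
    using LIMSEQ_ignore_initial_segment [OF LIMSEQ_inverse_real_of_nat, of 1] by simp
  then have "s \<longlonglongrightarrow> 0"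
    by (rule tendsto_sandwich [OF _ _ tendsto_const, rotated 2])
      (use si(1) in \<open>auto intro!: always_eventually less_imp_le\<close>)
  have "\<forall>\<^sub>F n in sequentially. \<forall>z\<in>cball 0 (\<rho>/4). cmod (F (s n) (i n) z) \<le> s n powr (- (1/2))"
  proof (rule hartogs_sequence [where F = "\<lambda>n. F (s n) (i n)", OF rho _ _ half \<open>s \<longlonglongrightarrow> 0\<close> _ C alpha])
    show "F (s n) (i n) holomorphic_on ball 0 \<rho>" for n by (rule hol [OF s1 si(2)])
    show "0 < s n" for n using s1 [of n] by simp
    show "cmod (F (s n) (i n) z) \<le> C * s n powr (- \<alpha>)" if "z \<in> ball 0 \<rho>" for n z
      by (rule growth [OF s1 si(2) that])
    show "\<exists>K. \<forall>n. cmod (F (s n) (i n) z) \<le> K" if "z \<in> ball 0 \<rho>" for z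
      using pw [OF that] s1 si(2) by meson
  qed
  then obtain N where "\<forall>z\<in>cball 0 (\<rho>/4). cmod (F (s N) (i N) z) \<le> s N powr (- (1/2))"
    by (auto simp: eventually_sequentially)
  with bad [of N] show False by blast
qed


section \<open>Vector-valued holomorphic functions\<close>

lemma vholomorphic_onD:
  assumes "f vholomorphic_on S" "open S" "z \<in> S"
  shows "\<exists>D. ((\<lambda>w. inverse (w - z) *\<^sub>C (f w - f z)) \<longlongrightarrow> D) (at z)"
  using assms unfolding vholomorphic_on_def by (metis at_within_open)

lemma vholomorphic_onI:
  assumes "open S" "\<And>z. z \<in> S \<Longrightarrow> \<exists>D. ((\<lambda>w. inverse (w - z) *\<^sub>C (f w - f z)) \<longlongrightarrow> D) (at z)"
  shows "f vholomorphic_on S"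
  using assms unfolding vholomorphic_on_def by (metis at_within_open)

lemma tendsto_scaleC:
  fixes g :: "'b \<Rightarrow> 'a::complex_normed_vector"
  assumes f: "(f \<longlongrightarrow> a) F" and g: "(g \<longlongrightarrow> b) F"
  shows "((\<lambda>x. f x *\<^sub>C g x) \<longlongrightarrow> a *\<^sub>C b) F"
proof -
  have "((\<lambda>x. norm (f x - a) * norm (g x) + cmod a * norm (g x - b)) \<longlongrightarrow> 0 * norm b + cmod a * 0) F"
    using f g by (intro tendsto_intros tendsto_norm_zero) (auto simp: LIM_zero_iff)
  then have lim: "((\<lambda>x. norm (f x - a) * norm (g x) + cmod a * norm (g x - b)) \<longlongrightarrow> 0) F"
    by simp
  have "norm (f x *\<^sub>C g x - a *\<^sub>C b) \<le> norm (f x - a) * norm (g x) + cmod a * norm (g x - b)" for x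
  proof -
    have "f x *\<^sub>C g x - a *\<^sub>C b = (f x - a) *\<^sub>C g x + a *\<^sub>C (g x - b)"
      by (simp add: scaleC_diff_left scaleC_diff_right)
    then show ?thesis by (metis norm_scaleC norm_triangle_ineq)
  qed
  then have "((\<lambda>x. f x *\<^sub>C g x - a *\<^sub>C b) \<longlongrightarrow> 0) F"
    by (intro Lim_null_comparison [OF _ lim] always_eventually allI)
  then show ?thesis by (simp add: LIM_zero_iff)
qed

lemma vholomorphic_imp_continuous:
  assumes "f vholomorphic_on S" "open S" "z \<in> S"
  shows "(f \<longlongrightarrow> f z) (at z)"
proof -
  obtain D where D: "((\<lambda>w. inverse (w - z) *\<^sub>C (f w - f z)) \<longlongrightarrow> D) (at z)"
    using vholomorphic_onD [OF assms] by blast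
  have "((\<lambda>w. (w - z) *\<^sub>C inverse (w - z) *\<^sub>C (f w - f z)) \<longlongrightarrow> 0 *\<^sub>C D) (at z)"
    by (intro tendsto_scaleC D) (auto simp: LIM_zero_iff intro!: tendsto_eq_intros)
  moreover have "\<forall>\<^sub>F w in at z. (w - z) *\<^sub>C inverse (w - z) *\<^sub>C (f w - f z) = f w - f z"
    by (auto simp: scaleC_scaleC eventually_at_filter)
  ultimately have "((\<lambda>w. f w - f z) \<longlongrightarrow> 0) (at z)"
    by (simp add: tendsto_cong)
  then show ?thesis by (simp add: LIM_zero_iff)
qed

lemma vholomorphic_imp_continuous_on:
  assumes "f vholomorphic_on S" "open S"
  shows "continuous_on S f"
  unfolding continuous_on_def
proof
  fix z assume "z \<in> S"
  from vholomorphic_imp_continuous [OF assms this] show "(f \<longlongrightarrow> f z) (at z within S)"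
    by (rule tendsto_within_subset) simp
qed

lemma bounded_clinearD:
  assumes "bounded_clinear f"
  shows bounded_clinear_bounded_linear: "bounded_linear f"
    and bounded_clinear_scaleC: "f (c *\<^sub>C x) = c *\<^sub>C f x"
  using assms by (auto simp: bounded_clinear_def)

lemma functionalD:
  assumes "functional f"
  shows functional_bounded_linear: "bounded_linear f"
    and functional_scaleC: "f (c *\<^sub>C x) = c * f x"
  using assms by (auto simp: functional_def)

lemma vholomorphic_functional:
  assumes f: "f vholomorphic_on S" "open S" and psi: "functional \<psi>"
  shows "(\<lambda>z. \<psi> (f z)) holomorphic_on S"
  unfolding holomorphic_on_open [OF assms(2)]
proof (intro ballI allI impI)
  interpret bounded_linear \<psi> by (rule functional_bounded_linear [OF psi])
  fix z assume "z \<in> S"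
  then obtain D where D: "((\<lambda>w. inverse (w - z) *\<^sub>C (f w - f z)) \<longlongrightarrow> D) (at z)"
    using vholomorphic_onD [OF f] by blast
  from tendsto [OF this] have "((\<lambda>w. inverse (w - z) * (\<psi> (f w) - \<psi> (f z))) \<longlongrightarrow> \<psi> D) (at z)"
    by (simp add: functional_scaleC [OF psi] diff)
  then show "\<exists>f'. ((\<lambda>z. \<psi> (f z)) has_field_derivative f') (at z)"
    by (auto simp: has_field_derivative_iff divide_inverse mult.commute)
qed

lemma vholomorphic_const: "open S \<Longrightarrow> (\<lambda>z. c) vholomorphic_on S"
  by (rule vholomorphic_onI) (auto intro!: exI [of _ 0])

lemma vholomorphic_add:
  assumes "f vholomorphic_on S" "g vholomorphic_on S" "open S"
  shows "(\<lambda>z. f z + g z) vholomorphic_on S"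
proof (rule vholomorphic_onI [OF assms(3)])
  fix z assume "z \<in> S"
  then obtain D D' where "((\<lambda>w. inverse (w - z) *\<^sub>C (f w - f z)) \<longlongrightarrow> D) (at z)"
    "((\<lambda>w. inverse (w - z) *\<^sub>C (g w - g z)) \<longlongrightarrow> D') (at z)"
    using vholomorphic_onD [OF assms(1,3)] vholomorphic_onD [OF assms(2,3)] by blast
  from tendsto_add [OF this]
  have "((\<lambda>w. inverse (w - z) *\<^sub>C (f w + g w - (f z + g z))) \<longlongrightarrow> D + D') (at z)"
    by (simp only: scaleC_add_right [symmetric] add_diff_add)
  then show "\<exists>D. ((\<lambda>w. inverse (w - z) *\<^sub>C (f w + g w - (f z + g z))) \<longlongrightarrow> D) (at z)" ..
qed

lemma vholomorphic_bounded_clinear: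
  assumes "f vholomorphic_on S" "open S" and L: "bounded_clinear L"
  shows "(\<lambda>z. L (f z)) vholomorphic_on S"
proof (rule vholomorphic_onI [OF assms(2)])
  interpret bounded_linear L by (rule bounded_clinear_bounded_linear [OF L])
  fix z assume "z \<in> S"
  then obtain D where "((\<lambda>w. inverse (w - z) *\<^sub>C (f w - f z)) \<longlongrightarrow> D) (at z)"
    using vholomorphic_onD [OF assms(1,2)] by blast
  from tendsto [OF this] show "\<exists>D. ((\<lambda>w. inverse (w - z) *\<^sub>C (L (f w) - L (f z))) \<longlongrightarrow> D) (at z)"
    by (auto simp: bounded_clinear_scaleC [OF L] diff)
qed

lemma vholomorphic_scaleC:
  assumes f: "f holomorphic_on S" and g: "g vholomorphic_on S" and S: "open S"
  shows "(\<lambda>z. f z *\<^sub>C g z) vholomorphic_on S"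
proof (rule vholomorphic_onI [OF S])
  fix z assume z: "z \<in> S"
  then obtain D where D: "((\<lambda>w. inverse (w - z) *\<^sub>C (g w - g z)) \<longlongrightarrow> D) (at z)"
    using vholomorphic_onD [OF g S] by blast
  obtain d where d: "((\<lambda>w. inverse (w - z) * (f w - f z)) \<longlongrightarrow> d) (at z)"
    using f z unfolding holomorphic_on_open [OF S]
    by (auto simp: has_field_derivative_iff divide_inverse mult.commute)
  have "(f \<longlongrightarrow> f z) (at z)"
    using holomorphic_on_imp_continuous_on [OF f] z S
    by (metis at_within_open continuous_on_def)
  from tendsto_add [OF tendsto_scaleC [OF this D] tendsto_scaleC [OF d tendsto_const [of "g z"]]]
  have "((\<lambda>w. inverse (w - z) *\<^sub>C (f w *\<^sub>C g w - f z *\<^sub>C g z)) \<longlongrightarrow> f z *\<^sub>C D + d *\<^sub>C g z) (at z)"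
    by (simp add: scaleC_scaleC scaleC_diff_right scaleC_diff_left right_diff_distrib mult.commute)
  then show "\<exists>D. ((\<lambda>w. inverse (w - z) *\<^sub>C (f w *\<^sub>C g w - f z *\<^sub>C g z)) \<longlongrightarrow> D) (at z)" ..
qed

text \<open>Product rule for a strongly holomorphic operator family. The difference quotient is
  \<open>K w\<close> applied to the error of the quotient of \<open>g\<close>, plus
  \<open>K w D\<close>, plus the quotient of \<open>K\<close> at the fixed vector
  \<open>g z\<close>. The uniform bound \<open>M\<close> disposes of the first term, strong
  continuity of the second.\<close>

lemma vholomorphic_apply:
  assumes K: "\<And>x. (\<lambda>z. K z x) vholomorphic_on S" and lin: "\<And>z. z \<in> S \<Longrightarrow> bounded_clinear (K z)"
    and bd: "\<And>z x. z \<in> S \<Longrightarrow> norm (K z x) \<le> M * norm x"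
    and g: "g vholomorphic_on S" and S: "open S"
  shows "(\<lambda>z. K z (g z)) vholomorphic_on S"
proof (rule vholomorphic_onI [OF S])
  fix z assume z: "z \<in> S"
  then obtain D where D: "((\<lambda>w. inverse (w - z) *\<^sub>C (g w - g z)) \<longlongrightarrow> D) (at z)"
    using vholomorphic_onD [OF g S] by blast
  obtain D' where D': "((\<lambda>w. inverse (w - z) *\<^sub>C (K w (g z) - K z (g z))) \<longlongrightarrow> D') (at z)"
    using vholomorphic_onD [OF K S z] by blast
  have KD: "((\<lambda>w. K w D) \<longlongrightarrow> K z D) (at z)"
    by (rule vholomorphic_imp_continuous [OF K S z])
  have ev: "\<forall>\<^sub>F w in at z. w \<in> S"
    using S z by (simp add: eventually_at_topological) blast
  have "((\<lambda>w. M * norm (inverse (w - z) *\<^sub>C (g w - g z) - D)) \<longlongrightarrow> M * 0) (at z)"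
    using D by (intro tendsto_intros tendsto_norm_zero) (simp add: LIM_zero_iff)
  then have "((\<lambda>w. K w (inverse (w - z) *\<^sub>C (g w - g z) - D)) \<longlongrightarrow> 0) (at z)"
    by (intro Lim_null_comparison [OF eventually_mono [OF ev bd]]) simp_all
  from tendsto_add [OF tendsto_add [OF this KD] D']
  have "((\<lambda>w. K w (inverse (w - z) *\<^sub>C (g w - g z) - D) + K w D +
      inverse (w - z) *\<^sub>C (K w (g z) - K z (g z))) \<longlongrightarrow> 0 + K z D + D') (at z)" .
  moreover have "\<forall>\<^sub>F w in at z. K w (inverse (w - z) *\<^sub>C (g w - g z) - D) + K w D +
      inverse (w - z) *\<^sub>C (K w (g z) - K z (g z)) = inverse (w - z) *\<^sub>C (K w (g w) - K z (g z))"
    using ev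
  proof eventually_elim
    case (elim w)
    interpret bounded_linear "K w" by (rule bounded_clinear_bounded_linear [OF lin [OF elim]])
    show ?case
      by (simp add: diff bounded_clinear_scaleC [OF lin [OF elim]] scaleC_diff_right)
  qed
  ultimately have "((\<lambda>w. inverse (w - z) *\<^sub>C (K w (g w) - K z (g z))) \<longlongrightarrow> 0 + K z D + D') (at z)"
    by (rule Lim_transform_eventually)
  then show "\<exists>D. ((\<lambda>w. inverse (w - z) *\<^sub>C (K w (g w) - K z (g z))) \<longlongrightarrow> D) (at z)" ..
qed

text \<open>Uniform boundedness gives a local bound of the operator norms, which the Schwarz lemma improves to
  \<open>O(\<bar>z\<bar>)\<close>.\<close>

lemma strongly_holomorphic_small:
  fixes K :: "complex \<Rightarrow> 'a::{complex_normed_vector,banach} \<Rightarrow> 'b::complex_normed_vector"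
  assumes K: "\<And>x. (\<lambda>z. K z x) vholomorphic_on ball 0 1"
    and lin: "\<And>z. z \<in> ball 0 1 \<Longrightarrow> bounded_clinear (K z)" and K0: "\<And>x. K 0 x = 0"
  shows "\<exists>M. \<forall>z\<in>ball 0 (1/2). \<forall>x. norm (K z x) \<le> M * norm z * norm x"
proof -
  have "\<exists>M. \<forall>f\<in>K ` cball 0 (1/2). \<forall>x. norm (f x) \<le> M * norm x"
  proof (rule uniform_boundedness)
    show "bounded_linear f" if "f \<in> K ` cball 0 (1/2)" for f
      using that by (auto intro!: bounded_clinear_bounded_linear lin)
    show "\<exists>M. \<forall>f\<in>K ` cball 0 (1/2). norm (f x) \<le> M" for x
    proof -
      have "continuous_on (cball 0 (1/2)) (\<lambda>z. K z x)"
        by (rule continuous_on_subset [OF vholomorphic_imp_continuous_on [OF K]]) auto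
      then have "bounded ((\<lambda>z. K z x) ` cball 0 (1/2))"
        by (intro compact_imp_bounded compact_continuous_image) auto
      then show ?thesis by (auto simp: bounded_iff)
    qed
  qed
  then obtain M where M: "\<And>z x. z \<in> cball 0 (1/2) \<Longrightarrow> norm (K z x) \<le> M * norm x" by blast
  define N where "N = \<bar>M\<bar> + 1"
  have N: "N > 0" "norm (K z x) \<le> N * norm x" if "z \<in> cball 0 (1/2)" for z x
    using M [OF that, of x] order_trans [OF _ mult_right_mono [of M "\<bar>M\<bar> + 1" "norm x"]]
    by (auto simp: N_def)
  have N0: "N > 0" by (simp add: N_def)
  have "norm (K z x) \<le> (4 * N) * norm z * norm x" if z: "z \<in> ball 0 (1/2)" for z x
  proof (cases "x = 0")
    case True
    then show ?thesis using M [of z 0] z by simp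
  next
    case False
    obtain \<psi> where psi: "functional \<psi>" "\<And>y. cmod (\<psi> y) \<le> norm y" "\<psi> (K z x) = of_real (norm (K z x))"
      using norming_functional by blast
    \<comment> \<open>Division by \<open>2 * N * norm x\<close> keeps the modulus strictly below 1,
      and \<open>w / 2\<close> moves the disc of radius \<open>1/2\<close> to the unit disc; the two
      factors of 2 produce the constant \<open>4 * N\<close>.\<close>
    define f where "f w = \<psi> (K (w / 2) x) / of_real (2 * N * norm x)" for w
    have c: "0 < 2 * N * norm x" using N0 False by simp
    have "norm (f (2 * z)) \<le> norm (2 * z)"
    proof (rule Schwarz_Lemma(1))
      have "(\<lambda>w. \<psi> (K w x)) holomorphic_on ball 0 1"
        by (rule vholomorphic_functional [OF K _ psi(1)]) simp
      then have "((\<lambda>w. \<psi> (K w x)) \<circ> (\<lambda>w. w / 2)) holomorphic_on ball 0 1"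
        by (intro holomorphic_on_compose_gen [where t = "ball 0 1"] holomorphic_intros) (auto simp: norm_divide)
      then show "f holomorphic_on ball 0 1"
        unfolding f_def [abs_def] o_def using c by (intro holomorphic_intros) auto
      show "f 0 = 0"
        using linear_0 [OF bounded_linear.linear [OF functional_bounded_linear [OF psi(1)]]]
        by (simp add: f_def K0)
      show "norm (f w) < 1" if "norm w < 1" for w
      proof -
        have "cmod (\<psi> (K (w / 2) x)) \<le> N * norm x"
          using psi(2) [of "K (w / 2) x"] N(2) [of "w / 2" x] that by (auto simp: norm_divide)
        also have "\<dots> < 2 * N * norm x" using c by simp
        finally show ?thesis
          using c unfolding f_def norm_divide norm_of_real abs_of_pos [OF c] by (simp only: divide_less_eq_1_pos)
      qed
      show "norm (2 * z) < 1" using z by (simp add: norm_mult)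
    qed
    moreover have "norm (f (2 * z)) = norm (K z x) / (2 * N * norm x)"
      using psi(3) unfolding f_def norm_divide norm_of_real abs_of_pos [OF c] by simp
    ultimately show ?thesis using c by (simp add: norm_mult field_simps)
  qed
  then show ?thesis by (intro exI [of _ "4 * N"] ballI allI)
qed


section \<open>Principal ideals and their polars\<close>

text \<open>For \<open>0 \<le> u\<close> and \<open>a \<ge> 0\<close> this is the closed ball of
  radius \<open>a\<close> for the gauge norm. Working with inclusions instead of
  \<open>gauge_norm\<close> avoids the infimum and makes limits in \<open>E\<close>
  accessible.\<close>

definition order_ball ::
    "'a::banach_lattice complexification \<Rightarrow> real \<Rightarrow> 'a complexification set" where
  "order_ball u a = {x. \<bar>x\<bar> \<le> a *\<^sub>R u}"

lemma nonneg_im: "0 \<le> u \<Longrightarrow> im_part u = 0"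
  and nonneg_re: "0 \<le> u \<Longrightarrow> 0 \<le> re_part u" for u :: "'a::banach_lattice complexification"
  by (simp_all add: less_eq_complexification_def complexification_defs)

lemma order_ball_modulus:
  assumes "0 \<le> u"
  shows "x \<in> order_ball u a \<longleftrightarrow> modulus (re_part x) (im_part x) \<le> a *\<^sub>R re_part u"
  using nonneg_im [OF assms]
  by (simp add: order_ball_def less_eq_complexification_def abs_complexification_def complexification_defs)

text \<open>Replaces one modulus inequality by linear inequalities, one for each angle; these
  survive limits without any continuity of the modulus.\<close>

lemma order_ball_rotated:
  assumes "0 \<le> u"
  shows "x \<in> order_ball u a \<longleftrightarrow> (\<forall>\<theta>. rotated (re_part x) (im_part x) \<theta> \<le> a *\<^sub>R re_part u)"
  unfolding order_ball_modulus [OF assms]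
  by (meson modulus_least modulus_upper order_trans)

lemma order_ball_mono:
  assumes "0 \<le> u" "a \<le> b" "x \<in> order_ball u a"
  shows "x \<in> order_ball u b"
  using assms scaleR_right_mono [OF assms(2) nonneg_re [OF assms(1)]]
  by (auto simp: order_ball_modulus intro: order_trans)

lemma order_ball_zero: "0 \<le> u \<Longrightarrow> 0 \<le> a \<Longrightarrow> 0 \<in> order_ball u a"
  using nonneg_re [of u]
  by (simp add: order_ball_rotated complexification_defs scaleR_nonneg_nonneg)

lemma order_ball_add:
  assumes u: "0 \<le> u" and "x \<in> order_ball u a" "y \<in> order_ball u b"
  shows "x + y \<in> order_ball u (a + b)"
  using assms(2,3) modulus_triangle [of "re_part x" "re_part y" "im_part x" "im_part y"]
    add_mono [of "modulus (re_part x) (im_part x)" "a *\<^sub>R re_part u" "modulus (re_part y) (im_part y)" "b *\<^sub>R re_part u"]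
  by (auto simp: order_ball_modulus [OF u] complexification_defs scaleR_add_left intro: order_trans)

lemma order_ball_scaleC:
  assumes u: "0 \<le> u" and "x \<in> order_ball u a"
  shows "c *\<^sub>C x \<in> order_ball u (cmod c * a)"
proof -
  have "cmod c *\<^sub>R modulus (re_part x) (im_part x) \<le> cmod c *\<^sub>R a *\<^sub>R re_part u"
    using assms by (intro scaleR_left_mono) (auto simp: order_ball_modulus)
  then show ?thesis
    using order_trans [OF modulus_scale_le]
    by (auto simp: order_ball_modulus [OF u] scaleC_complexification_def)
qed

lemma order_ball_scaleR:
  assumes "0 \<le> u" "x \<in> order_ball u a"
  shows "t *\<^sub>R x \<in> order_ball u (\<bar>t\<bar> * a)"
  using order_ball_scaleC [OF assms, of "of_real t"] by (simp add: scaleC_of_real)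

lemma bounded_linear_re_part: "bounded_linear (re_part :: 'a::banach_lattice complexification \<Rightarrow> 'a)"
  using norm_re_le by (intro bounded_linear_intro [where K = 1]) (auto simp: complexification_defs)

lemma bounded_linear_im_part: "bounded_linear (im_part :: 'a::banach_lattice complexification \<Rightarrow> 'a)"
  using norm_im_le by (intro bounded_linear_intro [where K = 1]) (auto simp: complexification_defs)

text \<open>The positive cone is closed in \<open>E\<close>, so order balls are closed for the norm
  of \<open>E\<close> and not only for the gauge norm. This is how approximations bounded in
  \<open>E_u\<close> pass their bound to a limit that is only taken in \<open>E\<close>.\<close>

lemma order_ball_lim:
  assumes u: "0 \<le> u" and X: "\<And>n. X n \<in> order_ball u (a n)" and lim: "X \<longlonglongrightarrow> x" "a \<longlonglongrightarrow> b"
  shows "x \<in> order_ball u b"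
  unfolding order_ball_rotated [OF u]
proof
  fix \<theta> :: real
  show "rotated (re_part x) (im_part x) \<theta> \<le> b *\<^sub>R re_part u"
  proof (rule lattice_tendsto_le)
    show "(\<lambda>n. rotated (re_part (X n)) (im_part (X n)) \<theta>) \<longlonglongrightarrow> rotated (re_part x) (im_part x) \<theta>"
      by (intro tendsto_intros bounded_linear.tendsto [OF bounded_linear_re_part]
          bounded_linear.tendsto [OF bounded_linear_im_part] lim)
    show "(\<lambda>n. a n *\<^sub>R re_part u) \<longlonglongrightarrow> b *\<^sub>R re_part u" by (intro tendsto_intros lim)
    show "rotated (re_part (X n)) (im_part (X n)) \<theta> \<le> a n *\<^sub>R re_part u" for n
      using X [of n] by (simp add: order_ball_rotated [OF u])
  qed
qed

lemma principal_ideal_order_ball: "x \<in> principal_ideal u \<longleftrightarrow> (\<exists>c>0. x \<in> order_ball u c)"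
  by (simp add: principal_ideal_def order_ball_def)

lemma order_ball_imp_ideal: "0 \<le> u \<Longrightarrow> x \<in> order_ball u a \<Longrightarrow> x \<in> principal_ideal u"
  unfolding principal_ideal_order_ball
  using order_ball_mono [of u a "\<bar>a\<bar> + 1" x] by (intro exI [of _ "\<bar>a\<bar> + 1"]) auto

lemma gauge_norm_le: "a > 0 \<Longrightarrow> x \<in> order_ball u a \<Longrightarrow> gauge_norm u x \<le> a"
  unfolding gauge_norm_def order_ball_def
  by (intro cInf_lower bdd_belowI [of _ 0]) auto

text \<open>The infimum defining the gauge norm is attained, since order balls are closed under
  limits of their radii.\<close>

lemma order_ball_gauge:
  assumes u: "0 \<le> u" and x: "x \<in> principal_ideal u"
  shows "x \<in> order_ball u (gauge_norm u x)"
proof (rule order_ball_lim [OF u _ tendsto_const])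
  show "(\<lambda>n. gauge_norm u x + inverse (real (Suc n))) \<longlonglongrightarrow> gauge_norm u x"
    using tendsto_add [OF tendsto_const LIMSEQ_inverse_real_of_nat, of "gauge_norm u x"] by simp
  fix n
  have "\<exists>c\<in>{c. c > 0 \<and> \<bar>x\<bar> \<le> c *\<^sub>R u}. c < gauge_norm u x + inverse (real (Suc n))"
    unfolding gauge_norm_def
    using x by (intro cInf_lessD) (auto simp: principal_ideal_def)
  then obtain c where c: "\<bar>x\<bar> \<le> c *\<^sub>R u" "c < gauge_norm u x + inverse (real (Suc n))" by blast
  then show "x \<in> order_ball u (gauge_norm u x + inverse (real (Suc n)))"
    using order_ball_mono [OF u, of c] by (auto simp: order_ball_def)
qed

lemma order_ball_gauge_le:
  assumes "0 \<le> u" "x \<in> principal_ideal u" "gauge_norm u x \<le> a"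
  shows "x \<in> order_ball u a"
  using order_ball_mono [OF assms(1,3)] order_ball_gauge [OF assms(1,2)] .

text \<open>Polar of the unit order ball inside the dual of \<open>E\<close>. Its members need not
  be uniformly bounded on \<open>E\<close>; uniform estimates over it must go through order
  balls.\<close>

definition order_polar ::
    "'a::banach_lattice complexification \<Rightarrow> ('a complexification \<Rightarrow> complex) set" where
  "order_polar u = {\<psi>. functional \<psi> \<and> (\<forall>x\<in>order_ball u 1. cmod (\<psi> x) \<le> 1)}"

lemma order_polarD:
  assumes u: "0 \<le> u" and psi: "\<psi> \<in> order_polar u" and x: "x \<in> order_ball u a" and a: "a \<ge> 0"
  shows "cmod (\<psi> x) \<le> a"
proof (rule field_le_epsilon)
  fix e :: real assume e: "e > 0"
  interpret bounded_linear \<psi> using psi by (simp add: order_polar_def functional_def)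
  \<comment> \<open>The extra \<open>e\<close> permits division by the radius when
    \<open>a = 0\<close>.\<close>
  have "x \<in> order_ball u (a + e)" using order_ball_mono [OF u _ x] e by simp
  then have "inverse (a + e) *\<^sub>R x \<in> order_ball u 1"
    using order_ball_scaleR [OF u, of x "a + e" "inverse (a + e)"] a e by simp
  then have "cmod (\<psi> (inverse (a + e) *\<^sub>R x)) \<le> 1" using psi by (auto simp: order_polar_def)
  then show "cmod (\<psi> x) \<le> a + e" using a e by (simp add: scale field_simps)
qed

text \<open>Bipolar theorem for the order interval: the seminorm fed to Hahn--Banach is the infimal
  convolution of the gauge and a large multiple of the norm.\<close>

theorem order_ball_polar:
  assumes u: "0 \<le> u" and a: "a \<ge> 0" and polar: "\<And>\<psi>. \<psi> \<in> order_polar u \<Longrightarrow> cmod (\<psi> y) \<le> a"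
  shows "y \<in> order_ball u a"
proof -
  define W where "W = {(b, x). b \<ge> 0 \<and> x \<in> order_ball u b}"
  \<comment> \<open>If this failed for some \<open>n\<close>, the seminorm \<open>p\<close> below
    would be at least \<open>a + inverse (n + 1)\<close> at \<open>y\<close>, and a functional
    norming \<open>p\<close> at \<open>y\<close> would violate the polar bound.\<close>
  have "\<exists>b x. (b, x) \<in> W \<and> b + real (Suc n) * norm (y - x) < a + inverse (real (Suc n))" for n
  proof (rule ccontr)
    define N where "N = real (Suc n)"
    assume neg: "\<not> (\<exists>b x. (b, x) \<in> W \<and> b + real (Suc n) * norm (y - x) < a + inverse (real (Suc n)))"
    define p where "p z = (INF (b, x)\<in>W. b + N * norm (z - x))" for z
    have N: "N > 0" by (simp add: N_def)
    have W0: "(0, 0) \<in> W" using order_ball_zero [OF u] by (simp add: W_def)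
    have le: "p z \<le> b + N * norm (z - x)" if "(b, x) \<in> W" for z b x
      unfolding p_def using that N
      by (intro cINF_lower2 [OF bdd_belowI2 [of _ 0] that]) (auto simp: W_def)
    have great: "r \<le> p z" if "\<And>b x. (b, x) \<in> W \<Longrightarrow> r \<le> b + N * norm (z - x)" for r z
      unfolding p_def using W0 that by (intro cINF_greatest) auto
    have p0: "0 \<le> p z" for z
      using N by (intro great) (auto simp: W_def)
    have "\<exists>\<psi>. functional \<psi> \<and> (\<forall>x. cmod (\<psi> x) \<le> p x) \<and> \<psi> y = of_real (p y)"
    proof (rule hahn_banach_seminorm [where N = N])
      show "p z \<le> N * norm z" for z using le [OF W0, of z] by simp
    next
      fix z z'
      have step: "p (z + z') \<le> (b + N * norm (z - x)) + (b' + N * norm (z' - x'))"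
        if "(b, x) \<in> W" "(b', x') \<in> W" for b x b' x'
      proof -
        have "(b + b', x + x') \<in> W" using that order_ball_add [OF u] by (auto simp: W_def)
        from le [OF this, of "z + z'"]
        have "p (z + z') \<le> (b + b') + N * norm ((z - x) + (z' - x'))" by (simp add: algebra_simps)
        also have "\<dots> \<le> (b + b') + N * (norm (z - x) + norm (z' - x'))"
          using N by (intro add_left_mono mult_left_mono norm_triangle_ineq) simp
        finally show ?thesis by (simp add: algebra_simps)
      qed
      have "p (z + z') - (b + N * norm (z - x)) \<le> p z'" if "(b, x) \<in> W" for b x
      proof (rule great)
        show "p (z + z') - (b + N * norm (z - x)) \<le> b' + N * norm (z' - x')"
          if "(b', x') \<in> W" for b' x'
          using step [OF \<open>(b, x) \<in> W\<close> that] by linarith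
      qed
      then have step': "p (z + z') \<le> b + N * norm (z - x) + p z'" if "(b, x) \<in> W" for b x
        using that by (smt (verit))
      have "p (z + z') - p z' \<le> p z"
      proof (rule great)
        show "p (z + z') - p z' \<le> b + N * norm (z - x)" if "(b, x) \<in> W" for b x
          using step' [OF that] by linarith
      qed
      then show "p (z + z') \<le> p z + p z'" by simp
    next
      fix c z
      show "p (c *\<^sub>C z) \<le> cmod c * p z"
      proof (cases "c = 0")
        case True
        then show ?thesis using le [OF W0, of 0] by simp
      next
        case False
        have "p (c *\<^sub>C z) / cmod c \<le> p z"
        proof (rule great)
          fix b x assume bx: "(b, x) \<in> W"
          then have "(cmod c * b, c *\<^sub>C x) \<in> W" using order_ball_scaleC [OF u] by (auto simp: W_def)
          from le [OF this, of "c *\<^sub>C z"]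
          have "p (c *\<^sub>C z) \<le> cmod c * b + N * norm (c *\<^sub>C (z - x))"
            by (simp only: scaleC_diff_right)
          then have "p (c *\<^sub>C z) \<le> cmod c * (b + N * norm (z - x))"
            by (simp add: norm_scaleC distrib_left mult.left_commute)
          then show "p (c *\<^sub>C z) / cmod c \<le> b + N * norm (z - x)"
            using False by (simp add: field_simps)
        qed
        then show ?thesis using False by (simp add: field_simps)
      qed
    qed
    then obtain \<psi> where psi: "functional \<psi>" "\<And>x. cmod (\<psi> x) \<le> p x" "\<psi> y = of_real (p y)"
      by blast
    \<comment> \<open>\<open>p\<close> lies below the gauge, so the norming functional belongs to
      the polar.\<close>
    have "p x \<le> 1" if "x \<in> order_ball u 1" for x
      using le [of 1 x x] that by (simp add: W_def)
    then have "\<psi> \<in> order_polar u"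
      using psi by (auto simp: order_polar_def intro: order_trans)
    from polar [OF this] have "p y \<le> a" using psi(3) p0 [of y] by simp
    moreover have "a + inverse N \<le> p y"
      using neg unfolding N_def [symmetric] by (intro great) (meson not_le)
    ultimately show False using N by (smt (verit) positive_imp_inverse_positive)
  qed
  then obtain b x where bx: "\<And>n. (b n, x n) \<in> W"
    "\<And>n. b n + real (Suc n) * norm (y - x n) < a + inverse (real (Suc n))"
    by metis
  have inv1: "inverse (real (Suc n)) \<le> 1" for n by (simp add: field_simps)
  have xn: "x n \<in> order_ball u (a + inverse (real (Suc n)))" for n
  proof (rule order_ball_mono [OF u])
    show "x n \<in> order_ball u (b n)" using bx(1) [of n] by (simp add: W_def)
    show "b n \<le> a + inverse (real (Suc n))"
      using bx(2) [of n] by (smt (verit) mult_nonneg_nonneg norm_ge_zero of_nat_0_le_iff)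
  qed
  have xy: "x \<longlonglongrightarrow> y"
  proof -
    have "(\<lambda>n. (a + 1) * inverse (real (Suc n))) \<longlonglongrightarrow> (a + 1) * 0"
      by (intro tendsto_intros LIMSEQ_inverse_real_of_nat)
    then have lim: "(\<lambda>n. (a + 1) * inverse (real (Suc n))) \<longlonglongrightarrow> 0" by simp
    \<comment> \<open>The growing weight \<open>n + 1\<close> on the norm in the infimal convolution
      forces \<open>x n\<close> towards \<open>y\<close>.\<close>
    have "norm (x n - y) \<le> (a + 1) * inverse (real (Suc n))" for n
    proof -
      have "real (Suc n) * norm (x n - y) \<le> a + 1"
        using bx(2) [of n] bx(1) [of n] inv1 [of n] by (simp add: W_def norm_minus_commute)
      then show ?thesis by (simp add: field_simps)
    qed
    then have "(\<lambda>n. x n - y) \<longlonglongrightarrow> 0"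
      by (intro Lim_null_comparison [OF _ lim] always_eventually allI)
    then show ?thesis by (simp add: LIM_zero_iff)
  qed
  have "(\<lambda>n. a + inverse (real (Suc n))) \<longlonglongrightarrow> a"
    using tendsto_add [OF tendsto_const LIMSEQ_inverse_real_of_nat, of a] by simp
  then show ?thesis by (rule order_ball_lim [OF u xn xy])
qed


section \<open>Differentiable semigroups\<close>

lemma clinear_onD:
  assumes "clinear_on D F"
  shows clinear_on_zero: "0 \<in> D" and clinear_on_mem_add: "x \<in> D \<Longrightarrow> y \<in> D \<Longrightarrow> x + y \<in> D"
    and clinear_on_mem_scale: "x \<in> D \<Longrightarrow> c *\<^sub>C x \<in> D"
    and clinear_on_mem_diff: "x \<in> D \<Longrightarrow> y \<in> D \<Longrightarrow> x - y \<in> D"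
    and clinear_on_add: "x \<in> D \<Longrightarrow> y \<in> D \<Longrightarrow> F (x + y) = F x + F y"
    and clinear_on_scale: "x \<in> D \<Longrightarrow> F (c *\<^sub>C x) = c *\<^sub>C F x"
    and clinear_on_diff: "x \<in> D \<Longrightarrow> y \<in> D \<Longrightarrow> F (x - y) = F x - F y"
proof -
  have D: "complex_vector.subspace D" using assms by (simp add: clinear_on_def)
  show "0 \<in> D" "x \<in> D \<Longrightarrow> y \<in> D \<Longrightarrow> x + y \<in> D" "x \<in> D \<Longrightarrow> c *\<^sub>C x \<in> D"
    "x \<in> D \<Longrightarrow> y \<in> D \<Longrightarrow> x - y \<in> D"
    using complex_vector.subspace_0 [OF D] complex_vector.subspace_add [OF D]
      complex_vector.subspace_scale [OF D] complex_vector.subspace_diff [OF D] by auto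
  show add: "x \<in> D \<Longrightarrow> y \<in> D \<Longrightarrow> F (x + y) = F x + F y" for x y
    using assms by (simp add: clinear_on_def)
  show scale: "x \<in> D \<Longrightarrow> F (c *\<^sub>C x) = c *\<^sub>C F x" for c x
    using assms by (simp add: clinear_on_def)
  show "x \<in> D \<Longrightarrow> y \<in> D \<Longrightarrow> F (x - y) = F x - F y"
    using add [of x "(- 1) *\<^sub>C y"] scale [of y "- 1"] complex_vector.subspace_scale [OF D, of y "- 1"]
    by simp
qed

lemma has_vector_derivativeI_quotient:
  fixes f :: "real \<Rightarrow> 'a::real_normed_vector"
  assumes "((\<lambda>h. (f (s + h) - f s) /\<^sub>R h) \<longlongrightarrow> d) (at 0)"
  shows "(f has_vector_derivative d) (at s)"
  unfolding has_vector_derivative_def has_derivative_at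
proof
  show "bounded_linear (\<lambda>x. x *\<^sub>R d)" by (rule bounded_linear_scaleR_left)
  have "((\<lambda>h. norm ((f (s + h) - f s) /\<^sub>R h - d)) \<longlongrightarrow> 0) (at 0)"
    using assms by (simp add: LIM_zero_iff tendsto_norm_zero)
  moreover have "\<forall>\<^sub>F h in at 0. norm ((f (s + h) - f s) /\<^sub>R h - d) = norm (f (s + h) - f s - h *\<^sub>R d) / norm h"
  proof -
    have "norm ((f (s + h) - f s) /\<^sub>R h - d) = norm (f (s + h) - f s - h *\<^sub>R d) / norm h" if "h \<noteq> 0" for h
    proof -
      have "(f (s + h) - f s) /\<^sub>R h - d = (f (s + h) - f s - h *\<^sub>R d) /\<^sub>R h"
        using that by (simp add: scaleR_diff_right)
      then show ?thesis by (simp add: divide_inverse mult.commute)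
    qed
    then show ?thesis by (simp add: eventually_at_filter)
  qed
  ultimately show "((\<lambda>h. norm (f (s + h) - f s - h *\<^sub>R d) / norm h) \<longlongrightarrow> 0) (at 0)"
    by (rule Lim_transform_eventually)
qed

locale differentiable_semigroup =
  fixes T :: "real \<Rightarrow> 'a::{complex_normed_vector,banach} \<Rightarrow> 'a" and D :: "'a set" and A :: "'a \<Rightarrow> 'a"
  assumes c0: "c0_semigroup T" and gen: "is_generator T D A" and diffb: "immediately_differentiable T D"
begin

lemma T_bounded_clinear: "t \<ge> 0 \<Longrightarrow> bounded_clinear (T t)"
  using c0 by (simp add: c0_semigroup_def)

lemma T_bounded_linear: "t \<ge> 0 \<Longrightarrow> bounded_linear (T t)"
  using T_bounded_clinear by (simp add: bounded_clinear_def)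

lemma T_scaleC: "t \<ge> 0 \<Longrightarrow> T t (c *\<^sub>C x) = c *\<^sub>C T t x"
  using T_bounded_clinear by (simp add: bounded_clinear_def)

lemma T_0: "T 0 x = x"
  using c0 by (simp add: c0_semigroup_def)

lemma T_plus: "s \<ge> 0 \<Longrightarrow> t \<ge> 0 \<Longrightarrow> T (s + t) x = T s (T t x)"
  using c0 by (simp add: c0_semigroup_def)

lemma T_lim: "((\<lambda>t. T t x) \<longlongrightarrow> x) (at_right 0)"
  using c0 by (simp add: c0_semigroup_def)

lemma T_mem: "t > 0 \<Longrightarrow> T t x \<in> D"
  using diffb by (auto simp: immediately_differentiable_def)

lemma A_lim: "x \<in> D \<Longrightarrow> ((\<lambda>h. (T h x - x) /\<^sub>R h) \<longlongrightarrow> A x) (at_right 0)"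
  using gen unfolding is_generator_def by blast

lemma A_eqI:
  assumes lim: "((\<lambda>h. (T h x - x) /\<^sub>R h) \<longlongrightarrow> y) (at_right 0)"
  shows "x \<in> D" "A x = y"
proof -
  show "x \<in> D" using lim gen unfolding is_generator_def by blast
  from tendsto_unique [OF _ A_lim [OF this] lim] show "A x = y" by simp
qed

lemma ev_at_right: "\<forall>\<^sub>F h in at_right (0::real). 0 \<le> h"
  by (auto simp: eventually_at_filter)

lemma A_clinear: "clinear_on D A"
proof -
  have 0: "0 \<in> D"
  proof (rule A_eqI(1) [of 0 0])
    have "\<forall>\<^sub>F h in at_right 0. 0 = (T h 0 - 0) /\<^sub>R h"
      using ev_at_right
    proof eventually_elim
      case (elim h)
      then show ?case using linear_0 [OF bounded_linear.linear [OF T_bounded_linear]] by simp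
    qed
    then show "((\<lambda>h. (T h 0 - 0) /\<^sub>R h) \<longlongrightarrow> 0) (at_right 0)"
      by (rule Lim_transform_eventually [OF tendsto_const])
  qed
  have add: "((\<lambda>h. (T h (x + y) - (x + y)) /\<^sub>R h) \<longlongrightarrow> A x + A y) (at_right 0)"
    if "x \<in> D" "y \<in> D" for x y
  proof (rule Lim_transform_eventually [OF tendsto_add [OF A_lim [OF that(1)] A_lim [OF that(2)]]])
    show "\<forall>\<^sub>F h in at_right 0. (T h x - x) /\<^sub>R h + (T h y - y) /\<^sub>R h = (T h (x + y) - (x + y)) /\<^sub>R h"
      using ev_at_right
    proof eventually_elim
      case (elim h)
      then interpret bounded_linear "T h" by (rule T_bounded_linear)
      show ?case by (simp add: add algebra_simps)
    qed
  qed
  have scale: "((\<lambda>h. (T h (c *\<^sub>C x) - c *\<^sub>C x) /\<^sub>R h) \<longlongrightarrow> c *\<^sub>C A x) (at_right 0)"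
    if "x \<in> D" for c x
  proof (rule Lim_transform_eventually [OF tendsto_scaleC [OF tendsto_const A_lim [OF that]]])
    show "\<forall>\<^sub>F h in at_right 0. c *\<^sub>C ((T h x - x) /\<^sub>R h) = (T h (c *\<^sub>C x) - c *\<^sub>C x) /\<^sub>R h"
      using ev_at_right
      by eventually_elim
        (simp add: T_scaleC scaleC_diff_right [symmetric] scaleR_scaleC_assoc scaleR_scaleC_assoc' mult.commute)
  qed
  show ?thesis
    unfolding clinear_on_def complex_vector.subspace_def
    by (intro conjI ballI allI 0 A_eqI(1) [OF add] A_eqI(1) [OF scale] A_eqI(2) [OF add] A_eqI(2) [OF scale])
qed

text \<open>Without a bound near 0 there would be times \<open>t n\<close> tending to 0 with
  unbounded operator norms, although strong continuity at 0 keeps each orbit along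
  \<open>t n\<close> bounded, contradicting uniform boundedness. The semigroup law carries the bound
  from \<open>{0..d}\<close> to any compact interval.\<close>

lemma T_bound: "\<exists>M\<ge>1. \<forall>t\<in>{0..\<tau>}. \<forall>x. norm (T t x) \<le> M * norm x"
proof -
  have "\<exists>d>0. \<exists>K. \<forall>t\<in>{0<..d}. \<forall>x. norm (T t x) \<le> K * norm x"
  proof (rule ccontr)
    assume neg: "\<not> ?thesis"
    have "\<exists>t. t \<in> {0<..inverse (real (Suc n))} \<and> (\<exists>x. \<not> norm (T t x) \<le> real n * norm x)" for n
    proof -
      have "0 < inverse (real (Suc n))" by simp
      with neg show ?thesis by meson
    qed
    then obtain t where t: "\<And>n. t n \<in> {0<..inverse (real (Suc n))}"
      "\<And>n. \<exists>x. \<not> norm (T (t n) x) \<le> real n * norm x"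
      by metis
    have tlim: "filterlim t (at_right 0) sequentially"
    proof -
      have "t \<longlonglongrightarrow> 0"
        by (rule tendsto_sandwich [OF _ _ tendsto_const LIMSEQ_inverse_real_of_nat])
          (use t(1) in \<open>auto intro!: always_eventually less_imp_le\<close>)
      then show ?thesis using t(1) by (auto simp: filterlim_at less_imp_neq [THEN not_sym])
    qed
    have "\<exists>K. \<forall>f\<in>range (\<lambda>n. T (t n)). \<forall>x. norm (f x) \<le> K * norm x"
    proof (rule uniform_boundedness)
      show "bounded_linear f" if "f \<in> range (\<lambda>n. T (t n))" for f
        using that t(1) by (auto intro!: T_bounded_linear less_imp_le)
      show "\<exists>K. \<forall>f\<in>range (\<lambda>n. T (t n)). norm (f x) \<le> K" for x
      proof -
        have "(\<lambda>n. T (t n) x) \<longlonglongrightarrow> x" by (rule filterlim_compose [OF T_lim tlim])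
        then have "Bseq (\<lambda>n. T (t n) x)" using convergent_imp_Bseq convergentI by blast
        then show ?thesis by (auto simp: Bseq_def)
      qed
    qed
    then obtain K where K: "\<And>n x. norm (T (t n) x) \<le> K * norm x" by blast
    obtain n where n: "K \<le> real n" using real_arch_simple by blast
    obtain x where "\<not> norm (T (t n) x) \<le> real n * norm x" using t(2) by blast
    with K [of n x] mult_right_mono [OF n, of "norm x"] show False by simp
  qed
  then obtain d K0 where d: "d > 0" and K0: "\<And>t x. t \<in> {0<..d} \<Longrightarrow> norm (T t x) \<le> K0 * norm x"
    by blast
  define K where "K = max 1 K0"
  have K1: "K \<ge> 1" by (simp add: K_def)
  have K: "norm (T t x) \<le> K * norm x" if "t \<in> {0..d}" for t x
  proof (cases "t = 0")
    case True
    then show ?thesis using mult_right_mono [OF K1, of "norm x"] by (simp add: T_0)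
  next
    case False
    then have "norm (T t x) \<le> K0 * norm x" using that by (intro K0) auto
    also have "\<dots> \<le> K * norm x" by (intro mult_right_mono) (auto simp: K_def)
    finally show ?thesis .
  qed
  have pow: "norm (T t x) \<le> K ^ Suc n * norm x" if "t \<in> {0..real n * d}" for n t x
    using that
  proof (induction n arbitrary: t x)
    case 0
    then show ?case using K [of 0 x] d by simp
  next
    case (Suc n)
    show ?case
    proof (cases "t \<le> d")
      case True
      have "norm (T t x) \<le> K * norm x" using True Suc.prems by (intro K) auto
      also have "\<dots> \<le> K ^ Suc (Suc n) * norm x"
        using K1 by (intro mult_right_mono self_le_power) auto
      finally show ?thesis .
    next
      case False
      have "T t x = T d (T (t - d) x)" using T_plus [of d "t - d" x] d False by simp
      then have "norm (T t x) \<le> K * norm (T (t - d) x)" using K [of d] d by simp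
      also have "\<dots> \<le> K * (K ^ Suc n * norm x)"
        using Suc.prems False K1 by (intro mult_left_mono Suc.IH) (auto simp: algebra_simps)
      finally show ?thesis by simp
    qed
  qed
  obtain n where n: "\<tau> / d \<le> real n" using real_arch_simple by blast
  have "norm (T t x) \<le> K ^ Suc n * norm x" if "t \<in> {0..\<tau>}" for t x
    using that n d by (intro pow) (auto simp: field_simps)
  then show ?thesis using one_le_power [OF K1] by blast
qed

text \<open>Strong continuity is given only from the right at 0. A difference at two times is
  \<open>T s\<close> applied to \<open>T h x - x\<close>, with \<open>s\<close> the smaller time and
  \<open>h\<close> the gap, and \<open>T_bound\<close> controls \<open>T s\<close>.\<close>

lemma T_continuous: "continuous_on {0..\<tau>} (\<lambda>t. T t x)"
proof -
  obtain M where M: "M \<ge> 1" "\<And>t x. t \<in> {0..\<tau>} \<Longrightarrow> norm (T t x) \<le> M * norm x" using T_bound [of \<tau>] by blast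
  have step: "norm (T t x - T s x) \<le> M * norm (T (t - s) x - x)" if "0 \<le> s" "s \<le> t" "t \<le> \<tau>" for s t
  proof -
    interpret bounded_linear "T s" using that by (intro T_bounded_linear)
    have "T t x - T s x = T s (T (t - s) x - x)" using T_plus [of s "t - s" x] that by (simp add: diff)
    then show ?thesis using M(2) [of s] that by simp
  qed
  show ?thesis
    unfolding continuous_on_iff
  proof (intro ballI allI impI)
    fix t e :: real assume t: "t \<in> {0..\<tau>}" and e: "0 < e"
    have "\<forall>\<^sub>F h in at_right 0. dist (T h x) x < e / M"
      using T_lim [of x] e M(1) by (intro tendstoD) auto
    then obtain d where d: "d > 0" "\<And>h. 0 < h \<Longrightarrow> h < d \<Longrightarrow> dist (T h x) x < e / M"
      unfolding eventually_at_right_field by auto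
    have small: "M * norm (T h x - x) < e" if "0 \<le> h" "h < d" for h
    proof (cases "h = 0")
      case True
      then show ?thesis using e by (simp add: T_0)
    next
      case False
      then show ?thesis using d(2) [of h] that M(1) by (simp add: dist_norm field_simps)
    qed
    show "\<exists>d>0. \<forall>s\<in>{0..\<tau>}. dist s t < d \<longrightarrow> dist (T s x) (T t x) < e"
    proof (intro exI conjI ballI impI)
      fix s :: real assume s: "s \<in> {0..\<tau>}" "dist s t < d"
      show "dist (T s x) (T t x) < e"
      proof (cases "s \<le> t")
        case True
        then show ?thesis using step [of s t] small [of "t - s"] s t by (auto simp: dist_norm norm_minus_commute)
      next
        case False
        then show ?thesis using step [of t s] small [of "s - t"] s t by (auto simp: dist_norm)
      qed
    qed (rule d)
  qed
qed

lemma T_A_commute: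
  assumes x: "x \<in> D" and t: "t \<ge> 0"
  shows "T t x \<in> D" "A (T t x) = T t (A x)"
proof -
  interpret bounded_linear "T t" by (rule T_bounded_linear [OF t])
  have "((\<lambda>h. (T h (T t x) - T t x) /\<^sub>R h) \<longlongrightarrow> T t (A x)) (at_right 0)"
  proof (rule Lim_transform_eventually [OF tendsto [OF A_lim [OF x]]])
    show "\<forall>\<^sub>F h in at_right 0. T t ((T h x - x) /\<^sub>R h) = (T h (T t x) - T t x) /\<^sub>R h"
      using ev_at_right
    proof eventually_elim
      case (elim h)
      have "T h (T t x) = T t (T h x)" using T_plus [OF elim t] T_plus [OF t elim] by (simp add: add.commute)
      then show ?case by (simp add: scaleR diff)
    qed
  qed
  from A_eqI [OF this] show "T t x \<in> D" "A (T t x) = T t (A x)" .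
qed

lemma T_derivative_domain:
  assumes x: "x \<in> D" and s: "0 < s"
  shows "((\<lambda>s. T s x) has_vector_derivative T s (A x)) (at s)"
proof (rule has_vector_derivativeI_quotient, rule filterlim_split_at)
  obtain M where M: "M \<ge> 1" "\<And>t x. t \<in> {0..s} \<Longrightarrow> norm (T t x) \<le> M * norm x" using T_bound [of s] by blast
  interpret Ts: bounded_linear "T s" using s by (intro T_bounded_linear) simp
  show "((\<lambda>h. (T (s + h) x - T s x) /\<^sub>R h) \<longlongrightarrow> T s (A x)) (at_right 0)"
  proof (rule Lim_transform_eventually [OF Ts.tendsto [OF A_lim [OF x]]])
    show "\<forall>\<^sub>F h in at_right 0. T s ((T h x - x) /\<^sub>R h) = (T (s + h) x - T s x) /\<^sub>R h"
      using ev_at_right by eventually_elim (use s in \<open>simp add: T_plus Ts.scaleR Ts.diff\<close>)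
  qed
  \<comment> \<open>On the left the operator \<open>T (s - h)\<close> varies with \<open>h\<close>;
    the uniform bound \<open>M\<close> absorbs this.\<close>
  show "((\<lambda>h. (T (s + h) x - T s x) /\<^sub>R h) \<longlongrightarrow> T s (A x)) (at_left 0)"
    unfolding filterlim_at_left_to_right
  proof (simp, rule Lim_transform_eventually)
    have evs: "\<forall>\<^sub>F h in at_right 0. 0 < h \<and> h < s"
      by (rule eventually_at_rightI [of 0 s]) (use s in auto)
    have cont: "((\<lambda>h. T (s - h) (A x)) \<longlongrightarrow> T s (A x)) (at_right 0)"
    proof -
      have "isCont (\<lambda>t. T t (A x)) s"
        using T_continuous [of "s + 1" "A x"] s by (intro continuous_on_interior) auto
      moreover have "((\<lambda>h. s - h) \<longlongrightarrow> s) (at_right 0)" by (auto intro!: tendsto_eq_intros)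
      ultimately show ?thesis by (rule isCont_tendsto_compose)
    qed
    have "((\<lambda>h. M * norm ((T h x - x) /\<^sub>R h - A x)) \<longlongrightarrow> M * 0) (at_right 0)"
      using A_lim [OF x] by (intro tendsto_intros tendsto_norm_zero) (simp add: LIM_zero_iff)
    then have lim0: "((\<lambda>h. M * norm ((T h x - x) /\<^sub>R h - A x)) \<longlongrightarrow> 0) (at_right 0)" by simp
    have "((\<lambda>h. T (s - h) ((T h x - x) /\<^sub>R h - A x)) \<longlongrightarrow> 0) (at_right 0)"
      by (rule Lim_null_comparison [OF eventually_mono [OF evs] lim0]) (use s in \<open>auto intro!: M\<close>)
    from tendsto_add [OF this cont]
    show "((\<lambda>h. T (s - h) ((T h x - x) /\<^sub>R h - A x) + T (s - h) (A x)) \<longlongrightarrow> T s (A x)) (at_right 0)" by simp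
    show "\<forall>\<^sub>F h in at_right 0. T (s - h) ((T h x - x) /\<^sub>R h - A x) + T (s - h) (A x) =
        - ((T (s - h) x - T s x) /\<^sub>R h)"
      using evs
    proof eventually_elim
      case (elim h)
      then interpret bounded_linear "T (s - h)" by (intro T_bounded_linear) simp
      have "T s x = T (s - h) (T h x)" using T_plus [of "s - h" h x] elim by simp
      then show ?case by (simp add: diff scaleR scaleR_diff_right)
    qed
  qed
qed

text \<open>Immediate differentiability replaces membership of \<open>y\<close> in \<open>D\<close>:
  \<open>T (s/2) y\<close> lies in \<open>D\<close>, and the derivative is that of its orbit shifted
  by \<open>s/2\<close>.\<close>

lemma T_derivative:
  assumes s: "0 < s"
  shows "((\<lambda>s. T s y) has_vector_derivative A (T s y)) (at s)"
proof -
  have x: "T (s/2) y \<in> D" using s by (intro T_mem) simp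
  have "((\<lambda>t. T t (T (s/2) y)) has_vector_derivative T (s/2) (A (T (s/2) y))) (at (s - s/2))"
    using T_derivative_domain [OF x, of "s/2"] s by simp
  moreover have "((\<lambda>t. t - s/2) has_vector_derivative 1) (at s)"
    by (auto intro!: derivative_eq_intros simp flip: has_real_derivative_iff_has_vector_derivative)
  ultimately have "((\<lambda>t. T (t - s/2) (T (s/2) y)) has_vector_derivative T (s/2) (A (T (s/2) y))) (at s)"
    using vector_diff_chain_at [of "\<lambda>t. t - s/2" 1 s "\<lambda>t. T t (T (s/2) y)"] by (simp add: o_def)
  then have "((\<lambda>t. T t y) has_vector_derivative T (s/2) (A (T (s/2) y))) (at s)"
  proof (rule has_vector_derivative_transform_within_open)
    show "T (t - s/2) (T (s/2) y) = T t y" if "t \<in> {s/2<..}" for t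
      using T_plus [of "t - s/2" "s/2" y] that s by simp
  qed (use s in auto)
  moreover have "T (s/2) (A (T (s/2) y)) = A (T s y)"
    using T_A_commute(2) [OF x, of "s/2"] T_plus [of "s/2" "s/2" y] s by simp
  ultimately show ?thesis by simp
qed

end


section \<open>Regularity of eigenvectors\<close>

lemma bounded_bilinear_scaleC:
  "bounded_bilinear (scaleC :: complex \<Rightarrow> 'a::complex_normed_vector \<Rightarrow> 'a)"
proof
  fix a b :: complex and x y :: 'a and r :: real
  show "(a + b) *\<^sub>C x = a *\<^sub>C x + b *\<^sub>C x" "a *\<^sub>C (x + y) = a *\<^sub>C x + a *\<^sub>C y"
    by (rule scaleC_add_left scaleC_add_right)+
  show "(r *\<^sub>R a) *\<^sub>C x = r *\<^sub>R a *\<^sub>C x" "a *\<^sub>C r *\<^sub>R x = r *\<^sub>R a *\<^sub>C x"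
    by (simp_all add: scaleR_scaleC_assoc scaleR_scaleC_assoc' scaleR_conv_of_real mult.commute)
  show "\<exists>K. \<forall>(a::complex) (x::'a). norm (a *\<^sub>C x) \<le> norm a * norm x * K"
    by (rule exI [of _ 1]) (simp add: norm_scaleC)
qed

lemma bounded_clinear_bound:
  assumes "bounded_clinear L"
  shows "\<exists>K>0. \<forall>x. norm (L x) \<le> K * norm x"
  using bounded_linear.pos_bounded [OF bounded_clinear_bounded_linear [OF assms]]
  by (auto simp: mult.commute)

lemma bounded_clinearI:
  assumes "\<And>x y. L (x + y) = L x + L y" "\<And>c x. L (c *\<^sub>C x) = c *\<^sub>C L x" "\<And>x. norm (L x) \<le> K * norm x"
  shows "bounded_clinear L"
  unfolding bounded_clinear_def
proof
  show "bounded_linear L"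
  proof (rule bounded_linear_intro)
    show "L (r *\<^sub>R x) = r *\<^sub>R L x" for r x
      using assms(2) [of "of_real r" x] by (simp add: scaleC_of_real)
    show "norm (L x) \<le> norm x * K" for x using assms(3) [of x] by (simp add: mult.commute)
  qed (rule assms(1))
qed (use assms(2) in blast)

lemma resolvent_setD:
  assumes "\<mu> \<in> resolvent_set D A"
  shows resolvent_mem: "resolvent D A \<mu> x \<in> D"
    and resolvent_right: "\<mu> *\<^sub>C resolvent D A \<mu> x - A (resolvent D A \<mu> x) = x"
    and resolvent_left: "x \<in> D \<Longrightarrow> resolvent D A \<mu> (\<mu> *\<^sub>C x - A x) = x"
    and resolvent_bounded_clinear: "bounded_clinear (resolvent D A \<mu>)"
proof -
  have bij: "bij_betw (\<lambda>x. \<mu> *\<^sub>C x - A x) D UNIV" and "bounded_clinear (resolvent D A \<mu>)"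
    using assms by (auto simp: resolvent_set_def)
  then show "bounded_clinear (resolvent D A \<mu>)" by simp
  have img: "x \<in> (\<lambda>x. \<mu> *\<^sub>C x - A x) ` D" using bij by (simp add: bij_betw_def)
  show "resolvent D A \<mu> x \<in> D" unfolding resolvent_def by (rule inv_into_into [OF img])
  show "\<mu> *\<^sub>C resolvent D A \<mu> x - A (resolvent D A \<mu> x) = x"
    unfolding resolvent_def by (rule f_inv_into_f [OF img])
  show "x \<in> D \<Longrightarrow> resolvent D A \<mu> (\<mu> *\<^sub>C x - A x) = x"
    unfolding resolvent_def using bij by (intro inv_into_f_f) (auto simp: bij_betw_def)
qed

text \<open>The graph norm of \<open>R x\<close> is controlled by \<open>norm x\<close>, because
  \<open>A (R x) = \<mu> *\<^sub>C R x - x\<close>. Composition with a resolvent thus makes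
  \<open>B\<close> a bounded operator on \<open>E\<close>.\<close>

lemma graph_bounded_resolvent:
  assumes B: "graph_bounded D A B" and mu: "\<mu> \<in> resolvent_set D A"
  shows "bounded_clinear (\<lambda>x. B (resolvent D A \<mu> x))"
proof -
  define R where "R = resolvent D A \<mu>"
  have R: "R x \<in> D" "\<mu> *\<^sub>C R x - A (R x) = x" "bounded_clinear R" for x
    unfolding R_def using resolvent_setD [OF mu] by auto
  interpret R: bounded_linear R by (rule bounded_clinear_bounded_linear [OF R(3)])
  obtain K where lin: "clinear_on D B" and K: "\<And>x. x \<in> D \<Longrightarrow> norm (B x) \<le> K * (norm x + norm (A x))"
    using B by (auto simp: graph_bounded_def)
  obtain M where M: "\<And>x. norm (R x) \<le> M * norm x" using bounded_clinear_bound [OF R(3)] by blast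
  have AR: "A (R x) = \<mu> *\<^sub>C R x - x" for x using R(2) [of x] by (simp add: algebra_simps)
  have "bounded_clinear (\<lambda>x. B (R x))"
  proof (rule bounded_clinearI)
    show "B (R (x + y)) = B (R x) + B (R y)" for x y
      by (simp add: R.add clinear_on_add [OF lin] R)
    show "B (R (c *\<^sub>C x)) = c *\<^sub>C B (R x)" for c x
      by (simp add: bounded_clinear_scaleC [OF R(3)] clinear_on_scale [OF lin] R)
    show "norm (B (R x)) \<le> \<bar>K\<bar> * (M + (cmod \<mu> * M + 1)) * norm x" for x
    proof -
      have "norm (A (R x)) \<le> cmod \<mu> * (M * norm x) + norm x"
        unfolding AR using M [of x]
        by (intro order_trans [OF norm_triangle_ineq4] add_mono) (auto simp: norm_scaleC intro: mult_left_mono)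
      then have "norm (R x) + norm (A (R x)) \<le> (M + (cmod \<mu> * M + 1)) * norm x"
        using M [of x] by (simp add: algebra_simps)
      moreover have "norm (B (R x)) \<le> \<bar>K\<bar> * (norm (R x) + norm (A (R x)))"
        using K [OF R(1), of x] by (rule order_trans) (intro mult_right_mono, auto)
      ultimately show ?thesis
        by (smt (verit) abs_ge_zero mult.assoc mult_left_mono)
    qed
  qed
  then show ?thesis by (simp add: R_def)
qed

context differentiable_semigroup
begin

lemma exp_T_derivative:
  assumes s: "0 < s"
  shows "((\<lambda>s. exp (- \<mu> * of_real s) *\<^sub>C T s y) has_vector_derivative
    - (exp (- \<mu> * of_real s) *\<^sub>C (\<mu> *\<^sub>C T s y - A (T s y)))) (at s)"
proof -
  have e: "((\<lambda>s. exp (- \<mu> * of_real s)) has_vector_derivative - \<mu> * exp (- \<mu> * of_real s)) (at s)"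
    by (rule has_vector_derivative_real_field) (auto intro!: derivative_eq_intros)
  from bounded_bilinear.has_vector_derivative [OF bounded_bilinear_scaleC e T_derivative [OF s, of y]]
  show ?thesis
    by (simp add: scaleC_diff_right scaleC_scaleC scaleC_minus_left mult.commute)
qed

text \<open>For \<open>L\<close> equal to \<open>B\<close> after the resolvent at \<mu>, the
  derivative is \<open>exp (- \<mu> s) B (T s y)\<close>. The integral of this possibly singular
  function is thereby represented by a bounded operator applied to a curve that is continuous up to
  \<open>s = 0\<close>.\<close>

lemma bounded_T_derivative:
  assumes s: "0 < s" and L: "bounded_clinear L"
  shows "((\<lambda>s. L (y - exp (- \<mu> * of_real s) *\<^sub>C T s y)) has_vector_derivative
    exp (- \<mu> * of_real s) *\<^sub>C L (\<mu> *\<^sub>C T s y - A (T s y))) (at s)"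
proof -
  interpret bounded_linear L by (rule bounded_clinear_bounded_linear [OF L])
  have "((\<lambda>s. y - exp (- \<mu> * of_real s) *\<^sub>C T s y) has_vector_derivative
      0 - - (exp (- \<mu> * of_real s) *\<^sub>C (\<mu> *\<^sub>C T s y - A (T s y)))) (at s)"
    by (rule has_vector_derivative_diff [OF has_vector_derivative_const exp_T_derivative [OF s]])
  from has_vector_derivative [OF this] show ?thesis
    by (simp add: bounded_clinear_scaleC [OF L])
qed

lemma exp_T_continuous: "continuous_on {0..\<tau>} (\<lambda>s. exp (- \<mu> * of_real s) *\<^sub>C T s y)"
  by (intro bounded_bilinear.continuous_on [OF bounded_bilinear_scaleC] T_continuous continuous_intros)

lemma bounded_T_continuous:
  assumes L: "bounded_clinear L"
  shows "continuous_on {0..\<tau>} (\<lambda>s. L (y - exp (- \<mu> * of_real s) *\<^sub>C T s y))"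
  by (intro bounded_linear.continuous_on [OF bounded_clinear_bounded_linear [OF L]]
      continuous_on_diff continuous_on_const exp_T_continuous)

lemma norm_exp_le: "0 \<le> s \<Longrightarrow> s \<le> t \<Longrightarrow> cmod (exp (- \<mu> * of_real s)) \<le> exp (cmod \<mu> * t)"
proof -
  assume s: "0 \<le> s" "s \<le> t"
  have "- Re \<mu> * s \<le> cmod \<mu> * t"
    using s abs_Re_le_cmod [of \<mu>] by (intro mult_mono) auto
  then show ?thesis by simp
qed

end

text \<open>Mean value inequality against the primitive
  \<open>k * s powr (1 - \<beta>) / (1 - \<beta>)\<close>. Continuity at 0 and a derivative on the
  open interval are enough, so the singular derivative is never integrated.\<close>

lemma powr_integral_bound:
  fixes f :: "real \<Rightarrow> 'b::real_normed_vector"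
  assumes t: "0 < t" and beta: "0 \<le> \<beta>" "\<beta> < 1"
    and cont: "continuous_on {0..t} f"
    and der: "\<And>s. 0 < s \<Longrightarrow> s < t \<Longrightarrow> (f has_vector_derivative f' s) (at s)"
    and bd: "\<And>s. 0 < s \<Longrightarrow> s < t \<Longrightarrow> norm (f' s) \<le> k * s powr (- \<beta>)"
  shows "norm (f t - f 0) \<le> k * t powr (1 - \<beta>) / (1 - \<beta>)"
proof -
  define \<phi> where "\<phi> s = k * s powr (1 - \<beta>) / (1 - \<beta>)" for s
  have "norm (f t - f 0) \<le> \<phi> t - \<phi> 0"
  proof (rule differentiable_bound_general [OF t cont _ der])
    show "continuous_on {0..t} \<phi>"
      unfolding \<phi>_def using beta by (intro continuous_intros continuous_on_powr') auto
    show "(\<phi> has_vector_derivative k * s powr (- \<beta>)) (at s)" if "0 < s" "s < t" for s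
      unfolding \<phi>_def has_real_derivative_iff_has_vector_derivative [symmetric]
      using that beta by (auto intro!: derivative_eq_intros)
    show "norm (f' s) \<le> k * s powr (- \<beta>)" if "0 < s" "s < t" for s by (rule bd [OF that])
  qed
  then show ?thesis using beta by (simp add: \<phi>_def)
qed

text \<open>Data for one fixed \<kappa>; the constants may depend on it. Gauge estimates are phrased
  as inclusions of order balls of arbitrary radius \<open>a\<close>.\<close>

locale regularity = differentiable_semigroup T D A
  for T :: "real \<Rightarrow> 'a::banach_lattice complexification \<Rightarrow> 'a complexification" and D A +
  fixes u :: "'a complexification" and B :: "'a complexification \<Rightarrow> 'a complexification"
    and C1 \<alpha> C2 C3 \<beta> q t0 :: real
  assumes u: "0 \<le> u"
    and smooth: "t \<in> {0<..1} \<Longrightarrow> T t x \<in> order_ball u (C1 * t powr (- \<alpha>) * norm x)"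
    and T_ideal: "t \<in> {0<..1} \<Longrightarrow> 0 \<le> a \<Longrightarrow> x \<in> order_ball u a \<Longrightarrow> T t x \<in> order_ball u (C2 * a)"
    and B_ideal: "t \<in> {0<..1} \<Longrightarrow> 0 \<le> a \<Longrightarrow> x \<in> order_ball u a \<Longrightarrow>
      B (T t x) \<in> order_ball u (C3 * t powr (- \<beta>) * a)"
    and B_graph: "graph_bounded D A B"
    and q: "0 < q" "q < 1" and t0: "0 < t0"
    and miyadera: "x \<in> D \<Longrightarrow> integral {0..t0} (\<lambda>s. norm (B (T s x))) \<le> q * norm x"
    and C1: "0 \<le> C1" and C2: "0 \<le> C2" and C3: "0 \<le> C3" and beta: "0 \<le> \<beta>" "\<beta> < 1"
begin

text \<open>Integration in \<open>E_u\<close> without an \<open>E_u\<close>-valued integral: each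
  functional of the polar turns the claim into a scalar inequality with an integrable singularity,
  and the bipolar theorem returns to the order ball.\<close>

lemma order_ball_integral:
  assumes t: "0 < t" "t \<le> 1" and L: "bounded_clinear L" and k: "0 \<le> k" and b: "0 \<le> b" "b < 1"
    and bd: "\<And>s. 0 < s \<Longrightarrow> s < t \<Longrightarrow> L (\<mu> *\<^sub>C T s y - A (T s y)) \<in> order_ball u (k * s powr (- b))"
  shows "L (y - exp (- \<mu> * of_real t) *\<^sub>C T t y) \<in> order_ball u (exp (cmod \<mu>) * k * t powr (1 - b) / (1 - b))"
proof (rule order_ball_polar [OF u])
  show "0 \<le> exp (cmod \<mu>) * k * t powr (1 - b) / (1 - b)" using k b by simp
  fix \<psi> assume psi: "\<psi> \<in> order_polar u"
  then have f: "functional \<psi>" by (simp add: order_polar_def)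
  interpret psi: bounded_linear \<psi> by (rule functional_bounded_linear [OF f])
  interpret L: bounded_linear L by (rule bounded_clinear_bounded_linear [OF L])
  define g where "g s = \<psi> (L (y - exp (- \<mu> * of_real s) *\<^sub>C T s y))" for s
  have "norm (g t - g 0) \<le> (exp (cmod \<mu>) * k) * t powr (1 - b) / (1 - b)"
  proof (rule powr_integral_bound [OF t(1) b])
    show "continuous_on {0..t} g"
      unfolding g_def by (intro psi.continuous_on bounded_T_continuous L)
    fix s assume s: "0 < s" "s < t"
    show "(g has_vector_derivative \<psi> (exp (- \<mu> * of_real s) *\<^sub>C L (\<mu> *\<^sub>C T s y - A (T s y)))) (at s)"
      unfolding g_def [abs_def] by (intro psi.has_vector_derivative bounded_T_derivative s L)
    have "cmod (\<psi> (L (\<mu> *\<^sub>C T s y - A (T s y)))) \<le> k * s powr (- b)"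
      using k by (intro order_polarD [OF u psi bd [OF s]]) simp
    moreover have "cmod (exp (- \<mu> * of_real s)) \<le> exp (cmod \<mu>)"
      using norm_exp_le [of s 1 \<mu>] s t by simp
    ultimately show "norm (\<psi> (exp (- \<mu> * of_real s) *\<^sub>C L (\<mu> *\<^sub>C T s y - A (T s y)))) \<le>
        exp (cmod \<mu>) * k * s powr (- b)"
      unfolding functional_scaleC [OF f] norm_mult mult.assoc by (intro mult_mono) auto
  qed
  moreover have "g 0 = 0" by (simp add: g_def T_0 L.zero psi.zero)
  ultimately show "cmod (\<psi> (L (y - exp (- \<mu> * of_real t) *\<^sub>C T t y)))
      \<le> exp (cmod \<mu>) * k * t powr (1 - b) / (1 - b)"
    by (simp add: g_def)
qed

lemma B_linear: "clinear_on D B"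
  using B_graph by (simp add: graph_bounded_def)

text \<open>The smallness constant \<open>q\<close> is given for vectors of \<open>D\<close>. There
  the left side is the norm of the integral of \<open>exp (- \<mu> s) B (T s x)\<close> over
  \<open>[0, t]\<close>. A general \<open>y\<close> is approximated by \<open>T h y\<close>, which
  lies in \<open>D\<close>, with \<open>h\<close> tending to 0.\<close>

lemma miyadera_small:
  assumes mu: "\<mu> \<in> resolvent_set D A" and t: "0 < t" "t \<le> t0"
  shows "norm (B (resolvent D A \<mu> (y - exp (- \<mu> * of_real t) *\<^sub>C T t y))) \<le> exp (cmod \<mu> * t) * q * norm y"
proof -
  define K where "K x = B (resolvent D A \<mu> x)" for x
  have K: "bounded_clinear K"
    unfolding K_def [abs_def] by (rule graph_bounded_resolvent [OF B_graph mu])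
  interpret K: bounded_linear K by (rule bounded_clinear_bounded_linear [OF K])
  have KB: "K (\<mu> *\<^sub>C x - A x) = B x" if "x \<in> D" for x
    by (simp add: K_def resolvent_left [OF mu that])
  have dom: "norm (K (x - exp (- \<mu> * of_real t) *\<^sub>C T t x)) \<le> exp (cmod \<mu> * t) * q * norm x"
    if x: "x \<in> D" for x
  proof -
    define f where "f s = K (x - exp (- \<mu> * of_real s) *\<^sub>C T s x)" for s
    have TsD: "T s x \<in> D" if "s \<ge> 0" for s by (rule T_A_commute(1) [OF x that])
    \<comment> \<open>Moving the generator through \<open>T s\<close> exhibits
      \<open>B (T s x)\<close> as a bounded operator applied to an orbit. It is therefore continuous
      in \<open>s\<close> and genuinely integrable, so \<open>integral\<close> does not take its
      default value 0.\<close>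
    have BT: "B (T s x) = K (T s (\<mu> *\<^sub>C x - A x))" if "s \<ge> 0" for s
    proof -
      interpret Ts: bounded_linear "T s" by (rule T_bounded_linear [OF that])
      show ?thesis
        using KB [OF TsD [OF that]] by (simp add: T_A_commute(2) [OF x that] T_scaleC [OF that] Ts.diff)
    qed
    have cB: "continuous_on {0..\<tau>} (\<lambda>s. B (T s x))" for \<tau>
    proof (subst continuous_on_cong [OF refl BT])
      show "continuous_on {0..\<tau>} (\<lambda>s. K (T s (\<mu> *\<^sub>C x - A x)))"
        by (intro K.continuous_on T_continuous)
    qed auto
    have int: "((\<lambda>s. exp (- \<mu> * of_real s) *\<^sub>C B (T s x)) has_integral f t - f 0) {0..t}"
    proof (rule fundamental_theorem_of_calculus_interior)
      show "continuous_on {0..t} f" unfolding f_def by (rule bounded_T_continuous [OF K])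
      show "(f has_vector_derivative exp (- \<mu> * of_real s) *\<^sub>C B (T s x)) (at s)" if "s \<in> {0<..<t}" for s
        using bounded_T_derivative [OF _ K, of s x \<mu>] that KB [OF TsD, of s]
        by (simp add: f_def [abs_def])
    qed (use t in simp)
    have ni: "(\<lambda>s. norm (B (T s x))) integrable_on {0..\<tau>}" for \<tau>
      by (intro integrable_continuous_interval continuous_on_norm cB)
    have "norm (f t - f 0) = norm (integral {0..t} (\<lambda>s. exp (- \<mu> * of_real s) *\<^sub>C B (T s x)))"
      by (simp only: integral_unique [OF int])
    also have "\<dots> \<le> integral {0..t} (\<lambda>s. exp (cmod \<mu> * t) * norm (B (T s x)))"
    proof (rule integral_norm_bound_integral)
      show "(\<lambda>s. exp (cmod \<mu> * t) * norm (B (T s x))) integrable_on {0..t}"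
        by (intro integrable_on_mult_right ni)
      show "norm (exp (- \<mu> * of_real s) *\<^sub>C B (T s x)) \<le> exp (cmod \<mu> * t) * norm (B (T s x))"
        if "s \<in> {0..t}" for s
        unfolding norm_scaleC using that norm_exp_le [of s t \<mu>] by (intro mult_right_mono) auto
    qed (use int in blast)
    also have "\<dots> = exp (cmod \<mu> * t) * integral {0..t} (\<lambda>s. norm (B (T s x)))"
      by simp
    also have "\<dots> \<le> exp (cmod \<mu> * t) * integral {0..t0} (\<lambda>s. norm (B (T s x)))"
      using t by (intro mult_left_mono integral_subset_le ni) auto
    also have "\<dots> \<le> exp (cmod \<mu> * t) * (q * norm x)"
      by (intro mult_left_mono miyadera x) simp
    finally show ?thesis by (simp add: f_def T_0 K.zero mult.assoc)
  qed
  have Tt: "bounded_linear (T t)" using t by (intro T_bounded_linear) simp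
  have "((\<lambda>h. norm (K (T h y - exp (- \<mu> * of_real t) *\<^sub>C T t (T h y)))) \<longlongrightarrow>
      norm (K (y - exp (- \<mu> * of_real t) *\<^sub>C T t y))) (at_right 0)"
    by (intro tendsto_norm K.tendsto tendsto_diff tendsto_scaleC tendsto_const
        bounded_linear.tendsto [OF Tt] T_lim)
  moreover have "((\<lambda>h. exp (cmod \<mu> * t) * q * norm (T h y)) \<longlongrightarrow> exp (cmod \<mu> * t) * q * norm y) (at_right 0)"
    by (intro tendsto_intros T_lim)
  moreover have "\<forall>\<^sub>F h in at_right 0. norm (K (T h y - exp (- \<mu> * of_real t) *\<^sub>C T t (T h y))) \<le>
      exp (cmod \<mu> * t) * q * norm (T h y)"
    by (rule eventually_at_rightI [of 0 1], rule dom, rule T_mem) auto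
  ultimately have "norm (K (y - exp (- \<mu> * of_real t) *\<^sub>C T t y)) \<le> exp (cmod \<mu> * t) * q * norm y"
    by (intro tendsto_le [OF trivial_limit_at_right_real]) 
  then show ?thesis by (simp add: K_def)
qed

text \<open>With \<open>y = (\<mu> - A) v\<close>, variation of constants gives
  \<open>y = b + V t y\<close>, where \<open>V t\<close> is the integral of
  \<open>exp (- \<mu> s) B' (T s)\<close> over \<open>[0, t]\<close> and
  \<open>B' = B + (\<mu> - \<nu>)\<close>. For small \<open>t\<close> this \<open>V t\<close>
  contracts \<open>E\<close> and also maps each order ball into the one of half the radius. The
  iterates from 0 stay in one order ball while converging in \<open>E\<close>, and closedness puts
  \<open>y\<close> into that ball. Membership of \<open>v\<close> and of \<open>B v\<close> follows
  from that of \<open>y\<close>.\<close>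

theorem eigenvector_regularity:
  assumes mu: "\<mu> \<in> resolvent_set D A" and v: "v \<in> D" "A v + B v = \<nu> *\<^sub>C v"
  shows "\<exists>b\<ge>0. v \<in> order_ball u b \<and> B v \<in> order_ball u b"
proof -
  define R where "R = resolvent D A \<mu>"
  define B' where "B' x = B x + (\<mu> - \<nu>) *\<^sub>C x" for x
  define y where "y = B' v"
  have R: "bounded_clinear R" unfolding R_def by (rule resolvent_bounded_clinear [OF mu])
  have Rl: "R (\<mu> *\<^sub>C x - A x) = x" if "x \<in> D" for x
    unfolding R_def by (rule resolvent_left [OF mu that])
  have K: "bounded_clinear (\<lambda>x. B (R x))"
    unfolding R_def by (rule graph_bounded_resolvent [OF B_graph mu])
  interpret R: bounded_linear R by (rule bounded_clinear_bounded_linear [OF R])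
  interpret K: bounded_linear "\<lambda>x. B (R x)" by (rule bounded_clinear_bounded_linear [OF K])
  have K': "bounded_clinear (\<lambda>x. B' (R x))"
    unfolding bounded_clinear_def B'_def
    by (intro conjI bounded_linear_add K.bounded_linear_axioms
        bounded_linear_compose [OF bounded_bilinear.bounded_linear_right [OF bounded_bilinear_scaleC] R.bounded_linear_axioms])
      (simp add: bounded_clinear_scaleC [OF R] clinear_on_scale [OF B_linear] resolvent_mem [OF mu, folded R_def] scaleC_add_right scaleC_scaleC mult.commute)
  interpret K': bounded_linear "\<lambda>x. B' (R x)" by (rule bounded_clinear_bounded_linear [OF K'])
  define V where "V t z = B' (R (z - exp (- \<mu> * of_real t) *\<^sub>C T t z))" for t z
  have "\<mu> *\<^sub>C v - A v = y"
    using v(2) by (simp add: y_def B'_def scaleC_diff_left algebra_simps)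
  then have Ry: "R y = v" using Rl [OF v(1)] by simp
  have RT: "R (T t y) = T t v" if "t \<ge> 0" for t
  proof -
    interpret Tt: bounded_linear "T t" by (rule T_bounded_linear [OF that])
    have "T t y = \<mu> *\<^sub>C T t v - A (T t v)"
      using T_A_commute(2) [OF v(1) that] \<open>\<mu> *\<^sub>C v - A v = y\<close> Tt.diff [of "\<mu> *\<^sub>C v" "A v"] T_scaleC [OF that, of \<mu> v]
      by simp
    then show ?thesis using Rl [OF T_A_commute(1) [OF v(1) that]] by simp
  qed
  obtain M where M: "M \<ge> 1" "\<And>t x. t \<in> {0..1} \<Longrightarrow> norm (T t x) \<le> M * norm x"
    using T_bound [of 1] by blast
  have Rsmall: "norm (R (z - exp (- \<mu> * of_real t) *\<^sub>C T t z)) \<le> exp (cmod \<mu>) * M * norm z * t"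
    if t: "0 < t" "t \<le> 1" for t z
  proof -
    have "norm (R (z - exp (- \<mu> * of_real t) *\<^sub>C T t z) - R (z - exp (- \<mu> * of_real 0) *\<^sub>C T 0 z))
        \<le> (exp (cmod \<mu>) * M * norm z) * t powr (1 - 0) / (1 - 0)"
    proof (rule powr_integral_bound [OF t(1), where f = "\<lambda>s. R (z - exp (- \<mu> * of_real s) *\<^sub>C T s z)"])
      fix s assume s: "0 < s" "s < t"
      show "((\<lambda>s. R (z - exp (- \<mu> * of_real s) *\<^sub>C T s z)) has_vector_derivative
          exp (- \<mu> * of_real s) *\<^sub>C T s z) (at s)"
        using bounded_T_derivative [OF s(1) R, of z \<mu>] Rl [OF T_mem [OF s(1)]] by simp
      show "norm (exp (- \<mu> * of_real s) *\<^sub>C T s z) \<le> exp (cmod \<mu>) * M * norm z * s powr (- 0)"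
        unfolding norm_scaleC using norm_exp_le [of s 1 \<mu>] M(2) [of s z] s t
        by (simp add: mult.assoc mult_mono)
    qed (use bounded_T_continuous [OF R] in auto)
    then show ?thesis using t by (simp add: T_0 R.zero)
  qed
  have ord: "V t z \<in> order_ball u (exp (cmod \<mu>) * (C3 + cmod (\<mu> - \<nu>) * C2) * t powr (1 - \<beta>) / (1 - \<beta>) * a)"
    if t: "0 < t" "t \<le> 1" and a: "0 \<le> a" "z \<in> order_ball u a" for t z a
  proof -
    have "V t z \<in> order_ball u (exp (cmod \<mu>) * ((C3 + cmod (\<mu> - \<nu>) * C2) * a) * t powr (1 - \<beta>) / (1 - \<beta>))"
      unfolding V_def
    proof (rule order_ball_integral [OF t K' _ beta])
      show "0 \<le> (C3 + cmod (\<mu> - \<nu>) * C2) * a" using a C2 C3 by simp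
      fix s assume s: "0 < s" "s < t"
      then have s1: "s \<in> {0<..1}" using t by simp
      have "B' (T s z) \<in> order_ball u (C3 * s powr (- \<beta>) * a + cmod (\<mu> - \<nu>) * (C2 * a))"
        unfolding B'_def
        by (intro order_ball_add [OF u] order_ball_scaleC [OF u] B_ideal T_ideal s1 a)
      \<comment> \<open>Since \<open>s < 1\<close>, the bounded contribution of
        \<open>\<mu> - \<nu>\<close> is absorbed into the singular rate
        \<open>s powr (- \<beta>)\<close>.\<close>
      moreover have "1 \<le> s powr (- \<beta>)"
        using s t beta by (simp add: powr_minus one_le_inverse powr_le1)
      then have "cmod (\<mu> - \<nu>) * (C2 * a) * 1 \<le> cmod (\<mu> - \<nu>) * (C2 * a) * s powr (- \<beta>)"
        using C2 a by (intro mult_left_mono) auto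
      then have "C3 * s powr (- \<beta>) * a + cmod (\<mu> - \<nu>) * (C2 * a) \<le>
          (C3 + cmod (\<mu> - \<nu>) * C2) * a * s powr (- \<beta>)" by (simp add: algebra_simps)
      ultimately have "B' (T s z) \<in> order_ball u ((C3 + cmod (\<mu> - \<nu>) * C2) * a * s powr (- \<beta>))"
        using order_ball_mono [OF u] by blast
      then show "B' (R (\<mu> *\<^sub>C T s z - A (T s z))) \<in> order_ball u ((C3 + cmod (\<mu> - \<nu>) * C2) * a * s powr (- \<beta>))"
        using Rl [OF T_mem [OF s(1)]] by simp
    qed
    then show ?thesis by (simp add: mult_ac)
  qed
  have small: "norm (V t z) \<le> (exp (cmod \<mu> * t) * q + cmod (\<mu> - \<nu>) * (exp (cmod \<mu>) * M * t)) * norm z"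
    if t: "0 < t" "t \<le> 1" "t \<le> t0" for t z
  proof -
    have "norm (V t z) \<le> exp (cmod \<mu> * t) * q * norm z + cmod (\<mu> - \<nu>) * (exp (cmod \<mu>) * M * norm z * t)"
      unfolding V_def B'_def
    proof (rule order_trans [OF norm_triangle_ineq add_mono])
      show "norm (B (R (z - exp (- \<mu> * of_real t) *\<^sub>C T t z))) \<le> exp (cmod \<mu> * t) * q * norm z"
        unfolding R_def by (rule miyadera_small [OF mu t(1,3)])
      show "norm ((\<mu> - \<nu>) *\<^sub>C R (z - exp (- \<mu> * of_real t) *\<^sub>C T t z)) \<le>
          cmod (\<mu> - \<nu>) * (exp (cmod \<mu>) * M * norm z * t)"
        unfolding norm_scaleC by (intro mult_left_mono Rsmall t) simp
    qed
    then show ?thesis by (simp add: algebra_simps)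
  qed
  have "((\<lambda>t. exp (cmod \<mu> * t) * q + cmod (\<mu> - \<nu>) * (exp (cmod \<mu>) * M * t)) \<longlongrightarrow>
      exp (cmod \<mu> * 0) * q + cmod (\<mu> - \<nu>) * (exp (cmod \<mu>) * M * 0)) (at_right 0)"
    by (intro tendsto_intros)
  then have ev1: "\<forall>\<^sub>F t in at_right 0. exp (cmod \<mu> * t) * q + cmod (\<mu> - \<nu>) * (exp (cmod \<mu>) * M * t) < 1"
    using q by (intro order_tendstoD) auto
  have "((\<lambda>t. t powr (1 - \<beta>)) \<longlongrightarrow> 0) (at_right 0)"
    using beta by (intro tendsto_eq_intros | simp add: eventually_at_filter)+
  then have "((\<lambda>t. exp (cmod \<mu>) * (C3 + cmod (\<mu> - \<nu>) * C2) * t powr (1 - \<beta>) / (1 - \<beta>)) \<longlongrightarrow>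
      exp (cmod \<mu>) * (C3 + cmod (\<mu> - \<nu>) * C2) * 0 / (1 - \<beta>)) (at_right 0)"
    using beta by (intro tendsto_intros) auto
  then have ev2: "\<forall>\<^sub>F t in at_right 0. exp (cmod \<mu>) * (C3 + cmod (\<mu> - \<nu>) * C2) * t powr (1 - \<beta>) / (1 - \<beta>) < 1/2"
    by (intro order_tendstoD) auto
  have ev3: "\<forall>\<^sub>F t in at_right 0. 0 < t \<and> t < min 1 t0"
    by (rule eventually_at_rightI [of 0 "min 1 t0"]) (use t0 in auto)
  \<comment> \<open>One \<open>t\<close> serves both purposes: \<open>q < 1\<close> makes
    \<open>V t\<close> a contraction on \<open>E\<close>, and \<open>\<beta> < 1\<close> makes it
    halve order balls.\<close>
  obtain t where t: "0 < t" "t < 1" "t < t0"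
    and t1: "exp (cmod \<mu> * t) * q + cmod (\<mu> - \<nu>) * (exp (cmod \<mu>) * M * t) < 1"
    and t2: "exp (cmod \<mu>) * (C3 + cmod (\<mu> - \<nu>) * C2) * t powr (1 - \<beta>) / (1 - \<beta>) < 1/2"
    using eventually_happens' [OF _ eventually_conj [OF ev1 eventually_conj [OF ev2 ev3]]] by auto
  define Q where "Q = exp (cmod \<mu> * t) * q + cmod (\<mu> - \<nu>) * (exp (cmod \<mu>) * M * t)"
  have Q: "0 \<le> Q" "Q < 1" "norm (V t z) \<le> Q * norm z" for z
    using t1 small [of t z] t M(1) q by (auto simp: Q_def)
  have half: "V t z \<in> order_ball u (a / 2)" if "0 \<le> a" "z \<in> order_ball u a" for a z
    using mult_right_mono [OF less_imp_le [OF t2] that(1)] order_ball_mono [OF u _ ord [OF t(1) _ that]] t by simp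
  define b where "b = exp (- \<mu> * of_real t) *\<^sub>C B' (T t v)"
  have fixpoint: "y = b + V t y"
  proof -
    have "V t y = B' (R y) - B' (R (exp (- \<mu> * of_real t) *\<^sub>C T t y))" by (simp only: V_def K'.diff)
    also have "B' (R (exp (- \<mu> * of_real t) *\<^sub>C T t y)) = b"
      using t by (simp add: b_def bounded_clinear_scaleC [OF K'] RT del: of_real_minus)
    finally have "V t y = y - b" by (simp only: Ry y_def [symmetric])
    then show ?thesis by simp
  qed
  \<comment> \<open>Half of the time is spent entering \<open>E_u\<close> by smoothing; during the
    other half \<open>B'\<close> acts on an orbit that starts in \<open>E_u\<close>.\<close>
  have half_t: "t / 2 \<in> {0<..1}" using t by simp
  define a1 where "a1 = C1 * (t / 2) powr (- \<alpha>) * norm v"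
  have a1: "0 \<le> a1" "T (t / 2) v \<in> order_ball u a1"
    unfolding a1_def using C1 smooth [OF half_t, of v] by auto
  have Ttv: "T t v = T (t / 2) (T (t / 2) v)" using T_plus [of "t / 2" "t / 2" v] t by simp
  have Tball: "T t v \<in> order_ball u (C2 * a1)" unfolding Ttv by (rule T_ideal [OF half_t a1])
  obtain c where c: "c \<ge> 0" "b \<in> order_ball u c"
  proof
    show "b \<in> order_ball u (cmod (exp (- \<mu> * of_real t)) *
        (C3 * (t / 2) powr (- \<beta>) * a1 + cmod (\<mu> - \<nu>) * (C2 * a1)))"
      unfolding b_def B'_def
      by (intro order_ball_scaleC [OF u] order_ball_add [OF u] Tball)
        (unfold Ttv, rule B_ideal [OF half_t a1])
    show "0 \<le> cmod (exp (- \<mu> * of_real t)) *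
        (C3 * (t / 2) powr (- \<beta>) * a1 + cmod (\<mu> - \<nu>) * (C2 * a1))"
      using C2 C3 a1(1) by simp
  qed
  define w where "w n = ((\<lambda>z. b + V t z) ^^ n) 0" for n
  have w: "w 0 = 0" "w (Suc n) = b + V t (w n)" for n by (simp_all add: w_def)
  \<comment> \<open>The radius \<open>2 * c\<close> solves \<open>a = c + a / 2\<close>.\<close>
  have wball: "w n \<in> order_ball u (2 * c)" for n
  proof (induction n)
    case 0
    then show ?case using c order_ball_zero [OF u] by (simp add: w)
  next
    case (Suc n)
    have "b + V t (w n) \<in> order_ball u (c + 2 * c / 2)"
      using c by (intro order_ball_add [OF u] half Suc) auto
    then show ?case by (simp add: w)
  qed
  have err: "norm (w n - y) \<le> norm y * Q ^ n" for n
  proof (induction n)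
    case 0
    then show ?case by (simp add: w)
  next
    case (Suc n)
    interpret Tt: bounded_linear "T t" by (rule T_bounded_linear) (use t in simp)
    have Vdiff: "V t z - V t z' = V t (z - z')" for z z'
      unfolding V_def by (simp only: K'.diff [symmetric] Tt.diff scaleC_diff_right) (simp add: algebra_simps)
    have "w (Suc n) - y = V t (w n - y)" by (subst fixpoint) (simp add: w flip: Vdiff)
    then have "norm (w (Suc n) - y) \<le> Q * (norm y * Q ^ n)"
      using Q(3) [of "w n - y"] mult_left_mono [OF Suc Q(1)] by simp
    then show ?case by (simp add: mult_ac)
  qed
  have "(\<lambda>n. norm y * Q ^ n) \<longlonglongrightarrow> norm y * 0"
    using Q by (intro tendsto_intros LIMSEQ_realpow_zero) auto
  then have "(\<lambda>n. w n - y) \<longlonglongrightarrow> 0"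
    by (intro Lim_null_comparison [OF always_eventually [OF allI [OF err]]]) simp
  then have "w \<longlonglongrightarrow> y" by (simp add: LIM_zero_iff)
  then have yball: "y \<in> order_ball u (2 * c)" by (rule order_ball_lim [OF u wball _ tendsto_const])
  \<comment> \<open>The same device with \<open>L = R\<close>: the integral of
    \<open>exp (- \<mu> s) T s y\<close> is \<open>v - exp (- \<mu> t) T t v\<close>, and its
    integrand has no singularity in \<open>E_u\<close>.\<close>
  have "R (y - exp (- \<mu> * of_real t) *\<^sub>C T t y) \<in> order_ball u (exp (cmod \<mu>) * (C2 * (2 * c)) * t powr (1 - 0) / (1 - 0))"
  proof (rule order_ball_integral [OF t(1) _ R])
    fix s assume s: "0 < s" "s < t"
    then have "T s y \<in> order_ball u (C2 * (2 * c))" using t c by (intro T_ideal yball) auto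
    then show "R (\<mu> *\<^sub>C T s y - A (T s y)) \<in> order_ball u (C2 * (2 * c) * s powr (- 0))"
      using Rl [OF T_mem [OF s(1)]] s by simp
  qed (use t c C2 in auto)
  moreover have "R (y - exp (- \<mu> * of_real t) *\<^sub>C T t y) = v - exp (- \<mu> * of_real t) *\<^sub>C T t v"
    using t by (simp only: R.diff bounded_clinear_scaleC [OF R] RT Ry less_imp_le)
  ultimately have "v - exp (- \<mu> * of_real t) *\<^sub>C T t v \<in> order_ball u (exp (cmod \<mu>) * (C2 * (2 * c)) * t powr (1 - 0) / (1 - 0))"
    by simp
  from order_ball_add [OF u this order_ball_scaleC [OF u Tball, of "exp (- \<mu> * of_real t)"]]
  obtain d where vball: "v \<in> order_ball u d" by auto
  have "B v = y + (- (\<mu> - \<nu>)) *\<^sub>C v" by (simp add: y_def B'_def scaleC_diff_left)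
  with order_ball_add [OF u yball order_ball_scaleC [OF u vball, of "- (\<mu> - \<nu>)"]]
  obtain e where Bball: "B v \<in> order_ball u e" by auto
  define m where "m = max 0 (max d e)"
  have "0 \<le> m" "v \<in> order_ball u m" "B v \<in> order_ball u m"
    using order_ball_mono [OF u _ vball, of m] order_ball_mono [OF u _ Bball, of m] by (auto simp: m_def)
  then show ?thesis by blast
qed

end


section \<open>Simple poles of the resolvent\<close>

lemma one_dim_multiple:
  assumes dim: "complex_vector.dim S = 1" and v: "v \<in> S" "v \<noteq> 0" and x: "x \<in> S"
  shows "\<exists>c. x = c *\<^sub>C v"
proof -
  obtain Bs where B: "Bs \<subseteq> S" "S \<subseteq> complex_vector.span Bs" "card Bs = complex_vector.dim S"
    by (rule complex_vector.basis_exists)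
  then have "card Bs = 1" using dim by simp
  then obtain b where b: "Bs = {b}" by (rule card_1_singletonE)
  have "\<exists>c. z = c *\<^sub>C b" if "z \<in> S" for z
  proof -
    have "z \<in> range (\<lambda>c. c *\<^sub>C b)"
      using that B(2) unfolding b complex_vector.span_singleton by (rule subsetD [rotated])
    then show ?thesis by auto
  qed
  from this [OF v(1)] this [OF x] obtain a c where "v = a *\<^sub>C b" "x = c *\<^sub>C b" by auto
  moreover have "a \<noteq> 0" using v(2) \<open>v = a *\<^sub>C b\<close> by auto
  ultimately have "x = (c / a) *\<^sub>C v" by (simp add: scaleC_scaleC)
  then show ?thesis ..
qed

text \<open>A resolvent point makes the operator closed: the bounded resolvent at \<mu> recovers
  \<open>X w\<close> from \<open>\<mu> *\<^sub>C X w - A (X w)\<close>, and this relation passes to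
  the limit.\<close>

lemma operator_closed:
  assumes mu: "\<mu> \<in> resolvent_set D A" and nt: "F \<noteq> bot"
    and X: "\<forall>\<^sub>F w in F. X w \<in> D" "(X \<longlongrightarrow> x) F" "((\<lambda>w. A (X w)) \<longlongrightarrow> y) F"
  shows "x \<in> D" "A x = y"
proof -
  define R where "R = resolvent D A \<mu>"
  interpret R: bounded_linear R
    unfolding R_def by (rule bounded_clinear_bounded_linear [OF resolvent_bounded_clinear [OF mu]])
  have "((\<lambda>w. R (\<mu> *\<^sub>C X w - A (X w))) \<longlongrightarrow> R (\<mu> *\<^sub>C x - y)) F"
    by (intro R.tendsto tendsto_diff tendsto_scaleC tendsto_const X)
  moreover have "\<forall>\<^sub>F w in F. R (\<mu> *\<^sub>C X w - A (X w)) = X w"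
    using X(1) by eventually_elim (simp add: R_def resolvent_left [OF mu])
  ultimately have "(X \<longlongrightarrow> R (\<mu> *\<^sub>C x - y)) F" by (rule Lim_transform_eventually)
  from tendsto_unique [OF nt X(2) this] have x: "x = R (\<mu> *\<^sub>C x - y)" .
  then show "x \<in> D" using resolvent_mem [OF mu] unfolding R_def by metis
  show "A x = y"
    using resolvent_right [OF mu, of "\<mu> *\<^sub>C x - y", folded R_def] unfolding x [symmetric] by simp
qed

text \<open>\<open>G\<close> is the leading Laurent coefficient of the resolvent and
  \<open>H\<close> the next one, obtained as limits of \<open>g\<close> and of its difference
  quotient \<open>q\<close>; closedness of \<open>A\<close> transfers the resolvent equations to
  them. The range of \<open>G\<close> consists of multiples of \<open>v0\<close>, which defines
  \<phi>. A pole of order at least two would give \<open>(l0 - A) (H x) = - G x\<close>, a Jordan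
  chain that one-dimensionality excludes.\<close>

theorem simple_pole_decomposition:
  fixes A :: "'a::{complex_normed_vector,banach} \<Rightarrow> 'a"
  assumes lin: "clinear_on D A" and pole: "resolvent_pole D A l0"
    and simple: "alg_simple_eigenvalue D A l0" and v0: "eigenvector D A l0 v0"
  shows "\<exists>\<phi> H. functional \<phi> \<and> \<phi> v0 = 1 \<and> bounded_clinear H \<and> H v0 = 0 \<and>
    (\<forall>x. H x \<in> D \<and> l0 *\<^sub>C H x - A (H x) = x - \<phi> x *\<^sub>C v0 \<and> \<phi> (H x) = 0) \<and>
    (\<forall>x\<in>D. H (l0 *\<^sub>C x - A x) = x - \<phi> x *\<^sub>C v0 \<and> \<phi> (A x) = l0 * \<phi> x)"
proof -
  define R where "R = resolvent D A"
  have ev_rho: "\<forall>\<^sub>F w in at l0. w \<in> resolvent_set D A" and vp: "vpole_at (\<lambda>l. Blinfun (R l)) l0"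
    using pole by (auto simp: resolvent_pole_def R_def)
  obtain n e g where n: "n \<ge> 1" and e: "e > 0" and ghol: "g vholomorphic_on ball l0 e" and g0: "g l0 \<noteq> 0"
    and fg: "\<And>z. z \<in> ball l0 e - {l0} \<Longrightarrow> Blinfun (R z) = inverse ((z - l0) ^ n) *\<^sub>C g z"
    using vp unfolding vpole_at_def by blast
  define G where "G = blinfun_apply (g l0)"
  obtain Hb where Hb: "((\<lambda>w. inverse (w - l0) *\<^sub>C (g w - g l0)) \<longlongrightarrow> Hb) (at l0)"
    using vholomorphic_onD [OF ghol open_ball, of l0] e by auto
  define H where "H = blinfun_apply Hb"
  define q where "q w x = inverse (w - l0) *\<^sub>C (g w x - G x)" for w x
  have appl: "((\<lambda>w. blinfun_apply (X w) x) \<longlongrightarrow> blinfun_apply L x) F" if "(X \<longlongrightarrow> L) F" for X L F and x :: 'a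
    by (rule bounded_linear.tendsto [OF blinfun.bounded_linear_left that])
  have glim: "((\<lambda>w. g w x) \<longlongrightarrow> G x) (at l0)" for x
    unfolding G_def by (rule appl, rule vholomorphic_imp_continuous [OF ghol]) (use e in auto)
  have qlim: "((\<lambda>w. q w x) \<longlongrightarrow> H x) (at l0)" for x
    using appl [OF Hb, of x] by (simp add: H_def q_def G_def scaleC_blinfun.rep_eq minus_blinfun.rep_eq)
  have evq: "\<forall>\<^sub>F w in at l0. w \<noteq> l0 \<and> w \<in> resolvent_set D A \<and> (\<forall>x. g w x = (w - l0) ^ n *\<^sub>C R w x)"
  proof -
    have "\<forall>\<^sub>F w in at l0. w \<in> ball l0 e" using e by (intro eventually_at_in_open') auto
    moreover have "\<forall>\<^sub>F w in at l0. w \<noteq> l0" by (simp add: eventually_at_filter)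
    ultimately show ?thesis
      using ev_rho
    proof eventually_elim
      case (elim w)
      have "bounded_linear (R w)"
        unfolding R_def by (rule bounded_clinear_bounded_linear [OF resolvent_bounded_clinear [OF elim(3)]])
      then have "R w x = inverse ((w - l0) ^ n) *\<^sub>C g w x" for x
        using fg [of w] elim by (metis DiffI bounded_linear_Blinfun_apply empty_iff insert_iff scaleC_blinfun.rep_eq)
      then show ?case using elim by (simp add: scaleC_scaleC)
    qed
  qed
  obtain \<mu> where mu: "\<mu> \<in> resolvent_set D A"
    using eventually_happens' [OF trivial_limit_at ev_rho] by blast
  have powlim: "((\<lambda>w. (w - l0) ^ m *\<^sub>C x) \<longlongrightarrow> 0 ^ m *\<^sub>C x) (at l0)" for m x
    by (intro tendsto_scaleC tendsto_const) (auto intro!: tendsto_eq_intros)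
  have pow_step: "inverse (w - l0) * (w - l0) ^ n = (w - l0) ^ (n - 1)" if "w \<noteq> l0" for w
    using n that by (cases n) auto
  have Rw: "R w x \<in> D" "w *\<^sub>C R w x - A (R w x) = x" "y \<in> D \<Longrightarrow> R w (w *\<^sub>C y - A y) = y"
    "bounded_clinear (R w)"
    if "w \<in> resolvent_set D A" for w x y
    using resolvent_setD [OF that] by (simp_all add: R_def)
  note ca = clinear_on_add [OF lin] and cs = clinear_on_scale [OF lin] and cd = clinear_on_diff [OF lin]
    and ma = clinear_on_mem_add [OF lin] and ms = clinear_on_mem_scale [OF lin] and md = clinear_on_mem_diff [OF lin]
  have gD: "\<forall>\<^sub>F w in at l0. g w x \<in> D" for x
    using evq by eventually_elim (simp add: Rw ms)
  have Ag: "\<forall>\<^sub>F w in at l0. w *\<^sub>C g w x - (w - l0) ^ n *\<^sub>C x = A (g w x)" for x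
    using evq
  proof eventually_elim
    case (elim w)
    have "A (R w x) = w *\<^sub>C R w x - x" using Rw(2) [of w x] elim by (simp add: algebra_simps)
    then show ?case using elim by (simp add: cs Rw scaleC_diff_right scaleC_scaleC mult.commute)
  qed
  have "((\<lambda>w. w *\<^sub>C g w x - (w - l0) ^ n *\<^sub>C x) \<longlongrightarrow> l0 *\<^sub>C G x - 0 ^ n *\<^sub>C x) (at l0)" for x
    by (intro tendsto_diff tendsto_scaleC glim powlim tendsto_ident_at)
  then have "((\<lambda>w. A (g w x)) \<longlongrightarrow> l0 *\<^sub>C G x) (at l0)" for x
    using n Lim_transform_eventually [OF _ Ag] by (simp add: power_0_left)
  from operator_closed [OF mu trivial_limit_at gD glim this]
  have GD: "G x \<in> D" and AG: "A (G x) = l0 *\<^sub>C G x" for x by auto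
  have Gclin: "G (c *\<^sub>C x) = c *\<^sub>C G x" for c x
  proof (rule tendsto_unique [OF trivial_limit_at glim])
    have "\<forall>\<^sub>F w in at l0. c *\<^sub>C g w x = g w (c *\<^sub>C x)"
      using evq by eventually_elim
        (simp add: bounded_clinear_scaleC [OF Rw(4)] scaleC_scaleC mult.commute)
    from Lim_transform_eventually [OF tendsto_scaleC [OF tendsto_const glim] this]
    show "((\<lambda>w. g w (c *\<^sub>C x)) \<longlongrightarrow> c *\<^sub>C G x) (at l0)" .
  qed
  have Gadd: "G (x + y) = G x + G y" for x y
    by (simp add: G_def blinfun.add_right)
  have Hdiff: "H (x - y) = H x - H y" for x y
    by (simp add: H_def blinfun.diff_right)
  have Hclin: "H (c *\<^sub>C x) = c *\<^sub>C H x" for c x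
  proof (rule tendsto_unique [OF trivial_limit_at qlim])
    have "\<forall>\<^sub>F w in at l0. c *\<^sub>C q w x = q w (c *\<^sub>C x)"
      using evq by eventually_elim
        (simp add: bounded_clinear_scaleC [OF Rw(4)] q_def Gclin scaleC_scaleC scaleC_diff_right mult_ac)
    from Lim_transform_eventually [OF tendsto_scaleC [OF tendsto_const qlim] this]
    show "((\<lambda>w. q w (c *\<^sub>C x)) \<longlongrightarrow> c *\<^sub>C H x) (at l0)" .
  qed
  have Grange: "G (l0 *\<^sub>C x - A x) = 0" if x: "x \<in> D" for x
  proof (rule tendsto_unique [OF trivial_limit_at glim])
    have "\<forall>\<^sub>F w in at l0. (w - l0) ^ n *\<^sub>C x - (w - l0) *\<^sub>C g w x = g w (l0 *\<^sub>C x - A x)"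
      using evq
    proof eventually_elim
      case (elim w)
      interpret bounded_linear "R w" using bounded_clinear_bounded_linear [OF Rw(4)] elim by blast
      have "l0 *\<^sub>C x - A x = (w *\<^sub>C x - A x) - (w - l0) *\<^sub>C x" by (simp add: scaleC_diff_left)
      then have "R w (l0 *\<^sub>C x - A x) = x - (w - l0) *\<^sub>C R w x"
        using elim Rw(3) [of w x] x by (simp only: diff bounded_clinear_scaleC [OF Rw(4)])
      then show ?case using elim by (simp add: scaleC_diff_right scaleC_scaleC mult.commute)
    qed
    moreover have "((\<lambda>w. (w - l0) ^ n *\<^sub>C x - (w - l0) ^ 1 *\<^sub>C g w x) \<longlongrightarrow> 0 ^ n *\<^sub>C x - 0 *\<^sub>C G x) (at l0)"
      by (intro tendsto_diff powlim tendsto_scaleC glim) (auto intro!: tendsto_eq_intros)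
    ultimately show "((\<lambda>w. g w (l0 *\<^sub>C x - A x)) \<longlongrightarrow> 0) (at l0)"
      using n by (auto simp: power_0_left intro: Lim_transform_eventually)
  qed
  have qD: "\<forall>\<^sub>F w in at l0. q w x \<in> D" for x
    using gD [of x] by eventually_elim (simp add: q_def ms md GD)
  have Aq: "\<forall>\<^sub>F w in at l0. l0 *\<^sub>C q w x + g w x - (w - l0) ^ (n - 1) *\<^sub>C x = A (q w x)" for x
    using evq gD [of x] Ag [of x]
  proof eventually_elim
    case (elim w)
    have "A (q w x) = inverse (w - l0) *\<^sub>C (w *\<^sub>C g w x - (w - l0) ^ n *\<^sub>C x - l0 *\<^sub>C G x)"
      unfolding q_def using elim(3) by (simp add: cs md cd GD elim(2) AG)
    also have "w *\<^sub>C g w x - (w - l0) ^ n *\<^sub>C x - l0 *\<^sub>C G x =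
        l0 *\<^sub>C (g w x - G x) + (w - l0) *\<^sub>C g w x - (w - l0) ^ n *\<^sub>C x"
      by (simp add: scaleC_diff_left scaleC_diff_right)
    also have "inverse (w - l0) *\<^sub>C \<dots> = l0 *\<^sub>C q w x + (inverse (w - l0) * (w - l0)) *\<^sub>C g w x
        - (inverse (w - l0) * (w - l0) ^ n) *\<^sub>C x"
      by (simp only: q_def scaleC_diff_right scaleC_add_right scaleC_scaleC mult.commute)
    finally show ?case using elim(1) by (simp add: pow_step)
  qed
  \<comment> \<open>The limit \<open>0 ^ (n - 1)\<close> is 1 for \<open>n = 1\<close> and 0 for
    \<open>n > 1\<close>: the identity term appears exactly at a simple pole.\<close>
  have "((\<lambda>w. l0 *\<^sub>C q w x + g w x - (w - l0) ^ (n - 1) *\<^sub>C x) \<longlongrightarrow> l0 *\<^sub>C H x + G x - 0 ^ (n - 1) *\<^sub>C x) (at l0)" for x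
    by (intro tendsto_diff tendsto_add tendsto_scaleC glim qlim powlim tendsto_const)
  from operator_closed [OF mu trivial_limit_at qD qlim Lim_transform_eventually [OF this Aq]]
  have HD: "H x \<in> D" and AH: "A (H x) = l0 *\<^sub>C H x + G x - 0 ^ (n - 1) *\<^sub>C x" for x by auto
  define S where "S = (\<Union>m. power_ker D (\<lambda>x. l0 *\<^sub>C x - A x) m)"
  have v0D: "v0 \<in> D" "v0 \<noteq> 0" "A v0 = l0 *\<^sub>C v0" using v0 by (auto simp: eigenvector_def)
  have S1: "x \<in> S" if "x \<in> D" "l0 *\<^sub>C x - A x = 0" for x
  proof -
    have "x \<in> power_ker D (\<lambda>x. l0 *\<^sub>C x - A x) 1" using that by (simp add: power_ker_def)
    then show ?thesis unfolding S_def by blast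
  qed
  have S2: "x \<in> S" if "x \<in> D" "l0 *\<^sub>C x - A x = y" "y \<in> D" "l0 *\<^sub>C y - A y = 0" for x y
  proof -
    have "x \<in> power_ker D (\<lambda>x. l0 *\<^sub>C x - A x) (Suc (Suc 0))" using that by (simp add: power_ker_def)
    then show ?thesis unfolding S_def by blast
  qed
  have "complex_vector.dim S = 1" using simple by (simp add: alg_simple_eigenvalue_def S_def)
  from one_dim_multiple [OF this S1 [OF v0D(1)] v0D(2)]
  have mult: "\<exists>c. x = c *\<^sub>C v0" if "x \<in> S" for x using that v0D(3) by simp
  have "n = 1"
  proof (rule ccontr)
    assume "n \<noteq> 1"
    then have pw: "(0::complex) ^ (n - 1) = 0" using n by simp
    obtain x where x: "G x \<noteq> 0"
      using g0 unfolding G_def by (metis blinfun_eqI zero_blinfun.rep_eq)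
    have "H x \<in> S"
      using AH [of x] pw AG [of x] GD [of x] cs [OF GD [of x], of "- 1"] ms [OF GD [of x], of "- 1"]
      by (intro S2 [of _ "- G x"] HD) (auto simp: scaleC_minus_left scaleC_minus_right)
    then obtain c where "H x = c *\<^sub>C v0" using mult by blast
    then have "A (H x) = l0 *\<^sub>C H x" using cs [OF v0D(1)] v0D(3) by (simp add: scaleC_scaleC mult.commute)
    with AH [of x] pw x show False by simp
  qed
  \<comment> \<open>On the eigenvector the resolvent is multiplication by
    \<open>1 / (w - l0)\<close>, so \<open>g w v0\<close> is constant near \<open>l0\<close>; this
    fixes \<open>\<phi> v0 = 1\<close> and \<open>H v0 = 0\<close>.\<close>
  have evs: "\<forall>\<^sub>F w in at l0. v0 = g w v0"
    using evq
  proof eventually_elim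
    case (elim w)
    have "(w - l0) *\<^sub>C v0 = w *\<^sub>C v0 - A v0" by (simp add: v0D scaleC_diff_left)
    then have "R w ((w - l0) *\<^sub>C v0) = v0" using Rw(3) [of w v0] elim v0D by simp
    then show ?case using elim \<open>n = 1\<close> bounded_clinear_scaleC [OF Rw(4), of w "w - l0" v0] by simp
  qed
  have Gv0: "G v0 = v0"
    by (rule tendsto_unique [OF trivial_limit_at glim Lim_transform_eventually [OF tendsto_const evs]])
  have Hv0: "H v0 = 0"
  proof (rule tendsto_unique [OF trivial_limit_at qlim Lim_transform_eventually [OF tendsto_const]])
    show "\<forall>\<^sub>F w in at l0. 0 = q w v0" using evs by eventually_elim (simp add: q_def Gv0)
  qed
  have "\<exists>c. G x = c *\<^sub>C v0" for x by (rule mult) (simp add: S1 GD AG)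
  then obtain \<phi> where phi: "\<And>x. G x = \<phi> x *\<^sub>C v0" by metis
  have inj: "a = b" if "a *\<^sub>C v0 = b *\<^sub>C v0" for a b
    using that v0D(2) by (simp add: complex_vector.scale_right_imp_eq)
  have fphi: "functional \<phi>"
    unfolding functional_def
  proof (intro conjI allI)
    show scale: "\<phi> (c *\<^sub>C x) = c * \<phi> x" for c x
      using Gclin [of c x] by (intro inj) (simp add: phi scaleC_scaleC)
    show "bounded_linear \<phi>"
    proof (rule bounded_linear_intro)
      show "\<phi> (x + y) = \<phi> x + \<phi> y" for x y
        using Gadd [of x y] by (intro inj) (simp add: phi scaleC_add_left)
      show "\<phi> (t *\<^sub>R x) = t *\<^sub>R \<phi> x" for t x
        using scale [of "of_real t" x] by (simp add: scaleC_of_real scaleR_conv_of_real)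
      show "norm (\<phi> x) \<le> norm x * (norm (g l0) / norm v0)" for x
        using norm_blinfun [of "g l0" x] phi [of x] v0D(2)
        by (simp add: G_def norm_scaleC field_simps)
    qed
  qed
  have Hright: "l0 *\<^sub>C H x - A (H x) = x - \<phi> x *\<^sub>C v0" for x
    using AH [of x] \<open>n = 1\<close> by (simp add: phi)
  have Hleft: "H (l0 *\<^sub>C x - A x) = x - \<phi> x *\<^sub>C v0" if x: "x \<in> D" for x
  proof (rule tendsto_unique [OF trivial_limit_at qlim])
    have "\<forall>\<^sub>F w in at l0. x - g w x = q w (l0 *\<^sub>C x - A x)"
      using evq
    proof eventually_elim
      case (elim w)
      interpret bounded_linear "R w" using bounded_clinear_bounded_linear [OF Rw(4)] elim by blast
      have "l0 *\<^sub>C x - A x = (w *\<^sub>C x - A x) - (w - l0) *\<^sub>C x" by (simp add: scaleC_diff_left)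
      then have "R w (l0 *\<^sub>C x - A x) = x - (w - l0) *\<^sub>C R w x"
        using elim Rw(3) [of w x] x by (simp only: diff bounded_clinear_scaleC [OF Rw(4)])
      then show ?case using elim \<open>n = 1\<close> by (simp add: q_def Grange [OF x] scaleC_scaleC)
    qed
    from Lim_transform_eventually [OF tendsto_diff [OF tendsto_const glim] this]
    show "((\<lambda>w. q w (l0 *\<^sub>C x - A x)) \<longlongrightarrow> x - \<phi> x *\<^sub>C v0) (at l0)" by (simp add: phi)
  qed
  have phiH: "\<phi> (H x) = 0" for x
  proof (rule inj)
    \<comment> \<open>Applying the left inverse property to \<open>H x\<close> itself isolates
      \<open>\<phi> (H x)\<close>.\<close>
    have "H (x - \<phi> x *\<^sub>C v0) = H x" by (simp add: Hdiff Hclin Hv0)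
    then show "\<phi> (H x) *\<^sub>C v0 = 0 *\<^sub>C v0" using Hleft [OF HD, of x] Hright [of x] by simp
  qed
  have "\<phi> (A x) = l0 * \<phi> x" if "x \<in> D" for x
  proof -
    interpret phi: bounded_linear \<phi> by (rule functional_bounded_linear [OF fphi])
    have "\<phi> (l0 *\<^sub>C x - A x) = 0" using Grange [OF that] by (intro inj) (simp add: phi)
    then show ?thesis by (simp add: phi.diff functional_scaleC [OF fphi])
  qed
  moreover have "\<phi> v0 = 1" using Gv0 phi [of v0] by (intro inj) simp
  moreover have "bounded_clinear H"
    unfolding bounded_clinear_def using Hclin blinfun.bounded_linear_right [of Hb] by (simp add: H_def)
  ultimately show ?thesis
    using fphi Hv0 HD Hright Hleft phiH by (intro exI [of _ \<phi>] exI [of _ H] conjI allI ballI)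
qed


section \<open>Perturbation of a simple pole\<close>

text \<open>The inverse of \<open>1 - L\<close> sends \<open>y\<close> to the fixed point of the
  contraction taking \<open>z\<close> to \<open>y + L z\<close>; uniqueness of fixed points yields
  linearity and the left inverse identity.\<close>

lemma neumann_inverse:
  fixes L :: "'a::{complex_normed_vector,banach} \<Rightarrow> 'a"
  assumes L: "bounded_clinear L" and half: "\<And>x. norm (L x) \<le> norm x / 2"
  shows "\<exists>S. bounded_clinear S \<and> (\<forall>y. S y - L (S y) = y) \<and> (\<forall>x. S (x - L x) = x) \<and> (\<forall>y. norm (S y) \<le> 2 * norm y)"
proof -
  interpret L: bounded_linear L by (rule bounded_clinear_bounded_linear [OF L])
  have "\<exists>!z. y + L z = z" for y
  proof (rule banach_fix_type [of "1/2"])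
    show "\<forall>z z'. dist (y + L z) (y + L z') \<le> 1/2 * dist z z'"
      using half by (simp add: dist_norm flip: L.diff)
  qed auto
  then obtain S where S: "\<And>y. y + L (S y) = S y" and uniq: "\<And>y z. y + L z = z \<Longrightarrow> z = S y"
    by metis
  have bound: "norm (S y) \<le> 2 * norm y" for y
  proof -
    have "norm (S y) \<le> norm y + norm (L (S y))" using norm_triangle_ineq [of y "L (S y)"] by (simp add: S)
    with half [of "S y"] show ?thesis by simp
  qed
  have "bounded_clinear S"
  proof (rule bounded_clinearI [OF _ _ bound])
    show "S (x + y) = S x + S y" for x y
      by (rule uniq [symmetric]) (metis S L.add add.assoc add.left_commute)
    show "S (c *\<^sub>C x) = c *\<^sub>C S x" for c x
      by (rule uniq [symmetric]) (metis S bounded_clinear_scaleC [OF L] scaleC_add_right)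
  qed
  moreover have "S y - L (S y) = y" for y using S [of y] by (simp add: algebra_simps)
  moreover have "S (x - L x) = x" for x by (rule uniq [symmetric]) simp
  ultimately show ?thesis using bound by blast
qed

text \<open>\<open>\<phi>\<close> and \<open>v0\<close> encode the rank-one spectral projection, and
  \<open>H0\<close> inverts \<open>l0 - A\<close> on the kernel of \<open>\<phi>\<close>.\<close>

locale simple_pole =
  fixes D :: "'a::{complex_normed_vector,banach} set" and A :: "'a \<Rightarrow> 'a" and l0 :: complex
    and v0 :: 'a and \<phi> :: "'a \<Rightarrow> complex" and H0 :: "'a \<Rightarrow> 'a" and r :: real
  assumes A_lin: "clinear_on D A"
    and v0: "v0 \<in> D" "v0 \<noteq> 0" "A v0 = l0 *\<^sub>C v0"
    and phi: "functional \<phi>" "\<phi> v0 = 1" "\<And>x. x \<in> D \<Longrightarrow> \<phi> (A x) = l0 * \<phi> x"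
    and H0: "bounded_clinear H0" "H0 v0 = 0" "\<And>x. H0 x \<in> D" "\<And>x. \<phi> (H0 x) = 0"
      "\<And>x. l0 *\<^sub>C H0 x - A (H0 x) = x - \<phi> x *\<^sub>C v0"
      "\<And>x. x \<in> D \<Longrightarrow> H0 (l0 *\<^sub>C x - A x) = x - \<phi> x *\<^sub>C v0"
    and r: "r > 0" "\<And>l. l \<in> cball l0 r \<Longrightarrow> l \<noteq> l0 \<Longrightarrow> l \<in> resolvent_set D A"
begin

sublocale phi: bounded_linear \<phi> by (rule functional_bounded_linear [OF phi(1)])

lemma phi_scaleC: "\<phi> (c *\<^sub>C x) = c * \<phi> x"
  by (rule functional_scaleC [OF phi(1)])

lemma phi_range: "x \<in> D \<Longrightarrow> \<phi> (l *\<^sub>C x - A x) = (l - l0) * \<phi> x"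
  by (simp add: phi.diff phi_scaleC phi(3) algebra_simps)

text \<open>The reduced resolvent: the resolvent of the part of \<open>A\<close> in the kernel of \<open>\<phi>\<close>.\<close>

definition H :: "complex \<Rightarrow> 'a \<Rightarrow> 'a" where
  "H l x = (if l = l0 then H0 x else resolvent D A l (x - \<phi> x *\<^sub>C v0))"

lemma H_clinear: assumes "l \<in> cball l0 r" shows "bounded_clinear (H l)"
proof (cases "l = l0")
  case True
  then show ?thesis using H0(1) by (simp add: H_def [abs_def])
next
  case False
  have R: "bounded_clinear (resolvent D A l)"
    by (rule resolvent_bounded_clinear [OF r(2) [OF assms False]])
  interpret R: bounded_linear "resolvent D A l" by (rule bounded_clinear_bounded_linear [OF R])
  have "bounded_linear (\<lambda>x. resolvent D A l (x - \<phi> x *\<^sub>C v0))"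
    by (intro bounded_linear_compose [OF R.bounded_linear_axioms] bounded_linear_sub bounded_linear_ident
        bounded_linear_compose [OF bounded_bilinear.bounded_linear_left [OF bounded_bilinear_scaleC] phi.bounded_linear_axioms])
  moreover have "resolvent D A l (c *\<^sub>C x - \<phi> (c *\<^sub>C x) *\<^sub>C v0) = c *\<^sub>C resolvent D A l (x - \<phi> x *\<^sub>C v0)" for c x
    by (simp add: phi_scaleC flip: bounded_clinear_scaleC [OF R] scaleC_scaleC) (simp add: scaleC_diff_right)
  ultimately show ?thesis using False by (simp add: bounded_clinear_def H_def [abs_def])
qed

lemma H_linear: "l \<in> cball l0 r \<Longrightarrow> bounded_linear (H l)"
  by (rule bounded_clinear_bounded_linear [OF H_clinear])

lemma
  assumes l: "l \<in> cball l0 r"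
  shows H_mem: "H l x \<in> D"
    and H_right: "l *\<^sub>C H l x - A (H l x) = x - \<phi> x *\<^sub>C v0"
    and H_left: "x \<in> D \<Longrightarrow> H l (l *\<^sub>C x - A x) = x - \<phi> x *\<^sub>C v0"
    and phi_H: "\<phi> (H l x) = 0"
proof -
  have "H l x \<in> D \<and> l *\<^sub>C H l x - A (H l x) = x - \<phi> x *\<^sub>C v0 \<and>
      (x \<in> D \<longrightarrow> H l (l *\<^sub>C x - A x) = x - \<phi> x *\<^sub>C v0) \<and> \<phi> (H l x) = 0"
  proof (cases "l = l0")
    case True
    then show ?thesis using H0 by (simp add: H_def)
  next
    case False
    note rho = r(2) [OF l False]
    define R where "R = resolvent D A l"
    have R: "R y \<in> D" "l *\<^sub>C R y - A (R y) = y" "z \<in> D \<Longrightarrow> R (l *\<^sub>C z - A z) = z" "bounded_clinear R" for y z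
      using resolvent_setD [OF rho] by (simp_all add: R_def)
    interpret R: bounded_linear R by (rule bounded_clinear_bounded_linear [OF R(4)])
    have Hl: "H l y = R (y - \<phi> y *\<^sub>C v0)" for y using False by (simp add: H_def R_def)
    have "(l - l0) * \<phi> (H l x) = 0"
      unfolding phi_range [OF R(1), symmetric] Hl by (simp add: R(2) phi.diff phi_scaleC phi(2))
    moreover have "R ((l - l0) *\<^sub>C v0) = v0" using R(3) [OF v0(1)] v0(3) by (simp add: scaleC_diff_left)
    then have Rv0: "R ((\<phi> x * (l - l0)) *\<^sub>C v0) = \<phi> x *\<^sub>C v0" for x
      by (metis bounded_clinear_scaleC [OF R(4)] scaleC_scaleC)
    have "H l (l *\<^sub>C x - A x) = x - \<phi> x *\<^sub>C v0" if "x \<in> D"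
      unfolding Hl phi_range [OF that] R.diff [of "l *\<^sub>C x - A x"] R(3) [OF that] mult.commute [of "l - l0"] Rv0 ..
    moreover have "H l x \<in> D" "l *\<^sub>C H l x - A (H l x) = x - \<phi> x *\<^sub>C v0" using R by (simp_all add: Hl)
    ultimately show ?thesis using False by simp
  qed
  then show "H l x \<in> D" "l *\<^sub>C H l x - A (H l x) = x - \<phi> x *\<^sub>C v0" "x \<in> D \<Longrightarrow> H l (l *\<^sub>C x - A x) = x - \<phi> x *\<^sub>C v0"
    "\<phi> (H l x) = 0" by auto
qed

text \<open>Resolvent identity. It persists across \<open>l0\<close> because the pole only affects
  the component along \<open>v0\<close>.\<close>

lemma H_diff:
  assumes l: "l \<in> cball l0 r" and m: "m \<in> cball l0 r"
  shows "H l x - H m x = (m - l) *\<^sub>C H l (H m x)"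
proof -
  interpret Hl: bounded_linear "H l" by (rule H_linear [OF l])
  have Hm: "A (H m x) = m *\<^sub>C H m x - (x - \<phi> x *\<^sub>C v0)" and Hl: "A (H l x) = l *\<^sub>C H l x - (x - \<phi> x *\<^sub>C v0)"
    using H_right [OF m, of x] H_right [OF l, of x] by (simp_all add: algebra_simps)
  have mem: "H l x - H m x \<in> D" by (intro clinear_on_mem_diff [OF A_lin] H_mem l m)
  have "l *\<^sub>C (H l x - H m x) - A (H l x - H m x) = (m - l) *\<^sub>C H m x"
    unfolding clinear_on_diff [OF A_lin H_mem [OF l] H_mem [OF m]] Hm Hl
    by (simp add: scaleC_diff_right scaleC_diff_left)
  then show ?thesis
    using H_left [OF l mem] by (simp add: phi.diff phi_H [OF l] phi_H [OF m] bounded_clinear_scaleC [OF H_clinear [OF l]])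
qed

text \<open>If \<open>K\<close> bounds \<open>H m\<close>, the resolvent identity bounds
  \<open>H l\<close> by \<open>2 * K\<close> for \<open>l\<close> within \<open>1 / (2 * K)\<close>
  of \<open>m\<close>; compactness of the closed disc leaves finitely many such bounds.\<close>

lemma H_bounded: "\<exists>M>0. \<forall>l\<in>cball l0 r. \<forall>x. norm (H l x) \<le> M * norm x"
proof -
  have "\<exists>e>0. \<exists>M>0. \<forall>l\<in>cball l0 r \<inter> ball m e. \<forall>x. norm (H l x) \<le> M * norm x" if m: "m \<in> cball l0 r" for m
  proof -
    obtain K where K: "K > 0" "\<And>x. norm (H m x) \<le> K * norm x"
      using bounded_clinear_bound [OF H_clinear [OF m]] by blast
    have "norm (H l x) \<le> 2 * K * norm x" if l: "l \<in> cball l0 r \<inter> ball m (1 / (2 * K))" for l x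
    proof -
      have lK: "cmod (l - m) * K \<le> 1/2" using l K(1) by (simp add: dist_norm norm_minus_commute field_simps)
      have "H l x = H m x - (l - m) *\<^sub>C H m (H l x)"
        using H_diff [OF m, of l x] l by (simp add: algebra_simps)
      then have "norm (H l x) \<le> norm (H m x) + cmod (l - m) * norm (H m (H l x))"
        by (metis norm_scaleC norm_triangle_ineq4)
      also have "\<dots> \<le> K * norm x + cmod (l - m) * (K * norm (H l x))"
        by (intro add_mono mult_left_mono K) simp
      also have "\<dots> \<le> K * norm x + 1/2 * norm (H l x)"
        using mult_right_mono [OF lK, of "norm (H l x)"] by (simp add: mult.assoc)
      finally show ?thesis by simp
    qed
    then show ?thesis using K(1) by (intro exI [of _ "1 / (2 * K)"] exI [of _ "2 * K"] conjI ballI allI) auto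
  qed
  then obtain e M where eM: "\<And>m. m \<in> cball l0 r \<Longrightarrow> e m > 0 \<and> M m > 0 \<and>
      (\<forall>l\<in>cball l0 r \<inter> ball m (e m). \<forall>x. norm (H l x) \<le> M m * norm x)"
    by metis
  have "cball l0 r \<subseteq> (\<Union>m\<in>cball l0 r. ball m (e m))" using eM by force
  then obtain F where F: "F \<subseteq> cball l0 r" "finite F" "cball l0 r \<subseteq> (\<Union>m\<in>F. ball m (e m))"
    by (rule compactE_image [OF compact_cball _, rotated]) auto
  have pos: "0 \<le> M m" if "m \<in> F" for m using eM F(1) that by (meson less_imp_le subsetD)
  have "norm (H l x) \<le> (sum M F + 1) * norm x" if l: "l \<in> cball l0 r" for l x
  proof -
    obtain m where m: "m \<in> F" "l \<in> ball m (e m)" using F(3) l by blast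
    have "norm (H l x) \<le> M m * norm x" using eM m l F(1) by blast
    also have "M m \<le> sum M F" using F(2) m(1) pos by (intro member_le_sum) auto
    then have "M m * norm x \<le> (sum M F + 1) * norm x" by (intro mult_right_mono) auto
    finally show ?thesis .
  qed
  moreover have "sum M F + 1 > 0" using sum_nonneg [of F M] pos by simp
  ultimately show ?thesis by blast
qed

end

text \<open>Origin of the thresholds for \<eta>: \<open>1/4\<close> makes \<open>1 - B (H l)\<close>
  invertible, the one with \<open>r\<close> keeps the eigenvalue in the disc, the one with
  \<open>N * M\<close> makes \<open>f\<close> a contraction, and the last one secures algebraic
  simplicity. The fixed point iteration draws on them as well.\<close>

locale small_perturbation = simple_pole D A l0 v0 \<phi> H0 r
  for D :: "'a::{complex_normed_vector,banach} set" and A l0 v0 \<phi> H0 r +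
  fixes B :: "'a \<Rightarrow> 'a" and M N \<eta> :: real
  assumes B_lin: "clinear_on D B"
    and HB: "\<And>l. l \<in> cball l0 r \<Longrightarrow> bounded_clinear (\<lambda>x. B (H l x))"
    and M: "M > 0" "\<And>l x. l \<in> cball l0 r \<Longrightarrow> norm (H l x) \<le> M * norm x"
    and N: "N > 0" "\<And>x. cmod (\<phi> x) \<le> N * norm x"
    and eta: "0 \<le> \<eta>" "\<eta> \<le> 1/4" "\<eta> * (8 * N) \<le> r" "\<eta> * (8 * N * M) \<le> 1"
      "\<eta> * (8 * N * (norm v0 + M)) \<le> 1"
    and B_H: "\<And>l x. l \<in> cball l0 r \<Longrightarrow> norm (B (H l x)) \<le> \<eta> * norm x"
    and B_v0: "norm (B v0) \<le> \<eta>"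
begin

section \<open>Reduction of the eigenvalue problem to a scalar equation\<close>

definition S :: "complex \<Rightarrow> 'a \<Rightarrow> 'a" where
  "S l = (SOME S. bounded_clinear S \<and> (\<forall>y. S y - B (H l (S y)) = y) \<and> (\<forall>x. S (x - B (H l x)) = x) \<and>
     (\<forall>y. norm (S y) \<le> 2 * norm y))"

lemma
  assumes l: "l \<in> cball l0 r"
  shows S_clinear: "bounded_clinear (S l)" and S_right: "S l y - B (H l (S l y)) = y"
    and S_left: "S l (x - B (H l x)) = x" and S_bound: "norm (S l y) \<le> 2 * norm y"
proof -
  have "norm (B (H l x)) \<le> norm x / 2" for x
    using B_H [OF l, of x] mult_right_mono [OF eta(2), of "norm x"] norm_ge_zero [of x] by linarith
  from someI_ex [OF neumann_inverse [OF HB [OF l] this], folded S_def]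
  show "bounded_clinear (S l)" "S l y - B (H l (S l y)) = y" "S l (x - B (H l x)) = x"
    "norm (S l y) \<le> 2 * norm y" by auto
qed

lemma S_linear: "l \<in> cball l0 r \<Longrightarrow> bounded_linear (S l)"
  by (rule bounded_clinear_bounded_linear [OF S_clinear])

text \<open>\<open>l - l0 - f l\<close> is the Schur complement of \<open>l - Ak\<close> for the
  splitting into the span of \<open>v0\<close> and the kernel of \<open>\<phi>\<close>
  (Lyapunov--Schmidt or Feshbach reduction).\<close>

definition f :: "complex \<Rightarrow> complex" where "f l = \<phi> (S l (B v0))"

abbreviation Ak :: "'a \<Rightarrow> 'a" where "Ak \<equiv> \<lambda>x. A x + B x"

text \<open>Put \<open>z = (l - A) x\<close>. Then \<open>H l z\<close> is \<open>x\<close> without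
  its component along \<open>v0\<close>, so
  \<open>z - B (H l z) = y + \<phi> x *\<^sub>C B v0\<close> determines \<open>z\<close>, and
  applying \<open>\<phi>\<close> leaves one scalar equation.\<close>

lemma reduction:
  assumes l: "l \<in> cball l0 r" and x: "x \<in> D" and y: "y = l *\<^sub>C x - Ak x"
  shows "x = \<phi> x *\<^sub>C v0 + H l (S l (y + \<phi> x *\<^sub>C B v0))" "\<phi> x * (l - l0 - f l) = \<phi> (S l y)"
proof -
  define z where "z = l *\<^sub>C x - A x"
  have Hz: "H l z = x - \<phi> x *\<^sub>C v0" unfolding z_def by (rule H_left [OF l x])
  have "B (H l z) = B x - \<phi> x *\<^sub>C B v0"
    unfolding Hz by (simp add: clinear_on_diff [OF B_lin] clinear_on_scale [OF B_lin] clinear_on_mem_scale [OF B_lin] x v0)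
  then have "y + \<phi> x *\<^sub>C B v0 = z - B (H l z)" by (simp add: y z_def)
  then have z: "S l (y + \<phi> x *\<^sub>C B v0) = z" using S_left [OF l, of z] by simp
  show "x = \<phi> x *\<^sub>C v0 + H l (S l (y + \<phi> x *\<^sub>C B v0))" unfolding z Hz by simp
  have "\<phi> z = \<phi> (S l y) + \<phi> x * f l"
    unfolding z [symmetric] f_def
    by (simp add: bounded_linear.linear [OF S_linear [OF l], THEN linear_add] phi.add
        bounded_clinear_scaleC [OF S_clinear [OF l]] phi_scaleC)
  moreover have "\<phi> z = (l - l0) * \<phi> x" unfolding z_def by (rule phi_range [OF x])
  ultimately show "\<phi> x * (l - l0 - f l) = \<phi> (S l y)" by (simp add: algebra_simps)
qed

lemma S_zero: "l \<in> cball l0 r \<Longrightarrow> S l 0 = 0"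
  using bounded_linear.linear [OF S_linear, THEN linear_0] .

lemma H_zero: "l \<in> cball l0 r \<Longrightarrow> H l 0 = 0"
  using bounded_linear.linear [OF H_linear, THEN linear_0] .

text \<open>\<open>c y\<close> solves the scalar equation of the reduction for the right-hand side
  \<open>y\<close>, and \<open>J y\<close> is the vector rebuilt from this component. The reduction
  also shows injectivity, so the bounded map \<open>J\<close> is the resolvent.\<close>

lemma perturbed_resolvent:
  assumes l: "l \<in> cball l0 r" and nz: "l - l0 \<noteq> f l"
  shows "l \<in> resolvent_set D Ak"
proof -
  define c where "c y = \<phi> (S l y) / (l - l0 - f l)" for y
  define J where "J y = c y *\<^sub>C v0 + H l (S l (y + c y *\<^sub>C B v0))" for y
  have nz': "l - l0 - f l \<noteq> 0" using nz by simp
  interpret Sl: bounded_linear "S l" by (rule S_linear [OF l])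
  interpret Hl: bounded_linear "H l" by (rule H_linear [OF l])
  have c: "bounded_linear c"
    unfolding c_def [abs_def] divide_inverse
    by (intro bounded_linear_mult_const [OF bounded_linear_compose [OF phi.bounded_linear_axioms Sl.bounded_linear_axioms]])
  have cc: "c (a *\<^sub>C y) = a * c y" for a y
    by (simp add: c_def bounded_clinear_scaleC [OF S_clinear [OF l]] phi_scaleC)
  have scl: "bounded_linear (\<lambda>y. c y *\<^sub>C w)" for w :: 'a
    by (rule bounded_linear_compose [OF bounded_bilinear.bounded_linear_left [OF bounded_bilinear_scaleC] c])
  have J: "bounded_clinear J"
    unfolding bounded_clinear_def J_def
    by (intro conjI bounded_linear_add scl bounded_linear_compose [OF Hl.bounded_linear_axioms]
        bounded_linear_compose [OF Sl.bounded_linear_axioms] bounded_linear_ident allI)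
      (simp add: cc scaleC_add_right scaleC_scaleC Sl.add Hl.add bounded_clinear_scaleC [OF S_clinear [OF l]]
        bounded_clinear_scaleC [OF H_clinear [OF l]])
  have JD: "J y \<in> D" for y
    unfolding J_def by (intro clinear_on_mem_add [OF A_lin] clinear_on_mem_scale [OF A_lin] v0 H_mem l)
  have Jr: "l *\<^sub>C J y - Ak (J y) = y" for y
  proof -
    define z where "z = S l (y + c y *\<^sub>C B v0)"
    have "z - B (H l z) = y + c y *\<^sub>C B v0" unfolding z_def by (rule S_right [OF l])
    then have BH: "B (H l z) = z - y - c y *\<^sub>C B v0" by (simp add: algebra_simps)
    have AH: "A (H l z) = l *\<^sub>C H l z - z + \<phi> z *\<^sub>C v0"
      using H_right [OF l, of z] by (simp add: algebra_simps)
    have pz: "\<phi> z = c y * (l - l0)"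
    proof -
      have "\<phi> z = \<phi> (S l y) + c y * f l"
        unfolding z_def f_def
        by (simp add: Sl.add phi.add bounded_clinear_scaleC [OF S_clinear [OF l]] phi_scaleC)
      also have "\<phi> (S l y) = c y * (l - l0 - f l)" using nz' by (simp add: c_def)
      finally show ?thesis by (simp add: algebra_simps)
    qed
    have mem: "c y *\<^sub>C v0 \<in> D" "H l z \<in> D"
      by (intro clinear_on_mem_scale [OF A_lin] v0 H_mem l)+
    have "Ak (J y) = (c y * l0) *\<^sub>C v0 + (l *\<^sub>C H l z - z + (c y * (l - l0)) *\<^sub>C v0) + (c y *\<^sub>C B v0 + (z - y - c y *\<^sub>C B v0))"
      unfolding J_def z_def [symmetric]
      by (simp add: clinear_on_add [OF A_lin] clinear_on_add [OF B_lin] mem clinear_on_scale [OF A_lin]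
          clinear_on_scale [OF B_lin] v0 AH BH pz scaleC_scaleC)
    also have "\<dots> = l *\<^sub>C (c y *\<^sub>C v0 + H l z) - y"
      by (simp add: scaleC_add_right scaleC_scaleC right_diff_distrib scaleC_diff_left mult.commute)
    finally show ?thesis by (simp add: J_def z_def)
  qed
  have zero: "x = 0" if "x \<in> D" "l *\<^sub>C x - Ak x = 0" for x
  proof -
    have "\<phi> x * (l - l0 - f l) = \<phi> (S l 0)" by (rule reduction(2) [OF l that(1)]) (simp only: that(2))
    then have "\<phi> x = 0" using nz' by (simp add: S_zero l)
    with reduction(1) [OF l that(1) that(2) [symmetric]] show ?thesis by (simp add: S_zero H_zero l)
  qed
  have inj: "x = x'" if "x \<in> D" "x' \<in> D" "l *\<^sub>C x - Ak x = l *\<^sub>C x' - Ak x'" for x x'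
  proof -
    have "l *\<^sub>C (x - x') - Ak (x - x') = (l *\<^sub>C x - Ak x) - (l *\<^sub>C x' - Ak x')"
      using that(1,2) by (simp add: clinear_on_diff [OF A_lin] clinear_on_diff [OF B_lin] scaleC_diff_right)
    then have "l *\<^sub>C (x - x') - Ak (x - x') = 0" unfolding that(3) diff_self .
    from zero [OF clinear_on_mem_diff [OF A_lin that(1,2)] this] show ?thesis by simp
  qed
  have inj_on: "inj_on (\<lambda>x. l *\<^sub>C x - Ak x) D" by (rule inj_onI) (rule inj)
  have "bij_betw (\<lambda>x. l *\<^sub>C x - Ak x) D UNIV"
    unfolding bij_betw_def
  proof (intro conjI inj_on UNIV_eq_I [symmetric])
    show "y \<in> (\<lambda>x. l *\<^sub>C x - Ak x) ` D" for y
      by (rule image_eqI [where x = "J y"]) (simp_all only: Jr JD)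
  qed
  moreover have "resolvent D Ak l = J"
    unfolding resolvent_def using inv_into_f_eq [OF inj_on JD Jr] by blast
  ultimately show ?thesis using J by (simp add: resolvent_set_def)
qed

text \<open>A contraction has at most one solution of \<open>l - l0 = f l\<close>. The difference of
  \<open>S l (B v0)\<close> and \<open>S m (B v0)\<close> reduces to that of \<open>H l\<close> and
  \<open>H m\<close>, as in the second resolvent identity, and \<open>H_diff\<close> supplies the
  factor \<open>m - l\<close>.\<close>

lemma f_lipschitz:
  assumes l: "l \<in> cball l0 r" and m: "m \<in> cball l0 r"
  shows "cmod (f l - f m) \<le> cmod (l - m) / 2"
proof -
  interpret Sl: bounded_linear "S l" by (rule S_linear [OF l])
  define w where "w = S m (B v0)"
  have w: "norm w \<le> 2 * \<eta>" unfolding w_def using S_bound [OF m, of "B v0"] B_v0 by simp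
  have Hd: "H l w - H m w = (m - l) *\<^sub>C H l (H m w)" by (rule H_diff [OF l m])
  have "S l (B v0) - w = S l (B v0 - (w - B (H l w)))" 
    unfolding Sl.diff [of "B v0" "w - B (H l w)"] S_left [OF l] ..
  also have "B v0 - (w - B (H l w)) = B (H l w - H m w)"
  proof -
    have "w - B (H m w) = B v0" unfolding w_def by (rule S_right [OF m])
    then show ?thesis
      unfolding clinear_on_diff [OF B_lin H_mem [OF l] H_mem [OF m]] by (simp add: algebra_simps)
  qed
  also have "\<dots> = (m - l) *\<^sub>C B (H l (H m w))"
    unfolding Hd by (rule clinear_on_scale [OF B_lin H_mem [OF l]])
  finally have dist: "norm (S l (B v0) - w) \<le> 2 * (cmod (m - l) * norm (B (H l (H m w))))"
    using S_bound [OF l, of "(m - l) *\<^sub>C B (H l (H m w))"] by (simp add: norm_scaleC)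
  have "norm (B (H l (H m w))) \<le> \<eta> * (M * (2 * \<eta>))"
  proof -
    have "norm (B (H l (H m w))) \<le> \<eta> * norm (H m w)" by (rule B_H [OF l])
    also have "norm (H m w) \<le> M * norm w" by (rule M(2) [OF m])
    also have "M * norm w \<le> M * (2 * \<eta>)" using w M(1) by (intro mult_left_mono) auto
    finally show ?thesis using eta(1) by (simp add: mult_left_mono)
  qed
  from dist mult_left_mono [OF this norm_ge_zero [of "m - l"]]
  have "norm (S l (B v0) - w) \<le> 2 * (cmod (m - l) * (\<eta> * (M * (2 * \<eta>))))" by linarith
  then have "norm (S l (B v0) - w) \<le> cmod (l - m) * (4 * M * \<eta> * \<eta>)"
    by (simp add: norm_minus_commute [of m l] mult_ac)
  then have "N * norm (S l (B v0) - w) \<le> N * (cmod (l - m) * (4 * M * \<eta> * \<eta>))"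
    using N(1) by (intro mult_left_mono) auto
  moreover have "cmod (f l - f m) \<le> N * norm (S l (B v0) - w)"
    unfolding f_def w_def phi.diff [symmetric] by (rule N)
  ultimately have "cmod (f l - f m) \<le> cmod (l - m) * ((\<eta> * (8 * N * M)) * (\<eta> / 2))"
    by (simp add: algebra_simps)
  also have "\<dots> \<le> cmod (l - m) * (1 * (1 / 2))"
    using eta N(1) M(1) by (intro mult_left_mono mult_mono) auto
  finally show ?thesis by simp
qed

lemma eigenvalue_unique:
  assumes "l \<in> cball l0 r" "l - l0 = f l" "m \<in> cball l0 r" "m - l0 = f m"
  shows "l = m"
proof -
  have "l - m = (l - l0) - (m - l0)" by simp
  then have "l - m = f l - f m" by (simp only: assms(2,4))
  then show ?thesis using f_lipschitz [OF assms(1,3)] by simp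
qed

definition eigvec :: "complex \<Rightarrow> 'a" where
  "eigvec l = v0 + H l (S l (B v0))"

lemma eigvec_mem: "l \<in> cball l0 r \<Longrightarrow> eigvec l \<in> D"
  unfolding eigvec_def by (intro clinear_on_mem_add [OF A_lin] v0 H_mem)

lemma phi_eigvec: "l \<in> cball l0 r \<Longrightarrow> \<phi> (eigvec l) = 1"
  by (simp add: eigvec_def phi.add phi(2) phi_H)

lemma eigvec_nonzero: "l \<in> cball l0 r \<Longrightarrow> eigvec l \<noteq> 0"
  using phi_eigvec by (force simp: phi.zero)

lemma eigvec_eigen:
  assumes l: "l \<in> cball l0 r" and fl: "l - l0 = f l"
  shows "Ak (eigvec l) = l *\<^sub>C eigvec l"
proof -
  define w where "w = S l (B v0)"
  have BH: "B (H l w) = w - B v0" using S_right [OF l, of "B v0"] by (simp add: w_def algebra_simps)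
  have AH: "A (H l w) = l *\<^sub>C H l w - w + (l - l0) *\<^sub>C v0"
    using H_right [OF l, of w] by (simp add: fl f_def w_def algebra_simps)
  show ?thesis
    unfolding eigvec_def w_def [symmetric]
    by (simp add: clinear_on_add [OF A_lin] clinear_on_add [OF B_lin] v0 H_mem [OF l] AH BH
        scaleC_add_right scaleC_diff_left)
qed

lemma eigvec_norm:
  assumes l: "l \<in> cball l0 r"
  shows "norm (eigvec l) \<le> norm v0 + M"
proof -
  have "norm (H l (S l (B v0))) \<le> M * norm (S l (B v0))" by (rule M(2) [OF l])
  also have "\<dots> \<le> M * 1"
    using S_bound [OF l, of "B v0"] B_v0 eta M(1) by (intro mult_left_mono) auto
  finally show ?thesis unfolding eigvec_def by (intro order_trans [OF norm_triangle_ineq]) simp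
qed

text \<open>Excludes Jordan chains. At an eigenvalue the scalar equation reads
  \<open>a * \<phi> (S l v) = 0\<close> with \<open>v = eigvec l\<close>; \<open>S l v\<close>
  differs from \<open>v\<close> by a small vector and \<open>\<phi> v = 1\<close>, so the second
  factor is nonzero and \<open>a = 0\<close>. What remains describes the kernel.\<close>

lemma generalized_eigvec:
  assumes l: "l \<in> cball l0 r" and fl: "l - l0 = f l"
    and x: "x \<in> D" "l *\<^sub>C x - Ak x = a *\<^sub>C eigvec l"
  shows "x = \<phi> x *\<^sub>C eigvec l"
proof -
  interpret Sl: bounded_linear "S l" by (rule S_linear [OF l])
  define v where "v = eigvec l"
  have "\<phi> x * (l - l0 - f l) = \<phi> (S l (a *\<^sub>C v))"
    by (rule reduction(2) [OF l x(1)]) (simp only: x(2) v_def)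
  then have "a * \<phi> (S l v) = 0"
    by (simp add: fl bounded_clinear_scaleC [OF S_clinear [OF l]] phi_scaleC)
  moreover have "\<phi> (S l v) \<noteq> 0"
  proof
    assume z: "\<phi> (S l v) = 0"
    have "\<phi> (S l v - B (H l (S l v))) = 1" unfolding S_right [OF l] v_def by (rule phi_eigvec [OF l])
    then have "1 = cmod (\<phi> (B (H l (S l v))))" using z by (simp add: phi.diff) (metis norm_minus_cancel norm_one)
    also have "\<dots> \<le> N * norm (B (H l (S l v)))" by (rule N)
    also have "\<dots> \<le> N * (\<eta> * (2 * (norm v0 + M)))"
    proof -
      have "norm (B (H l (S l v))) \<le> \<eta> * norm (S l v)" by (rule B_H [OF l])
      also have "\<dots> \<le> \<eta> * (2 * (norm v0 + M))"
        using S_bound [OF l, of v] eigvec_norm [OF l] eta(1) unfolding v_def by (intro mult_left_mono) auto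
      finally show ?thesis using N(1) by (intro mult_left_mono) auto
    qed
    also have "\<dots> = \<eta> * (8 * N * (norm v0 + M)) / 4" by simp
    also have "\<dots> \<le> 1 / 4" using eta(5) by (intro divide_right_mono) auto
    finally show False by simp
  qed
  ultimately have a: "a = 0" by simp
  have red: "x = \<phi> x *\<^sub>C v0 + H l (S l (0 + \<phi> x *\<^sub>C B v0))"
    by (rule reduction(1) [OF l x(1)]) (simp only: x(2) a scaleC_zero_left)
  have "S l (0 + \<phi> x *\<^sub>C B v0) = \<phi> x *\<^sub>C S l (B v0)" by (simp add: bounded_clinear_scaleC [OF S_clinear [OF l]])
  then have "H l (S l (0 + \<phi> x *\<^sub>C B v0)) = \<phi> x *\<^sub>C H l (S l (B v0))"
    by (simp only: bounded_clinear_scaleC [OF H_clinear [OF l]])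
  with red show ?thesis unfolding eigvec_def scaleC_add_right by metis
qed

lemma perturbed_simple:
  assumes l: "l \<in> cball l0 r" and fl: "l - l0 = f l"
  shows "alg_simple_eigenvalue D Ak l"
proof -
  define v where "v = eigvec l"
  define F where "F = (\<lambda>x. l *\<^sub>C x - Ak x)"
  have v: "v \<in> D" "v \<noteq> 0" "F v = 0"
    using eigvec_mem [OF l] eigvec_nonzero [OF l] eigvec_eigen [OF l fl] by (simp_all add: v_def F_def)
  \<comment> \<open>Chains of any length collapse: if \<open>F x\<close> is a multiple of
    \<open>v\<close>, then so is \<open>x\<close>.\<close>
  have sub: "power_ker D F m \<subseteq> complex_vector.span {v}" for m
  proof (induction m)
    case 0
    then show ?case by (auto simp: power_ker_def complex_vector.span_zero)
  next
    case (Suc m)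
    show ?case
    proof
      fix x assume "x \<in> power_ker D F (Suc m)"
      then have x: "x \<in> D" "F x \<in> power_ker D F m"
        by (auto simp: power_ker_def funpow_swap1)
      then have "F x \<in> range (\<lambda>a. a *\<^sub>C v)" using Suc unfolding complex_vector.span_singleton by blast
      then obtain a where "F x = a *\<^sub>C v" by auto
      then have "x = \<phi> x *\<^sub>C v" unfolding F_def v_def by (rule generalized_eigvec [OF l fl x(1)])
      then show "x \<in> complex_vector.span {v}" unfolding complex_vector.span_singleton by (rule range_eqI)
    qed
  qed
  have FD: "c *\<^sub>C v \<in> D" "F (c *\<^sub>C v) = 0" for c
  proof -
    show "c *\<^sub>C v \<in> D" by (rule clinear_on_mem_scale [OF A_lin v(1)])
    have "F (c *\<^sub>C v) = c *\<^sub>C F v"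
      unfolding F_def
      by (simp add: clinear_on_scale [OF A_lin v(1)] clinear_on_scale [OF B_lin v(1)] scaleC_diff_right
          scaleC_add_right scaleC_scaleC mult.commute)
    then show "F (c *\<^sub>C v) = 0" by (simp add: v)
  qed
  have "complex_vector.span {v} \<subseteq> power_ker D F 1"
    unfolding complex_vector.span_singleton using FD by (auto simp: power_ker_def)
  with sub have "(\<Union>m. power_ker D F m) = complex_vector.span {v}" by blast
  moreover have "complex_vector.dim (complex_vector.span {v}) = 1"
    using complex_vector.dim_eq_card_independent [of "{v}"] v(2)
    by (simp add: complex_vector.dim_span complex_vector.independent_insert complex_vector.independent_empty)
  moreover have "eigenvalue D Ak l"
    unfolding eigenvalue_def eigenvector_def using v eigvec_eigen [OF l fl] by (auto simp: v_def)
  ultimately show ?thesis by (simp add: alg_simple_eigenvalue_def F_def)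
qed

lemma eigenvector_imp:
  assumes l: "l \<in> cball l0 r" and x: "x \<in> D" "x \<noteq> 0" "Ak x = l *\<^sub>C x"
  shows "l - l0 = f l" "x = \<phi> x *\<^sub>C eigvec l"
proof -
  show fl: "l - l0 = f l"
  proof (rule ccontr)
    assume "l - l0 \<noteq> f l"
    from perturbed_resolvent [OF l this] have "inj_on (\<lambda>x. l *\<^sub>C x - Ak x) D"
      by (auto simp: resolvent_set_def bij_betw_def)
    moreover have "l *\<^sub>C x - Ak x = l *\<^sub>C 0 - Ak 0"
      using x(3) clinear_on_scale [OF A_lin x(1), of 0] clinear_on_scale [OF B_lin x(1), of 0] by simp
    ultimately have "x = 0" using x(1) clinear_on_zero [OF A_lin] by (simp add: inj_on_def)
    with x(2) show False ..
  qed
  show "x = \<phi> x *\<^sub>C eigvec l"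
    by (rule generalized_eigvec [OF l fl x(1), of 0]) (simp only: x(3) diff_self scaleC_zero_left)
qed

lemma perturbed_spectrum:
  assumes l: "l \<in> cball l0 r" and fl: "l - l0 = f l"
  shows "cball l0 r \<inter> spectrum D Ak = {l}"
proof -
  have "l \<in> spectrum D Ak"
  proof (rule ccontr)
    assume "l \<notin> spectrum D Ak"
    then have "inj_on (\<lambda>x. l *\<^sub>C x - Ak x) D"
      by (auto simp: spectrum_def resolvent_set_def bij_betw_def)
    moreover have "l *\<^sub>C eigvec l - Ak (eigvec l) = l *\<^sub>C 0 - Ak 0"
      using eigvec_eigen [OF l fl] clinear_on_scale [OF A_lin v0(1), of 0] clinear_on_scale [OF B_lin v0(1), of 0]
      by simp
    ultimately have "eigvec l = 0"
      using eigvec_mem [OF l] clinear_on_zero [OF A_lin] by (simp add: inj_on_def)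
    with eigvec_nonzero [OF l] show False ..
  qed
  moreover have "m = l" if "m \<in> cball l0 r" "m \<in> spectrum D Ak" for m
    using that perturbed_resolvent eigenvalue_unique [OF _ _ l fl] by (auto simp: spectrum_def)
  ultimately show ?thesis using l by blast
qed

text \<open>Existence of the eigenpair, by a quadratic fixed point equation that only involves \<open>H l0\<close>: in this
  form the iterates visibly depend holomorphically on a parameter in \<open>B\<close>.\<close>

definition b :: "'a \<Rightarrow> 'a" where "b z = B v0 + B (H l0 z)"

text \<open>For \<open>v = v0 + H l0 z\<close> and \<open>l = l0 + \<phi> (B v)\<close>, the
  equation \<open>Ak v = l *\<^sub>C v\<close> becomes
  \<open>z = B v - \<phi> (B v) *\<^sub>C v\<close> with \<open>z = (l0 - A) v\<close>.\<close>

definition step :: "'a \<Rightarrow> 'a" where "step z = b z - \<phi> (b z) *\<^sub>C (v0 + H l0 z)"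

section \<open>The fixed point map as a contraction of the unit ball\<close>

lemma l0_mem: "l0 \<in> cball l0 r" using r(1) by simp

lemma b_diff: "norm (b z - b z') \<le> \<eta> * norm (z - z')"
proof -
  interpret H0: bounded_linear "H l0" by (rule H_linear [OF l0_mem])
  have "b z - b z' = B (H l0 (z - z'))"
    by (simp add: b_def H0.diff clinear_on_diff [OF B_lin] H_mem [OF l0_mem])
  then show ?thesis using B_H [OF l0_mem] by simp
qed

lemma b_bound:
  assumes "norm z \<le> 1"
  shows "norm (b z) \<le> 2 * \<eta>"
proof -
  have "norm (b z) \<le> \<eta> + \<eta> * norm z"
    unfolding b_def by (intro order_trans [OF norm_triangle_ineq] add_mono B_v0 B_H l0_mem)
  also have "\<eta> * norm z \<le> \<eta> * 1" by (intro mult_left_mono assms eta)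
  finally show ?thesis by simp
qed

lemma v_bound:
  assumes "norm z \<le> 1"
  shows "norm (v0 + H l0 z) \<le> norm v0 + M"
  using M(2) [OF l0_mem, of z] mult_left_mono [OF assms less_imp_le [OF M(1)]]
  by (intro order_trans [OF norm_triangle_ineq]) simp

lemma step_bound:
  assumes z: "norm z \<le> 1"
  shows "norm (step z) \<le> 1"
proof -
  have pb: "cmod (\<phi> (b z)) \<le> N * (2 * \<eta>)"
    using N b_bound [OF z] by (meson less_imp_le mult_left_mono order_trans)
  have "norm (step z) \<le> 2 * \<eta> + N * (2 * \<eta>) * (norm v0 + M)"
    unfolding step_def
    by (intro order_trans [OF norm_triangle_ineq4] add_mono b_bound z)
      (unfold norm_scaleC, intro mult_mono pb v_bound z, use N eta in auto)
  also have "\<dots> = 2 * \<eta> + (\<eta> * (8 * N * (norm v0 + M))) / 4" by (simp add: algebra_simps)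
  also have "\<dots> \<le> 1" using eta(2,5) by linarith
  finally show ?thesis .
qed

lemma step_contraction:
  assumes z: "norm z \<le> 1" "norm z' \<le> 1"
  shows "norm (step z - step z') \<le> 3/4 * norm (z - z')"
proof -
  interpret H0: bounded_linear "H l0" by (rule H_linear [OF l0_mem])
  have eq: "step z - step z' = (b z - b z') - (\<phi> (b z - b z') *\<^sub>C (v0 + H l0 z) + \<phi> (b z') *\<^sub>C H l0 (z - z'))"
    by (simp add: step_def phi.diff H0.diff scaleC_diff_left scaleC_diff_right scaleC_add_right)
  have pb: "cmod (\<phi> (b z')) \<le> N * (2 * \<eta>)"
    using N b_bound [OF z(2)] by (meson less_imp_le mult_left_mono order_trans)
  have pd: "cmod (\<phi> (b z - b z')) \<le> N * (\<eta> * norm (z - z'))"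
    using N b_diff [of z z'] by (meson less_imp_le mult_left_mono order_trans)
  have "norm (step z - step z') \<le> \<eta> * norm (z - z') +
      (N * (\<eta> * norm (z - z')) * (norm v0 + M) + N * (2 * \<eta>) * (M * norm (z - z')))"
    unfolding eq
    by (intro order_trans [OF norm_triangle_ineq4] order_trans [OF norm_triangle_ineq] add_mono b_diff;
        unfold norm_scaleC; intro mult_mono pb pd v_bound z M(2) l0_mem)
      (use N eta M in auto)
  \<comment> \<open>The smallness conditions bound the three terms of the factor by
    \<open>1/4\<close>, \<open>1/8\<close> and \<open>1/4\<close>.\<close>
  also have "\<dots> = (\<eta> + \<eta> * (8 * N * (norm v0 + M)) / 8 + \<eta> * (8 * N * M) / 4) * norm (z - z')"
    by (simp add: field_simps)
  also have "\<dots> \<le> 3/4 * norm (z - z')"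
    using eta(2,4,5) by (intro mult_right_mono norm_ge_zero) linarith
  finally show ?thesis .
qed

text \<open>The explicit geometric rate does not depend on the perturbation, which later makes
  convergence uniform in the parameter.\<close>

lemma step_fixpoint:
  shows "\<exists>z. norm z \<le> 1 \<and> step z = z \<and> (\<forall>n. norm ((step ^^ n) 0 - z) \<le> (3/4) ^ n)"
proof -
  have "\<exists>!z\<in>cball 0 1. step z = z"
  proof (rule Banach_fix)
    show "complete (cball (0::'a) 1)" by (simp add: complete_eq_closed)
    show "step ` cball 0 1 \<subseteq> cball 0 1" using step_bound by auto
    show "\<And>x y. x \<in> cball 0 1 \<Longrightarrow> y \<in> cball 0 1 \<Longrightarrow> dist (step x) (step y) \<le> 3/4 * dist x y"
      using step_contraction by (auto simp: dist_norm)
  qed auto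
  then obtain z where z: "norm z \<le> 1" "step z = z" by auto
  have n1: "norm ((step ^^ n) 0) \<le> 1" for n
    by (induction n) (auto intro: step_bound)
  have "norm ((step ^^ n) 0 - z) \<le> (3/4) ^ n" for n
  proof (induction n)
    case 0
    then show ?case using z by simp
  next
    case (Suc n)
    have "norm ((step ^^ Suc n) 0 - z) = norm (step ((step ^^ n) 0) - step z)" using z by simp
    also have "\<dots> \<le> 3/4 * norm ((step ^^ n) 0 - z)" by (intro step_contraction n1 z)
    also have "\<dots> \<le> 3/4 * (3/4) ^ n" using Suc by simp
    finally show ?case by simp
  qed
  with z show ?thesis by blast
qed

lemma fixpoint_eigenpair:
  assumes z: "norm z \<le> 1" "step z = z"
  defines "v \<equiv> v0 + H l0 z" and "l \<equiv> l0 + \<phi> (b z)"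
  shows "v \<in> D" "B v = b z" "Ak v = l *\<^sub>C v" "\<phi> v = 1" "l \<in> ball l0 r" "l - l0 = f l" "v = eigvec l"
proof -
  have H0z: "H l0 z \<in> D" "\<phi> (H l0 z) = 0" by (rule H_mem [OF l0_mem], rule phi_H [OF l0_mem])
  show v: "v \<in> D" unfolding v_def by (intro clinear_on_mem_add [OF A_lin] v0 H0z)
  show Bv: "B v = b z" by (simp add: v_def b_def clinear_on_add [OF B_lin] v0 H0z)
  show pv: "\<phi> v = 1" by (simp add: v_def phi.add phi(2) H0z)
  have zeq: "z = b z - \<phi> (b z) *\<^sub>C v" using z(2) by (simp add: step_def v_def)
  \<comment> \<open>A fixed point lies in the kernel of \<open>\<phi>\<close> because
    \<open>\<phi> v = 1\<close>; there \<open>H l0\<close> is an exact right inverse of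
    \<open>l0 - A\<close>.\<close>
  have "\<phi> z = 0" by (subst zeq) (simp add: phi.diff phi_scaleC pv)
  then have "l0 *\<^sub>C H l0 z - A (H l0 z) = z" using H_right [OF l0_mem, of z] by simp
  then have "A v = l0 *\<^sub>C v - z"
    by (simp add: v_def clinear_on_add [OF A_lin] v0 H0z scaleC_add_right algebra_simps)
  moreover have "\<phi> (b z) *\<^sub>C v = b z - z" using zeq by (auto simp: algebra_simps)
  ultimately show Ak: "Ak v = l *\<^sub>C v"
    unfolding l_def scaleC_add_left Bv by simp
  have "cmod (\<phi> (b z)) \<le> N * (2 * \<eta>)"
    using N b_bound [OF z(1)] by (meson less_imp_le mult_left_mono order_trans)
  also have "\<dots> = \<eta> * (8 * N) / 4" by simp
  also have "\<dots> < r" using eta(3) r(1) by linarith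
  finally show l: "l \<in> ball l0 r" by (simp add: l_def dist_norm)
  have lc: "l \<in> cball l0 r" using l by simp
  have "v \<noteq> 0" using pv by (auto simp: phi.zero)
  from eigenvector_imp [OF lc v this Ak] pv show "l - l0 = f l" "v = eigvec l" by simp_all
qed

end


section \<open>Holomorphic families of perturbations\<close>

text \<open>The bounds \<open>M\<close>, \<open>N\<close> and the slope \<open>E\<close> are common
  to all parameters, whereas the constants of \<open>regularity\<close> are quantified separately
  for each \<open>k\<close>.\<close>

locale perturbed_family = differentiable_semigroup T D A
  for T :: "real \<Rightarrow> 'a::banach_lattice complexification \<Rightarrow> 'a complexification" and D A +
  fixes u :: "'a complexification" and B :: "complex \<Rightarrow> 'a complexification \<Rightarrow> 'a complexification"
    and l0 :: complex and v0 \<phi> H0 and r M N E \<rho> :: real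
  assumes rho: "\<rho> > 0"
    and regular: "\<And>k. k \<in> ball 0 \<rho> \<Longrightarrow> \<exists>C1 \<alpha> C2 C3 \<beta> q t0. regularity T D A u (B k) C1 \<alpha> C2 C3 \<beta> q t0"
    and small: "\<And>k. k \<in> ball 0 \<rho> \<Longrightarrow> small_perturbation D A l0 v0 \<phi> H0 r (B k) M N (E * cmod k)"
    and hol: "\<And>x. x \<in> D \<Longrightarrow> (\<lambda>k. B k x) vholomorphic_on ball 0 \<rho>"
begin

definition bk where "bk k z = B k v0 + B k (H0 z)"

definition stepk where "stepk k z = bk k z - \<phi> (bk k z) *\<^sub>C (v0 + H0 z)"

text \<open>Chosen with \<open>SOME\<close>, but the rate identifies it as the limit of the iterates
  from 0, so nothing depends on the choice.\<close>

definition zk where "zk k = (SOME z. norm z \<le> 1 \<and> stepk k z = z \<and> (\<forall>n. norm ((stepk k ^^ n) 0 - z) \<le> (3/4) ^ n))"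

definition vk where "vk k = v0 + H0 (zk k)"

definition lk where "lk k = l0 + \<phi> (bk k (zk k))"

lemma zk:
  assumes k: "k \<in> ball 0 \<rho>"
  shows "norm (zk k) \<le> 1" "stepk k (zk k) = zk k" "norm ((stepk k ^^ n) 0 - zk k) \<le> (3/4) ^ n"
    "vk k \<in> D" "B k (vk k) = bk k (zk k)" "A (vk k) + B k (vk k) = lk k *\<^sub>C vk k" "\<phi> (vk k) = 1"
    "lk k \<in> ball l0 r"
    "norm (bk k z - bk k z') \<le> E * cmod k * norm (z - z')" "E * cmod k \<le> 1/4" "0 \<le> E * cmod k"
    "norm (bk k (zk k)) \<le> 2 * (E * cmod k)"
    "norm (vk k - v0) \<le> M * (2 * (E * cmod k) * (1 + N * (norm v0 + M)))"
    "cmod (lk k - l0) \<le> N * (2 * (E * cmod k))"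
proof -
  interpret sp: small_perturbation D A l0 v0 \<phi> H0 r "B k" M N "E * cmod k" by (rule small [OF k])
  have H: "sp.H l0 z = H0 z" for z by (simp add: sp.H_def)
  have b: "sp.b z = bk k z" for z by (simp add: sp.b_def bk_def H)
  have s: "sp.step = stepk k" by (rule ext) (simp add: sp.step_def stepk_def b H)
  have ex: "\<exists>z. norm z \<le> 1 \<and> stepk k z = z \<and> (\<forall>n. norm ((stepk k ^^ n) 0 - z) \<le> (3/4) ^ n)"
    using sp.step_fixpoint unfolding s .
  have z: "norm (zk k) \<le> 1 \<and> stepk k (zk k) = zk k \<and> (\<forall>n. norm ((stepk k ^^ n) 0 - zk k) \<le> (3/4) ^ n)"
    unfolding zk_def by (rule someI_ex [OF ex])
  then show z1: "norm (zk k) \<le> 1" and z2: "stepk k (zk k) = zk k"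
    and "norm ((stepk k ^^ n) 0 - zk k) \<le> (3/4) ^ n" by auto
  have z2': "sp.step (zk k) = zk k" by (simp add: s z2)
  note fp = sp.fixpoint_eigenpair [OF z1 z2', unfolded H b, folded vk_def lk_def]
  show "vk k \<in> D" "B k (vk k) = bk k (zk k)" "A (vk k) + B k (vk k) = lk k *\<^sub>C vk k" "\<phi> (vk k) = 1"
    "lk k \<in> ball l0 r" by (rule fp)+
  show "norm (bk k z - bk k z') \<le> E * cmod k * norm (z - z')" using sp.b_diff [of z z'] by (simp only: b)
  show "E * cmod k \<le> 1/4" "0 \<le> E * cmod k" by (rule sp.eta)+
  show bb: "norm (bk k (zk k)) \<le> 2 * (E * cmod k)" using sp.b_bound [OF z1] by (simp only: b)
  have pb: "cmod (\<phi> (bk k (zk k))) \<le> N * (2 * (E * cmod k))"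
    using sp.N bb by (meson less_imp_le mult_left_mono order_trans)
  then show "cmod (lk k - l0) \<le> N * (2 * (E * cmod k))" by (simp add: lk_def)
  have vb: "norm (vk k) \<le> norm v0 + M" using sp.v_bound [OF z1] by (simp only: H vk_def)
  have "zk k = bk k (zk k) - \<phi> (bk k (zk k)) *\<^sub>C vk k" using z2 by (simp add: stepk_def vk_def)
  then have "norm (zk k) \<le> norm (bk k (zk k)) + cmod (\<phi> (bk k (zk k))) * norm (vk k)"
    by (metis norm_scaleC norm_triangle_ineq4)
  also have "\<dots> \<le> 2 * (E * cmod k) + N * (2 * (E * cmod k)) * (norm v0 + M)"
    by (intro add_mono bb mult_mono pb vb) (use sp.N sp.eta in auto)
  finally have zb: "norm (zk k) \<le> 2 * (E * cmod k) * (1 + N * (norm v0 + M))" by (simp add: algebra_simps)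
  have "norm (vk k - v0) \<le> M * norm (zk k)"
    using sp.M(2) [OF sp.l0_mem, of "zk k"] by (simp add: vk_def H)
  also have "\<dots> \<le> M * (2 * (E * cmod k) * (1 + N * (norm v0 + M)))"
    using zb sp.M(1) by (intro mult_left_mono) auto
  finally show "norm (vk k - v0) \<le> M * (2 * (E * cmod k) * (1 + N * (norm v0 + M)))" .
qed

lemma zero_mem: "0 \<in> ball (0::complex) \<rho>" using rho by simp

lemma iterates_holomorphic: "(\<lambda>k. (stepk k ^^ n) 0) vholomorphic_on ball 0 \<rho>"
  and bk_iterates_holomorphic: "(\<lambda>k. bk k ((stepk k ^^ n) 0)) vholomorphic_on ball 0 \<rho>"
proof -
  interpret s0: small_perturbation D A l0 v0 \<phi> H0 r "B 0" M N "E * cmod 0" by (rule small [OF zero_mem])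
  have bhol: "(\<lambda>k. bk k (g k)) vholomorphic_on ball 0 \<rho>" if g: "g vholomorphic_on ball 0 \<rho>" for g
    unfolding bk_def
  \<comment> \<open>\<open>B k\<close> need not be bounded on \<open>E\<close>, but its composition
    with \<open>H0\<close> is bounded by \<open>1/4\<close> uniformly in \<open>k\<close>, as the
    product rule \<open>vholomorphic_apply\<close> requires.\<close>
  proof (intro vholomorphic_add hol s0.v0 open_ball, rule vholomorphic_apply [where K = "\<lambda>k x. B k (H0 x)" and M = "1/4"])
    show "(\<lambda>k. B k (H0 x)) vholomorphic_on ball 0 \<rho>" for x by (rule hol [OF s0.H0(3)])
    fix k :: complex assume k: "k \<in> ball 0 \<rho>"
    interpret sp: small_perturbation D A l0 v0 \<phi> H0 r "B k" M N "E * cmod k" by (rule small [OF k])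
    show "bounded_clinear (\<lambda>x. B k (H0 x))" using sp.HB [OF sp.l0_mem] by (simp add: s0.H_def)
    show "norm (B k (H0 x)) \<le> 1/4 * norm x" for x
      using sp.B_H [OF sp.l0_mem, of x] mult_right_mono [OF sp.eta(2), of "norm x"] by (simp add: s0.H_def)
  qed (rule g, rule open_ball)
  have shol: "(\<lambda>k. stepk k (g k)) vholomorphic_on ball 0 \<rho>" if g: "g vholomorphic_on ball 0 \<rho>" for g
  proof -
    have "(\<lambda>k. bk k (g k) + (- \<phi> (bk k (g k))) *\<^sub>C (v0 + H0 (g k))) vholomorphic_on ball 0 \<rho>"
      by (intro vholomorphic_add vholomorphic_scaleC holomorphic_on_minus vholomorphic_functional bhol g s0.phi(1)
          vholomorphic_const vholomorphic_bounded_clinear [OF g] s0.H0(1) open_ball)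
    then show ?thesis by (simp add: stepk_def scaleC_minus_left)
  qed
  show it: "(\<lambda>k. (stepk k ^^ n) 0) vholomorphic_on ball 0 \<rho>" for n
    by (induction n) (simp_all add: vholomorphic_const shol)
  show "(\<lambda>k. bk k ((stepk k ^^ n) 0)) vholomorphic_on ball 0 \<rho>" by (rule bhol [OF it])
qed

text \<open>Convergence of vectors in \<open>E\<close> does not pass through \<open>B k\<close>. It
  is therefore used inside \<open>bk\<close>, which is Lipschitz uniformly in \<open>k\<close>, and
  the claim becomes a locally uniform limit of holomorphic functions.\<close>

lemma functional_Bv_holomorphic:
  assumes psi: "functional \<psi>"
  shows "(\<lambda>k. \<psi> (B k (vk k))) holomorphic_on ball 0 \<rho>"
proof (rule holomorphic_uniform_sequence [OF open_ball])
  interpret psi: bounded_linear \<psi> by (rule functional_bounded_linear [OF psi])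
  show "(\<lambda>k. \<psi> (bk k ((stepk k ^^ n) 0))) holomorphic_on ball 0 \<rho>" for n
    by (rule vholomorphic_functional [OF bk_iterates_holomorphic open_ball psi])
  obtain P where P: "P > 0" "\<And>x. norm (\<psi> x) \<le> norm x * P" using psi.pos_bounded by blast
  have bd: "norm (\<psi> (bk k ((stepk k ^^ n) 0)) - \<psi> (B k (vk k))) \<le> P * (3/4) ^ n" if k: "k \<in> ball 0 \<rho>" for k n
  proof -
    have "norm (bk k ((stepk k ^^ n) 0) - bk k (zk k)) \<le> E * cmod k * norm ((stepk k ^^ n) 0 - zk k)"
      by (rule zk(9) [OF k])
    also have "\<dots> \<le> 1 * (3/4) ^ n"
      using zk(10,11) [OF k] by (intro mult_mono zk(3) [OF k]) auto
    finally have "norm (bk k ((stepk k ^^ n) 0) - bk k (zk k)) \<le> (3/4) ^ n" by simp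
    then have "norm (bk k ((stepk k ^^ n) 0) - bk k (zk k)) * P \<le> (3/4) ^ n * P"
      using P(1) by (intro mult_right_mono) auto
    with P(2) [of "bk k ((stepk k ^^ n) 0) - bk k (zk k)"] show ?thesis
      by (simp add: psi.diff zk(5) [OF k] mult.commute)
  qed
  fix x :: complex assume "x \<in> ball 0 \<rho>"
  then obtain d where d: "0 < d" "cball x d \<subseteq> ball 0 \<rho>" using open_contains_cball open_ball by blast
  have "uniform_limit (cball x d) (\<lambda>n k. \<psi> (bk k ((stepk k ^^ n) 0))) (\<lambda>k. \<psi> (B k (vk k))) sequentially"
    unfolding uniform_limit_iff
  proof (intro allI impI)
    fix e :: real assume "0 < e"
    have "(\<lambda>n. P * (3/4) ^ n) \<longlonglongrightarrow> P * 0" by (intro tendsto_intros LIMSEQ_realpow_zero) auto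
    then have "\<forall>\<^sub>F n in sequentially. P * (3/4) ^ n < e" using \<open>0 < e\<close> by (intro order_tendstoD) auto
    then show "\<forall>\<^sub>F n in sequentially. \<forall>k\<in>cball x d. dist (\<psi> (bk k ((stepk k ^^ n) 0))) (\<psi> (B k (vk k))) < e"
    proof eventually_elim
      case (elim n)
      show ?case
      proof
        fix k assume "k \<in> cball x d"
        then have "k \<in> ball 0 \<rho>" using d by blast
        from bd [OF this, of n] elim show "dist (\<psi> (bk k ((stepk k ^^ n) 0))) (\<psi> (B k (vk k))) < e"
          by (simp add: dist_norm)
      qed
    qed
  qed
  with d show "\<exists>d>0. cball x d \<subseteq> ball 0 \<rho> \<and>
      uniform_limit (cball x d) (\<lambda>n k. \<psi> (bk k ((stepk k ^^ n) 0))) (\<lambda>k. \<psi> (B k (vk k))) sequentially"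
    by blast
qed

lemma eigenvector_order_ball:
  assumes mu: "\<mu> \<in> resolvent_set D A" and k: "k \<in> ball 0 \<rho>"
  shows "\<exists>b\<ge>0. vk k \<in> order_ball u b \<and> B k (vk k) \<in> order_ball u b"
proof -
  obtain C1 \<alpha> C2 C3 \<beta> q t0 where "regularity T D A u (B k) C1 \<alpha> C2 C3 \<beta> q t0"
    using regular [OF k] by blast
  then interpret reg: regularity T D A u "B k" C1 \<alpha> C2 C3 \<beta> q t0 .
  show ?thesis by (rule reg.eigenvector_regularity [OF mu zk(4) [OF k] zk(6) [OF k]])
qed

text \<open>Since \<open>v0 = exp (- l0 t) T t v0\<close>, the difference \<open>vk k - v0\<close>
  splits into the Duhamel term of \<open>vk k\<close> and \<open>T t (w k)\<close>. The order of
  choices matters: \<open>t\<close> is taken so small that the Duhamel term has gauge at most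
  \<open>c / 2\<close> for all \<open>k\<close> in a fixed disc; with this \<open>t\<close> fixed,
  smoothing bounds \<open>T t (w k)\<close> by a constant times \<open>norm (w k)\<close>, which
  tends to 0 with \<open>k\<close>.\<close>

theorem eigenvector_convergence:
  assumes mu: "\<mu> \<in> resolvent_set D A" and c: "c > 0"
  shows "\<exists>\<delta>>0. \<delta> \<le> \<rho> \<and> (\<forall>k\<in>ball 0 \<delta>. vk k - v0 \<in> order_ball u c)"
proof -
  interpret s0: small_perturbation D A l0 v0 \<phi> H0 r "B 0" M N "E * cmod 0" by (rule small [OF zero_mem])
  \<comment> \<open>Smoothing and ideal bounds of \<open>T\<close> do not involve the perturbation,
    so the instance at \<open>k = 0\<close> serves every \<open>k\<close>.\<close>
  obtain C1 \<alpha> C2 C3 \<beta> q t0 where "regularity T D A u (B 0) C1 \<alpha> C2 C3 \<beta> q t0"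
    using regular [OF zero_mem] by blast
  then interpret reg: regularity T D A u "B 0" C1 \<alpha> C2 C3 \<beta> q t0 .
  define C where "C = max C1 1"
  define a where "a = max \<alpha> 0"
  have smooth: "T t x \<in> order_ball u (C * t powr (- a) * norm x)" if t: "t \<in> {0<..1}" for t x
  proof (rule order_ball_mono [OF reg.u _ reg.smooth [OF t]])
    have "t powr (- \<alpha>) \<le> t powr (- a)" using t by (intro powr_mono') (auto simp: a_def)
    then show "C1 * t powr (- \<alpha>) * norm x \<le> C * t powr (- a) * norm x"
      using reg.C1 by (intro mult_right_mono mult_mono) (auto simp: C_def)
  qed
  have C0: "C \<ge> 1" "a \<ge> 0" by (simp_all add: C_def a_def)
  have "\<exists>s0\<in>{0<..1}. \<forall>s\<in>{0<..s0}. \<forall>\<psi>\<in>order_polar u. \<forall>k\<in>cball 0 (\<rho>/4).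
      cmod (\<psi> (T s (B k (vk k)))) \<le> s powr (- (1/2))"
  proof (rule hartogs_family [OF rho _ _ C0])
    fix s \<psi> assume s: "s \<in> {0<..1::real}" and psi: "\<psi> \<in> order_polar u"
    have Ts: "bounded_clinear (T s)" using s by (intro T_bounded_clinear) simp
    have f: "functional \<psi>" using psi by (simp add: order_polar_def)
    have "functional (\<lambda>x. \<psi> (T s x))"
      unfolding functional_def
      by (simp add: bounded_clinear_scaleC [OF Ts] functional_scaleC [OF f]
          bounded_linear_compose [OF functional_bounded_linear [OF f] bounded_clinear_bounded_linear [OF Ts]])
    then show "(\<lambda>k. \<psi> (T s (B k (vk k)))) holomorphic_on ball 0 \<rho>" by (rule functional_Bv_holomorphic)
    fix k :: complex assume k: "k \<in> ball 0 \<rho>"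
    have "cmod (\<psi> (T s (B k (vk k)))) \<le> C * s powr (- a) * norm (B k (vk k))"
      using C0 by (intro order_polarD [OF reg.u psi smooth [OF s]]) simp
    \<comment> \<open>\<open>norm (B k (vk k))\<close> is at most
      \<open>2 * (E * cmod k) \<le> 1/2\<close>, so the growth constant is free of
      \<open>k\<close>.\<close>
    also have "\<dots> \<le> C * s powr (- a) * 1"
      using zk(5,10,12) [OF k] C0 by (intro mult_left_mono) auto
    finally show "cmod (\<psi> (T s (B k (vk k)))) \<le> C * s powr (- a)" by simp
  next
    fix k :: complex assume k: "k \<in> ball 0 \<rho>"
    \<comment> \<open>Here \<open>b\<close> depends on \<open>k\<close> in an uncontrolled way; the
      bound is uniform only in \<open>s\<close> and \<psi> at fixed \<open>k\<close>.\<close>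
    obtain b where b: "b \<ge> 0" "B k (vk k) \<in> order_ball u b" using eigenvector_order_ball [OF mu k] by blast
    have "cmod (\<psi> (T s (B k (vk k)))) \<le> C2 * b" if "s \<in> {0<..1}" "\<psi> \<in> order_polar u" for s \<psi>
      using that b reg.C2 by (intro order_polarD [OF reg.u _ reg.T_ideal]) auto
    then show "\<exists>K. \<forall>s\<in>{0<..1}. \<forall>\<psi>\<in>order_polar u. cmod (\<psi> (T s (B k (vk k)))) \<le> K" by blast
  qed
  then obtain s0 where s0: "s0 \<in> {0<..1}"
    and unif: "\<And>s \<psi> k. s \<in> {0<..s0} \<Longrightarrow> \<psi> \<in> order_polar u \<Longrightarrow> k \<in> cball 0 (\<rho>/4) \<Longrightarrow>
      cmod (\<psi> (T s (B k (vk k)))) \<le> s powr (- (1/2))" by blast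
  define \<Lambda> where "\<Lambda> = cmod l0 + r"
  have duhamel: "cmod (\<psi> (vk k - exp (- lk k * of_real t) *\<^sub>C T t (vk k))) \<le> exp \<Lambda> * t powr (1/2) / (1/2)"
    if t: "0 < t" "t \<le> s0" and psi: "\<psi> \<in> order_polar u" and k: "k \<in> cball 0 (\<rho>/4)" for t \<psi> k
  proof -
    have kb: "k \<in> ball 0 \<rho>" using k rho by simp
    have f: "functional \<psi>" using psi by (simp add: order_polar_def)
    interpret psi: bounded_linear \<psi> by (rule functional_bounded_linear [OF f])
    have lk: "cmod (lk k) \<le> \<Lambda>"
      using zk(8) [OF kb] norm_triangle_ineq2 [of "lk k" l0] by (simp add: \<Lambda>_def dist_norm norm_minus_commute)
    define g where "g s = \<psi> (exp (- lk k * of_real s) *\<^sub>C T s (vk k))" for s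
    have "norm (g t - g 0) \<le> exp \<Lambda> * t powr (1 - 1/2) / (1 - 1/2)"
    proof (rule powr_integral_bound [OF t(1)])
      show "continuous_on {0..t} g" unfolding g_def by (intro psi.continuous_on exp_T_continuous)
      fix s assume s: "0 < s" "s < t"
      show "(g has_vector_derivative \<psi> (- (exp (- lk k * of_real s) *\<^sub>C (lk k *\<^sub>C T s (vk k) - A (T s (vk k)))))) (at s)"
        unfolding g_def [abs_def] by (intro psi.has_vector_derivative exp_T_derivative s)
      interpret Ts: bounded_linear "T s" using s by (intro T_bounded_linear) simp
      have Bv: "B k (vk k) = lk k *\<^sub>C vk k - A (vk k)"
        unfolding zk(6) [OF kb, symmetric] by simp
      \<comment> \<open>Up to sign and the exponential factor, the eigenvalue equation turns the
        derivative of \<open>exp (- lk k s) T s (vk k)\<close> into \<open>T s (B k (vk k))\<close>,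
        the vector controlled by Hartogs' lemma.\<close>
      have "lk k *\<^sub>C T s (vk k) - A (T s (vk k)) = T s (B k (vk k))"
        unfolding Bv using s by (simp add: Ts.diff T_scaleC T_A_commute(2) [OF zk(4) [OF kb]])
      moreover have "cmod (exp (- lk k * of_real s)) \<le> exp (cmod (lk k) * 1)"
        using s t s0 by (intro norm_exp_le) auto
      then have "cmod (exp (- lk k * of_real s)) \<le> exp \<Lambda>" using lk by (smt (verit) exp_le_cancel_iff mult.right_neutral)
      moreover have "cmod (\<psi> (T s (B k (vk k)))) \<le> s powr (- (1/2))" using s t by (intro unif psi k) auto
      ultimately show "norm (\<psi> (- (exp (- lk k * of_real s) *\<^sub>C (lk k *\<^sub>C T s (vk k) - A (T s (vk k)))))) \<le> exp \<Lambda> * s powr (- (1/2))"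
        by (simp only: psi.neg norm_minus_cancel functional_scaleC [OF f] norm_mult) (intro mult_mono, auto)
    qed auto
    moreover have "g t - g 0 = - \<psi> (vk k - exp (- lk k * of_real t) *\<^sub>C T t (vk k))"
      by (simp add: g_def T_0 psi.diff)
    ultimately show ?thesis by simp
  qed
  have fixed: "v0 = exp (- l0 * of_real t) *\<^sub>C T t v0" if t: "0 < t" for t
  proof -
    have "norm (exp (- l0 * of_real t) *\<^sub>C T t v0 - exp (- l0 * of_real 0) *\<^sub>C T 0 v0) \<le> 0 * t powr (1 - 0) / (1 - 0)"
    proof (rule powr_integral_bound [OF t, where f = "\<lambda>s. exp (- l0 * of_real s) *\<^sub>C T s v0"])
      fix s assume s: "0 < s" "s < t"
      have "A (T s v0) = l0 *\<^sub>C T s v0" using T_A_commute(2) [OF s0.v0(1), of s] s s0.v0(3) by (simp add: T_scaleC)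
      then show "((\<lambda>s. exp (- l0 * of_real s) *\<^sub>C T s v0) has_vector_derivative 0) (at s)"
        using exp_T_derivative [OF s(1), of l0 v0] by simp
    qed (simp, simp, rule exp_T_continuous, simp)
    then show ?thesis by (simp add: T_0)
  qed
  have "((\<lambda>t. t powr (1/2)) \<longlongrightarrow> (0::real)) (at_right 0)"
    by (rule tendsto_eq_rhs [OF tendsto_powr' [OF tendsto_ident_at tendsto_const]])
      (auto simp: eventually_at_filter)
  then have "((\<lambda>t. exp \<Lambda> * t powr (1/2) / (1/2)) \<longlongrightarrow> exp \<Lambda> * 0 / (1/2)) (at_right 0)"
    by (intro tendsto_intros) auto
  then have "\<forall>\<^sub>F t in at_right 0. exp \<Lambda> * t powr (1/2) / (1/2) < c / 2" using c by (intro order_tendstoD) auto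
  moreover have "\<forall>\<^sub>F t in at_right 0. 0 < t \<and> t < s0"
    by (rule eventually_at_rightI [of 0 s0]) (use s0 in auto)
  ultimately obtain t where t: "exp \<Lambda> * t powr (1/2) / (1/2) < c / 2" "0 < t" "t < s0"
    using eventually_happens' [OF trivial_limit_at_right_real] by (metis (mono_tags, lifting) eventually_conj)
  define w where "w k = exp (- lk k * of_real t) *\<^sub>C vk k - exp (- l0 * of_real t) *\<^sub>C v0" for k
  have ek: "((\<lambda>k. E * cmod k) \<longlongrightarrow> 0) (nhds 0)"
    by (rule tendsto_eq_rhs [OF tendsto_mult [OF tendsto_const tendsto_norm [OF filterlim_ident]]]) simp
  have evk: "\<forall>\<^sub>F k in nhds 0. k \<in> ball (0::complex) \<rho>" using rho by (intro eventually_nhds_in_open) auto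
  have "((\<lambda>k. vk k - v0) \<longlongrightarrow> 0) (nhds 0)"
  proof (rule Lim_null_comparison [OF eventually_mono [OF evk zk(13)]])
    show "((\<lambda>k. M * (2 * (E * cmod k) * (1 + N * (norm v0 + M)))) \<longlongrightarrow> 0) (nhds 0)"
      using tendsto_mult [OF tendsto_const tendsto_mult [OF tendsto_mult [OF tendsto_const ek] tendsto_const],
          of M 2 "1 + N * (norm v0 + M)"] by simp
  qed
  then have vlim: "(vk \<longlongrightarrow> v0) (nhds 0)" by (simp add: LIM_zero_iff)
  have "((\<lambda>k. lk k - l0) \<longlongrightarrow> 0) (nhds 0)"
  proof (rule Lim_null_comparison [OF eventually_mono [OF evk zk(14)]])
    show "((\<lambda>k. N * (2 * (E * cmod k))) \<longlongrightarrow> 0) (nhds 0)"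
      using tendsto_mult [OF tendsto_const tendsto_mult [OF tendsto_const ek], of N 2] by simp
  qed
  then have llim: "(lk \<longlongrightarrow> l0) (nhds 0)" by (simp add: LIM_zero_iff)
  have "((\<lambda>k. w k) \<longlongrightarrow> exp (- l0 * of_real t) *\<^sub>C v0 - exp (- l0 * of_real t) *\<^sub>C v0) (nhds 0)"
    unfolding w_def by (intro tendsto_diff tendsto_scaleC tendsto_const vlim tendsto_exp tendsto_mult tendsto_minus llim)
  then have "((\<lambda>k. C * t powr (- a) * norm (w k)) \<longlongrightarrow> C * t powr (- a) * norm (0 :: 'a complexification)) (nhds 0)"
    by (intro tendsto_mult tendsto_const tendsto_norm) simp
  then have "\<forall>\<^sub>F k in nhds 0. C * t powr (- a) * norm (w k) < c / 2" using c by (intro order_tendstoD) auto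
  then obtain d where d: "d > 0" "\<And>k. dist k 0 < d \<Longrightarrow> C * t powr (- a) * norm (w k) < c / 2"
    unfolding eventually_nhds_metric by blast
  have "vk k - v0 \<in> order_ball u c" if k: "k \<in> ball 0 (min d (\<rho>/4))" for k
  proof (rule order_ball_polar [OF reg.u])
    fix \<psi> assume psi: "\<psi> \<in> order_polar u"
    have f: "functional \<psi>" using psi by (simp add: order_polar_def)
    interpret psi: bounded_linear \<psi> by (rule functional_bounded_linear [OF f])
    have T1: "t \<in> {0<..1}" using t s0 by simp
    interpret Tt: bounded_linear "T t" using t by (intro T_bounded_linear) simp
    have "vk k - v0 = (vk k - exp (- lk k * of_real t) *\<^sub>C T t (vk k)) + T t (w k)"
      using fixed [OF t(2)] t by (simp add: w_def Tt.diff T_scaleC)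
    then have "cmod (\<psi> (vk k - v0)) \<le> cmod (\<psi> (vk k - exp (- lk k * of_real t) *\<^sub>C T t (vk k))) + cmod (\<psi> (T t (w k)))"
      by (metis norm_triangle_ineq psi.add)
    also have "\<dots> \<le> c / 2 + c / 2"
    proof (rule add_mono)
      show "cmod (\<psi> (vk k - exp (- lk k * of_real t) *\<^sub>C T t (vk k))) \<le> c / 2"
        using duhamel [of t \<psi> k] t psi k by simp
      have "cmod (\<psi> (T t (w k))) \<le> C * t powr (- a) * norm (w k)"
        using C0 by (intro order_polarD [OF reg.u psi smooth [OF T1]]) simp
      also have "\<dots> < c / 2" using k by (intro d) simp
      finally show "cmod (\<psi> (T t (w k))) \<le> c / 2" by simp
    qed
    finally show "cmod (\<psi> (vk k - v0)) \<le> c" by simp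
  qed (use c in simp)
  then show ?thesis using d rho by (intro exI [of _ "min d (\<rho>/4)"]) auto
qed

end


section \<open>The theorem\<close>

lemma scaleC_parts [simp]:
  fixes x :: "'a::banach_lattice complexification"
  shows "re_part (c *\<^sub>C x) = Re c *\<^sub>R re_part x - Im c *\<^sub>R im_part x"
    and "im_part (c *\<^sub>C x) = Re c *\<^sub>R im_part x + Im c *\<^sub>R re_part x"
  by (simp_all add: scaleC_complexification_def)

lemma plus_parts [simp]:
  fixes x y :: "'a::banach_lattice complexification"
  shows "re_part (x + y) = re_part x + re_part y" "im_part (x + y) = im_part x + im_part y"
    "re_part (x - y) = re_part x - re_part y" "im_part (x - y) = im_part x - im_part y"
    "re_part (0 :: 'a complexification) = 0" "im_part (0 :: 'a complexification) = 0"
    "re_part (t *\<^sub>R x) = t *\<^sub>R re_part x" "im_part (t *\<^sub>R x) = t *\<^sub>R im_part x"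
  by (simp_all add: complexification_defs)

lemma complexification_eqI:
  "re_part x = re_part y \<Longrightarrow> im_part x = im_part y \<Longrightarrow> x = y"
  by (rule complexification.expand) simp

lemma real_operator_parts:
  fixes D :: "'a::banach_lattice complexification set"
  assumes real: "real_operator D A" and lin: "clinear_on D A" and x: "x \<in> D"
  shows "Cplx (re_part x) 0 \<in> D" "Cplx (im_part x) 0 \<in> D"
    "A (Cplx (re_part x) 0) = Cplx (re_part (A x)) 0" "A (Cplx (im_part x) 0) = Cplx (im_part (A x)) 0"
proof -
  have "x \<in> {x + \<i> *\<^sub>C y | x y. x \<in> D \<inter> real_elements \<and> y \<in> D \<inter> real_elements}"
    using real x unfolding real_operator_def by blast
  then obtain a b where ab: "x = a + \<i> *\<^sub>C b" "a \<in> D" "b \<in> D" "im_part a = 0" "im_part b = 0"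
    by (auto simp: real_elements_def)
  have ax: "Cplx (re_part x) 0 = a" and bx: "Cplx (im_part x) 0 = b"
    using ab(4,5) by (auto simp: ab(1) intro: complexification_eqI)
  have im: "im_part (A a) = 0" "im_part (A b) = 0"
    using real ab unfolding real_operator_def real_elements_def by auto
  have "A x = A a + \<i> *\<^sub>C A b"
    using ab(2,3) by (simp add: ab(1) clinear_on_add [OF lin] clinear_on_scale [OF lin] clinear_on_mem_scale [OF lin])
  then have "re_part (A x) = re_part (A a)" "im_part (A x) = re_part (A b)" by (simp_all add: im)
  then show "Cplx (re_part x) 0 \<in> D" "Cplx (im_part x) 0 \<in> D"
    "A (Cplx (re_part x) 0) = Cplx (re_part (A x)) 0" "A (Cplx (im_part x) 0) = Cplx (im_part (A x)) 0"
    unfolding ax bx using ab(2,3) im by (auto intro: complexification_eqI)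
qed

text \<open>Conjugation thus sends eigenpairs to eigenpairs with conjugate eigenvalue; together with
  uniqueness in the disc this makes the perturbed eigenvalue real.\<close>

lemma real_operator_cnj:
  fixes D :: "'a::banach_lattice complexification set"
  assumes real: "real_operator D A" and lin: "clinear_on D A" and x: "x \<in> D"
  shows "Cplx (re_part x) (- im_part x) \<in> D"
    "A (Cplx (re_part x) (- im_part x)) = Cplx (re_part (A x)) (- im_part (A x))"
proof -
  note parts = real_operator_parts [OF assms]
  have eq: "Cplx (re_part y) (- im_part y) = Cplx (re_part y) 0 + (- \<i>) *\<^sub>C Cplx (im_part y) 0"
    for y :: "'a complexification"
    by (rule complexification_eqI) simp_all
  show "Cplx (re_part x) (- im_part x) \<in> D"
    unfolding eq by (intro clinear_on_mem_add [OF lin] clinear_on_mem_scale [OF lin] parts)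
  show "A (Cplx (re_part x) (- im_part x)) = Cplx (re_part (A x)) (- im_part (A x))"
    unfolding eq
    by (simp only: clinear_on_add [OF lin] clinear_on_mem_scale [OF lin] clinear_on_scale [OF lin] parts)
qed

text \<open>The infimum runs over positive radii, so radius 0 has to be reached through
  \<open>a + e\<close>.\<close>

lemma gauge_norm_le_nonneg:
  assumes "0 \<le> u" "0 \<le> a" "x \<in> order_ball u a"
  shows "gauge_norm u x \<le> a"
proof (rule field_le_epsilon)
  fix e :: real assume "0 < e"
  then show "gauge_norm u x \<le> a + e"
    using assms order_ball_mono [OF assms(1) _ assms(3), of "a + e"] by (intro gauge_norm_le) auto
qed

text \<open>Settles the degenerate case \<open>u = 0\<close>, where a lower bound by a multiple of
  \<open>u\<close> does not prevent a vector from vanishing.\<close>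

lemma order_ball_zero_vector:
  assumes "x \<in> order_ball 0 a"
  shows "x = 0"
proof -
  have "modulus (re_part x) (im_part x) \<le> 0" using assms by (simp add: order_ball_modulus)
  then have "modulus (re_part x) (im_part x) = 0" using modulus_nonneg by (rule antisym)
  then have "norm x = 0" by (simp add: norm_complexification_def)
  then show ?thesis by simp
qed

theorem theorem3p6:
  fixes u v0 :: "'a::banach_lattice complexification"
    and T :: "real \<Rightarrow> 'a complexification \<Rightarrow> 'a complexification"
    and D :: "'a complexification set"
    and A :: "'a complexification \<Rightarrow> 'a complexification"
    and B :: "complex \<Rightarrow> 'a complexification \<Rightarrow> 'a complexification"
    and lambda0 r c :: real
  assumes u: "0 \<le> u"
    and T: "c0_semigroup T" "is_generator T D A" "immediately_differentiable T D"
    and B_bounded: "\<forall>k\<in>ball 0 1. graph_bounded D A (B k)"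
    and B_zero: "\<forall>x\<in>D. B 0 x = 0"
    and smoothing: "\<forall>k\<in>ball (0::complex) 1. \<exists>C\<ge>1. \<exists>\<alpha>>0. \<forall>t\<in>{0<..1}.
      range (T t) \<subseteq> principal_ideal u \<and>
      (\<forall>x. gauge_norm u (T t x) \<le> C * t powr (-\<alpha>) * norm x)"
    and miyadera: "\<forall>k\<in>ball 0 1. \<exists>q\<in>{0<..<1}. \<exists>t0>0. \<forall>x\<in>D.
      integral {0..t0} (\<lambda>s. norm (B k (T s x))) \<le> q * norm x"
    and ideal_bounds: "\<forall>k\<in>ball 0 1. \<exists>C\<ge>1. \<exists>\<beta>\<in>{0..<1}.
      (\<forall>t\<in>{0<..1}. \<forall>x\<in>principal_ideal u. T t x \<in> principal_ideal u \<and>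
         gauge_norm u (T t x) \<le> C * gauge_norm u x) \<and>
      (\<forall>t\<in>{0<..1}. \<forall>x\<in>principal_ideal u. T t x \<in> D \<longrightarrow>
         B k (T t x) \<in> principal_ideal u \<and>
         gauge_norm u (B k (T t x)) \<le> C * t powr (-\<beta>) * gauge_norm u x)"
    and holomorphic: "\<forall>x\<in>D. (\<lambda>k. A x + B k x) vholomorphic_on ball 0 1"
    and real_A: "real_operator D A"
    and real_B: "\<forall>k::real. \<bar>k\<bar> < 1 \<longrightarrow> real_operator D (B (of_real k))"
    and pole: "resolvent_pole D A (of_real lambda0)"
    and simple: "alg_simple_eigenvalue D A (of_real lambda0)"
    and v0: "eigenvector D A (of_real lambda0) v0" "c > 0" "c *\<^sub>R u \<le> v0"
    and r: "r > 0" "cball (of_real lambda0) r \<inter> spectrum D A = {of_real lambda0}"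
    and beta_lim: "((\<lambda>k::real. SUP l\<in>sphere (of_real lambda0) r.
        onorm (\<lambda>x. B (of_real k) (resolvent D A l x))) \<longlongrightarrow> 0) (at 0)"
  shows "\<exists>\<delta>>0. \<delta> \<le> 1 \<and> (\<forall>k\<in>{-\<delta><..<\<delta>}.
    let Ak = (\<lambda>x. A x + B (of_real k) x) in
    \<exists>l::real.
      (l \<in> {lambda0 - r<..<lambda0 + r} \<and> alg_simple_eigenvalue D Ak (of_real l) \<and>
       (\<forall>l'\<in>{lambda0 - r<..<lambda0 + r}. alg_simple_eigenvalue D Ak (of_real l') \<longrightarrow> l' = l) \<and>
       (\<exists>v. eigenvector D Ak (of_real l) v \<and> v \<in> principal_ideal u) \<and>
       cball (of_real lambda0) r \<inter> spectrum D Ak = {of_real l}) \<and>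
      (\<exists>v. eigenvector D Ak (of_real l) v \<and> v \<in> principal_ideal u \<and> (c / 2) *\<^sub>R u \<le> v))"
proof -
  note c_pos = v0(2) and v0_ge = v0(3)
  interpret differentiable_semigroup T D A
    using T by unfold_locales
  have Blin: "clinear_on D (B k)" if "k \<in> ball 0 1" for k
    using B_bounded that by (auto simp: graph_bounded_def)

  \<comment> \<open>Passage from gauge norms to order balls\<close>
  have regular: "\<exists>C1 \<alpha> C2 C3 \<beta> q t0. regularity T D A u (B k) C1 \<alpha> C2 C3 \<beta> q t0" if k: "k \<in> ball 0 1" for k
  proof -
    obtain C1 \<alpha> where C1: "C1 \<ge> 1"
      and sm: "\<And>t. t \<in> {0<..1} \<Longrightarrow> range (T t) \<subseteq> principal_ideal u \<and>
        (\<forall>x. gauge_norm u (T t x) \<le> C1 * t powr (- \<alpha>) * norm x)"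
      using smoothing k by metis
    obtain q t0 where q: "q \<in> {0<..<1}" "t0 > 0"
      and mi: "\<And>x. x \<in> D \<Longrightarrow> integral {0..t0} (\<lambda>s. norm (B k (T s x))) \<le> q * norm x"
      using miyadera k by metis
    obtain C \<beta> where C: "C \<ge> 1" and beta: "\<beta> \<in> {0..<1}"
      and ib1: "\<And>t x. t \<in> {0<..1} \<Longrightarrow> x \<in> principal_ideal u \<Longrightarrow>
        T t x \<in> principal_ideal u \<and> gauge_norm u (T t x) \<le> C * gauge_norm u x"
      and ib2: "\<And>t x. t \<in> {0<..1} \<Longrightarrow> x \<in> principal_ideal u \<Longrightarrow> T t x \<in> D \<Longrightarrow>
        B k (T t x) \<in> principal_ideal u \<and> gauge_norm u (B k (T t x)) \<le> C * t powr (- \<beta>) * gauge_norm u x"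
      using ideal_bounds k by metis
    have "regularity T D A u (B k) C1 \<alpha> C C \<beta> q t0"
    proof unfold_locales
      show "T t x \<in> order_ball u (C1 * t powr (- \<alpha>) * norm x)" if "t \<in> {0<..1}" for t x
        using sm [OF that] by (intro order_ball_gauge_le u) auto
      fix t a :: real and x assume *: "t \<in> {0<..1}" "0 \<le> a" "x \<in> order_ball u a"
      then have x: "x \<in> principal_ideal u" "gauge_norm u x \<le> a"
        using u order_ball_imp_ideal gauge_norm_le_nonneg by auto
      have "C * gauge_norm u x \<le> C * a" "C * t powr (- \<beta>) * gauge_norm u x \<le> C * t powr (- \<beta>) * a"
        using x(2) C by (intro mult_left_mono; simp)+
      note le = this
      show "T t x \<in> order_ball u (C * a)"
        using ib1 [OF *(1) x(1)] le(1) by (intro order_ball_gauge_le u) auto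
      have "T t x \<in> D" using * by (intro T_mem) simp
      then show "B k (T t x) \<in> order_ball u (C * t powr (- \<beta>) * a)"
        using ib2 [OF *(1) x(1)] le(2) by (intro order_ball_gauge_le u) auto
    qed (use u q C C1 beta B_bounded k mi in auto)
    then show ?thesis by blast
  qed

  \<comment> \<open>Spectral splitting at \<open>lambda0\<close> and size of the
    perturbation\<close>
  obtain \<phi> H0 where dec: "functional \<phi>" "\<phi> v0 = 1" "bounded_clinear H0" "H0 v0 = 0"
    "\<And>x. H0 x \<in> D \<and> of_real lambda0 *\<^sub>C H0 x - A (H0 x) = x - \<phi> x *\<^sub>C v0 \<and> \<phi> (H0 x) = 0"
    "\<And>x. x \<in> D \<Longrightarrow> H0 (of_real lambda0 *\<^sub>C x - A x) = x - \<phi> x *\<^sub>C v0 \<and> \<phi> (A x) = of_real lambda0 * \<phi> x"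
    using simple_pole_decomposition [OF A_clinear pole simple v0(1)] by blast
  have v0': "v0 \<in> D" "v0 \<noteq> 0" "A v0 = of_real lambda0 *\<^sub>C v0" using v0(1) by (auto simp: eigenvector_def)
  have rho: "l \<in> resolvent_set D A" if "l \<in> cball (of_real lambda0) r" "l \<noteq> of_real lambda0" for l
  proof -
    have "l \<notin> spectrum D A" using r(2) that by blast
    then show ?thesis by (simp add: spectrum_def)
  qed
  note dec5 = dec(5) [THEN conjunct1] dec(5) [THEN conjunct2, THEN conjunct1] dec(5) [THEN conjunct2, THEN conjunct2]
  interpret simple_pole D A "of_real lambda0" v0 \<phi> H0 r
    by unfold_locales
      (assumption | rule A_clinear v0' dec(1-4) dec5 dec(6) [THEN conjunct1] dec(6) [THEN conjunct2] r(1) rho)+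
  \<comment> \<open>A reference point on the circle, hence in the resolvent set;
    \<open>\<mu> - A\<close> acts on \<open>v0\<close> as multiplication by
    \<open>r\<close>.\<close>
  define \<mu> :: complex where "\<mu> = of_real lambda0 + of_real r"
  have mu: "\<mu> \<in> resolvent_set D A" using r(1) by (intro rho) (auto simp: \<mu>_def dist_norm)
  define R where "R = resolvent D A \<mu>"
  define K where "K k x = B k (R x)" for k x
  have Kclin: "bounded_clinear (K k)" if "k \<in> ball 0 1" for k
    unfolding K_def [abs_def] R_def using B_bounded that by (intro graph_bounded_resolvent mu) auto
  have Bhol: "(\<lambda>k. B k x) vholomorphic_on ball 0 1" if x: "x \<in> D" for x
  proof -
    have "(\<lambda>k. - A x + (A x + B k x)) vholomorphic_on ball 0 1"
      by (rule vholomorphic_add [OF vholomorphic_const [OF open_ball] holomorphic [rule_format, OF x] open_ball])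
    then show ?thesis by simp
  qed
  have KB: "K k (\<mu> *\<^sub>C x - A x) = B k x" if "x \<in> D" for k x
    by (simp add: K_def R_def resolvent_left [OF mu that])
  have "\<exists>K0. \<forall>k\<in>ball 0 (1/2). \<forall>x. norm (K k x) \<le> K0 * cmod k * norm x"
  proof (rule strongly_holomorphic_small)
    show "(\<lambda>k. K k x) vholomorphic_on ball 0 1" for x
      unfolding K_def R_def by (rule Bhol [OF resolvent_mem [OF mu]])
    show "K 0 x = 0" for x
      unfolding K_def R_def by (rule B_zero [rule_format, OF resolvent_mem [OF mu]])
  qed (rule Kclin)
  then obtain K0 where K0: "\<And>k x. k \<in> ball 0 (1/2) \<Longrightarrow> norm (K k x) \<le> K0 * cmod k * norm x"
    by blast
  obtain M where M: "M > 0" "\<And>l x. l \<in> cball (of_real lambda0) r \<Longrightarrow> norm (H l x) \<le> M * norm x"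
    using H_bounded by blast
  obtain N where N: "N > 0" "\<And>x. cmod (\<phi> x) \<le> norm x * N"
    using phi.pos_bounded by blast
  then have N: "N > 0" "\<And>x. cmod (\<phi> x) \<le> N * norm x" by (simp_all add: mult.commute)
  \<comment> \<open>The bracket collects the norms in \<open>(\<mu> - A) (H l x) = (\<mu> - l)
    *\<^sub>C H l x + (x - \<phi> x *\<^sub>C v0)\<close>, with
    \<open>cmod (\<mu> - l) \<le> 2 * r\<close>, and in
    \<open>(\<mu> - A) v0 = r *\<^sub>R v0\<close>.\<close>
  define E where "E = \<bar>K0\<bar> * (2 * r * M + 1 + N * norm v0 + r * norm v0)"
  have E0: "E \<ge> 0" using r(1) M(1) N(1) by (simp add: E_def)
  have BHb: "norm (B k (H l x)) \<le> (E * cmod k) * norm x"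
    if k: "k \<in> ball 0 (1/2)" and l: "l \<in> cball (of_real lambda0) r" for k l x
  proof -
    have "\<mu> *\<^sub>C H l x - A (H l x) = (\<mu> - l) *\<^sub>C H l x + (x - \<phi> x *\<^sub>C v0)"
      unfolding H_right [OF l, symmetric] by (simp add: scaleC_diff_left)
    then have "B k (H l x) = K k ((\<mu> - l) *\<^sub>C H l x + (x - \<phi> x *\<^sub>C v0))"
      using KB [OF H_mem [OF l], of k x] by simp
    also have "norm \<dots> \<le> \<bar>K0\<bar> * cmod k * norm ((\<mu> - l) *\<^sub>C H l x + (x - \<phi> x *\<^sub>C v0))"
      by (rule order_trans [OF K0 [OF k]]) (intro mult_right_mono, auto)
    also have "\<dots> \<le> \<bar>K0\<bar> * cmod k * ((2 * r * M + 1 + N * norm v0 + r * norm v0) * norm x)"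
    proof (rule mult_left_mono)
      have "cmod (\<mu> - l) \<le> cmod (\<mu> - of_real lambda0) + cmod (of_real lambda0 - l)"
        using norm_triangle_ineq [of "\<mu> - of_real lambda0" "of_real lambda0 - l"] by simp
      then have ml: "cmod (\<mu> - l) \<le> 2 * r" using l r(1) by (simp add: \<mu>_def dist_norm)
      have "norm ((\<mu> - l) *\<^sub>C H l x + (x - \<phi> x *\<^sub>C v0)) \<le>
          2 * r * (M * norm x) + (norm x + (N * norm x) * norm v0)"
        by (intro order_trans [OF norm_triangle_ineq] add_mono order_trans [OF norm_triangle_ineq4] order_refl;
            unfold norm_scaleC; intro mult_mono ml M(2) l N(2))
          (use r(1) N(1) in auto)
      also have "\<dots> \<le> (2 * r * M + 1 + N * norm v0 + r * norm v0) * norm x"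
        using r(1) by (simp add: algebra_simps)
      finally show "norm ((\<mu> - l) *\<^sub>C H l x + (x - \<phi> x *\<^sub>C v0)) \<le> (2 * r * M + 1 + N * norm v0 + r * norm v0) * norm x" .
    qed simp
    finally show ?thesis by (simp add: E_def mult_ac)
  qed
  have Bv0b: "norm (B k v0) \<le> E * cmod k" if k: "k \<in> ball 0 (1/2)" for k
  proof -
    have "B k v0 = K k (of_real r *\<^sub>C v0)"
      using KB [OF v0'(1), of k] by (simp add: v0' \<mu>_def scaleC_add_left)
    also have "norm \<dots> \<le> \<bar>K0\<bar> * cmod k * norm ((of_real r :: complex) *\<^sub>C v0)"
      by (rule order_trans [OF K0 [OF k]]) (intro mult_right_mono, auto)
    also have "\<dots> = \<bar>K0\<bar> * (r * norm v0) * cmod k" using r(1) by (simp add: norm_scaleC)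
    also have "\<dots> \<le> E * cmod k"
      unfolding E_def using r(1) M(1) N(1) by (intro mult_right_mono mult_left_mono) auto
    finally show ?thesis .
  qed
  define \<eta> where "\<eta> = min (1/4) (min (r / (8 * N)) (min (1 / (8 * N * M)) (1 / (8 * N * (norm v0 + M)))))"
  have eta0: "\<eta> > 0" using r(1) N(1) M(1) by (simp add: \<eta>_def add_nonneg_pos)
  have eta: "\<eta> \<le> 1/4" "\<eta> \<le> r / (8 * N)" "\<eta> \<le> 1 / (8 * N * M)" "\<eta> \<le> 1 / (8 * N * (norm v0 + M))"
    by (auto simp: \<eta>_def)
  \<comment> \<open>\<open>1/2\<close> is the radius on which \<open>K0\<close> is valid;
    \<open>E + 1\<close> avoids division by 0 and still gives
    \<open>E * cmod k \<le> \<eta>\<close>.\<close>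
  define \<rho> where "\<rho> = min (1/2) (\<eta> / (E + 1))"
  have rho0: "\<rho> > 0" "\<rho> \<le> 1/2"
  proof -
    show "\<rho> > 0" using eta0 E0 by (simp add: \<rho>_def)
    show "\<rho> \<le> 1/2" unfolding \<rho>_def by (rule min.cobounded1)
  qed
  have Ek: "E * cmod k \<le> \<eta>" if "k \<in> ball 0 \<rho>" for k
  proof -
    have "cmod k \<le> \<eta> / (E + 1)" using that by (simp add: \<rho>_def)
    then have "(E + 1) * cmod k \<le> \<eta>" using E0 by (simp add: field_simps)
    moreover have "E * cmod k \<le> (E + 1) * cmod k" by (intro mult_right_mono) auto
    ultimately show ?thesis by linarith
  qed
  have small: "small_perturbation D A (of_real lambda0) v0 \<phi> H0 r (B k) M N (E * cmod k)" if k: "k \<in> ball 0 \<rho>" for k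
  proof unfold_locales
    have k2: "k \<in> ball 0 (1/2)" and k1: "k \<in> ball 0 1" using k rho0 by auto
    show lin: "clinear_on D (B k)" by (rule Blin [OF k1])
    show BH: "norm (B k (H l x)) \<le> (E * cmod k) * norm x" if "l \<in> cball (of_real lambda0) r" for l x
      by (rule BHb [OF k2 that])
    show "bounded_clinear (\<lambda>x. B k (H l x))" if l: "l \<in> cball (of_real lambda0) r" for l
    proof (rule bounded_clinearI [OF _ _ BH [OF l]])
      interpret Hl: bounded_linear "H l" by (rule H_linear [OF l])
      show "B k (H l (x + y)) = B k (H l x) + B k (H l y)" for x y
        by (simp add: Hl.add clinear_on_add [OF lin] H_mem [OF l])
      show "B k (H l (c *\<^sub>C x)) = c *\<^sub>C B k (H l x)" for c x
        by (simp add: bounded_clinear_scaleC [OF H_clinear [OF l]] clinear_on_scale [OF lin] H_mem [OF l])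
    qed
    show "norm (B k v0) \<le> E * cmod k" by (rule Bv0b [OF k2])
    have vM: "norm v0 + M > 0" using M(1) by (simp add: add_nonneg_pos)
    have le: "E * cmod k * d \<le> e" if "d > 0" "\<eta> \<le> e / d" for d e
    proof -
      have "E * cmod k * d \<le> \<eta> * d" using Ek [OF k] that(1) by (intro mult_right_mono) auto
      also have "\<dots> \<le> e" using that by (simp add: pos_le_divide_eq)
      finally show ?thesis .
    qed
    show "E * cmod k * (8 * N) \<le> r" "E * cmod k * (8 * N * M) \<le> 1" "E * cmod k * (8 * N * (norm v0 + M)) \<le> 1"
      using N(1) M(1) vM by (intro le eta mult_pos_pos; simp)+
    show "E * cmod k \<le> 1/4" using Ek [OF k] eta(1) by simp
    show "0 \<le> E * cmod k" using E0 by simp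
  qed (use M N in auto)
  interpret fam: perturbed_family T D A u B "of_real lambda0" v0 \<phi> H0 r M N E \<rho>
  proof (intro perturbed_family.intro perturbed_family_axioms.intro)
    show "differentiable_semigroup T D A" ..
    show "0 < \<rho>" by (rule rho0)
    show "\<exists>C1 \<alpha> C2 C3 \<beta> q t0. regularity T D A u (B k) C1 \<alpha> C2 C3 \<beta> q t0" if "k \<in> ball 0 \<rho>" for k
      using that rho0 by (intro regular) auto
    show "(\<lambda>k. B k x) vholomorphic_on ball 0 \<rho>" if "x \<in> D" for x
    proof (rule vholomorphic_onI [OF open_ball])
      fix z :: complex assume "z \<in> ball 0 \<rho>"
      then have "z \<in> ball 0 1" using rho0 by auto
      from vholomorphic_onD [OF Bhol [OF that] open_ball this]
      show "\<exists>d. ((\<lambda>w. inverse (w - z) *\<^sub>C (B w x - B z x)) \<longlongrightarrow> d) (at z)" .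
    qed
  qed (rule small)
  obtain \<delta> where delta: "\<delta> > 0" "\<delta> \<le> \<rho>"
    and conv: "\<And>k. k \<in> ball 0 \<delta> \<Longrightarrow> fam.vk k - v0 \<in> order_ball u (c / 2)"
    using fam.eigenvector_convergence [OF mu, of "c / 2"] c_pos by auto

  \<comment> \<open>Reality and positivity of the perturbed eigenpair\<close>
  show ?thesis
  proof (intro exI [of _ \<delta>] conjI ballI)
    show "\<delta> > 0" "\<delta> \<le> 1" using delta rho0 by auto
    fix k assume k: "k \<in> {- \<delta><..<\<delta>}"
    define kc :: complex where "kc = of_real k"
    have kd: "kc \<in> ball 0 \<delta>" using k by (simp add: kc_def abs_less_iff)
    then have kr: "kc \<in> ball 0 \<rho>" using delta by auto
    have k1: "\<bar>k\<bar> < 1" "kc \<in> ball 0 1" using kr rho0 by (auto simp: kc_def)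
    interpret sp: small_perturbation D A "of_real lambda0" v0 \<phi> H0 r "B kc" M N "E * cmod kc" by (rule small [OF kr])
    define l where "l = fam.lk kc"
    define v where "v = fam.vk kc"
    have lv: "v \<in> D" "A v + B kc v = l *\<^sub>C v" "\<phi> v = 1" "l \<in> ball (of_real lambda0) r"
      using fam.zk [OF kr] by (simp_all add: l_def v_def)
    have lc: "l \<in> cball (of_real lambda0) r" using lv(4) by simp
    have vn: "v \<noteq> 0" using lv(3) by (auto simp: phi.zero)
    have fl: "l - of_real lambda0 = sp.f l" by (rule sp.eigenvector_imp(1) [OF lc lv(1) vn lv(2)])
    note Ak = real_operator_parts [OF real_A A_clinear] real_operator_cnj [OF real_A A_clinear]
    have real_k: "real_operator D (B kc)" using real_B k1 by (simp add: kc_def)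
    note Bk = real_operator_parts [OF real_k Blin [OF k1(2)]] real_operator_cnj [OF real_k Blin [OF k1(2)]]
    have "cnj l = l"
    proof (rule sp.eigenvalue_unique [OF _ _ lc fl])
      show cl: "cnj l \<in> cball (of_real lambda0) r"
        using lc by (simp add: dist_norm) (metis complex_cnj_complex_of_real complex_cnj_diff complex_mod_cnj)
      define w where "w = Cplx (re_part v) (- im_part v)"
      show "cnj l - of_real lambda0 = sp.f (cnj l)"
      proof (rule sp.eigenvector_imp(1) [OF cl])
        show "w \<in> D" unfolding w_def by (rule Ak(5) [OF lv(1)])
        show "w \<noteq> 0" using vn by (auto simp: w_def complexification_defs intro: complexification_eqI)
        have "A w + B kc w = Cplx (re_part (A v + B kc v)) (- im_part (A v + B kc v))"
          unfolding w_def Ak(6) [OF lv(1)] Bk(6) [OF lv(1)] by (rule complexification_eqI) simp_all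
        also have "\<dots> = cnj l *\<^sub>C w"
          unfolding lv(2) w_def by (rule complexification_eqI) simp_all
        finally show "A w + B kc w = cnj l *\<^sub>C w" .
      qed
    qed
    then have lr: "l = of_real (Re l)" by (simp add: complex_eq_iff)
    \<comment> \<open>The operators and \<open>l\<close> are real, so the real part of
      \<open>v\<close> satisfies the same eigenvalue equation; unlike \<open>v\<close> it can be
      compared with \<open>u\<close>.\<close>
    define v' where "v' = Cplx (re_part v) 0"
    have v'D: "v' \<in> D" unfolding v'_def by (rule Ak(1) [OF lv(1)])
    have "A v' + B kc v' = Cplx (re_part (A v + B kc v)) 0"
      unfolding v'_def Ak(3) [OF lv(1)] Bk(3) [OF lv(1)] by (rule complexification_eqI) simp_all
    also have "\<dots> = l *\<^sub>C v'"
      unfolding lv(2) v'_def by (subst (1 2) lr, rule complexification_eqI) simp_all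
    finally have v'e: "A v' + B kc v' = l *\<^sub>C v'" .
    obtain b where b: "v \<in> order_ball u b"
      using fam.eigenvector_order_ball [OF mu kr] by (auto simp: v_def)
    have im_u: "im_part u = 0" and re_u: "0 \<le> re_part u" using nonneg_im [OF u] nonneg_re [OF u] .
    have v'ge: "(c / 2) *\<^sub>R u \<le> v'"
    proof -
      \<comment> \<open>\<open>c *\<^sub>R u\<close> is twice \<open>h\<close>: from
        \<open>re_part v0 \<ge> h + h\<close> and \<open>re_part v0 - re_part v \<le> h\<close> the
        lower bound \<open>h\<close> remains.\<close>
      define h where "h = (c / 2) *\<^sub>R re_part u"
      have m: "modulus (re_part (v - v0)) (im_part (v - v0)) \<le> h"
        using conv [OF kd] unfolding order_ball_modulus [OF u] v_def h_def .
      have "c *\<^sub>R re_part u = h + h" unfolding h_def by (simp flip: scaleR_add_left)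
      moreover have "c *\<^sub>R re_part u \<le> re_part v0" using v0_ge by (simp add: less_eq_complexification_def)
      moreover have "re_part v0 - re_part v \<le> h"
        using order_trans [OF abs_ge_minus_self [of "re_part (v - v0)"] order_trans [OF abs_le_modulus1 m]] by simp
      ultimately have "h + h - re_part v \<le> h"
        using order_trans [OF diff_right_mono] by metis
      then have "h \<le> re_part v" by (simp add: diff_le_eq)
      then have "(c / 2) *\<^sub>R re_part u \<le> re_part v" unfolding h_def .
      then show ?thesis by (simp add: less_eq_complexification_def v'_def im_u)
    qed
    \<comment> \<open>If the real part vanished, the lower bound would force \<open>u = 0\<close>;
      then \<open>E_u\<close> is trivial, contrary to its containing the nonzero vector
      \<open>v\<close>.\<close>
    have v'n: "v' \<noteq> 0"
    proof
      assume "v' = 0"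
      with v'ge have "(c / 2) *\<^sub>R re_part u \<le> 0" by (simp add: less_eq_complexification_def)
      moreover have "0 \<le> (c / 2) *\<^sub>R re_part u" using re_u c_pos by (simp add: scaleR_nonneg_nonneg)
      ultimately have "re_part u = 0" using c_pos by (metis antisym half_gt_zero less_irrefl scaleR_eq_0_iff)
      then have "u = 0" using im_u by (auto intro: complexification_eqI)
      with b have "v = 0" by (auto dest: order_ball_zero_vector)
      with vn show False ..
    qed
    have "modulus (re_part v) 0 \<le> modulus (re_part v) (im_part v)"
    proof (rule modulus_least)
      fix \<theta> :: real
      have "rotated (re_part v) 0 \<theta> \<le> 1 *\<^sub>R \<bar>re_part v\<bar>"
        using scaleR_le_abs [of "cos \<theta>" 1 "re_part v"] by simp
      also have "\<dots> \<le> modulus (re_part v) (im_part v)" using abs_le_modulus1 by simp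
      finally show "rotated (re_part v) 0 \<theta> \<le> modulus (re_part v) (im_part v)" .
    qed
    then have "v' \<in> order_ball u b"
      using b by (auto simp: order_ball_modulus [OF u] v'_def intro: order_trans)
    then have v'i: "v' \<in> principal_ideal u" by (rule order_ball_imp_ideal [OF u])
    have ev: "eigenvector D (\<lambda>x. A x + B kc x) (of_real (Re l)) v'"
      using v'D v'n v'e lr by (simp add: eigenvector_def)
    have lin_int: "Re l \<in> {lambda0 - r<..<lambda0 + r}"
      using lv(4) by (subst (asm) lr) (auto simp: dist_norm norm_of_real abs_less_iff simp flip: of_real_diff)
    have simp_l: "alg_simple_eigenvalue D (\<lambda>x. A x + B kc x) (of_real (Re l))"
      using sp.perturbed_simple [OF lc fl] lr by simp
    have spec: "cball (of_real lambda0) r \<inter> spectrum D (\<lambda>x. A x + B kc x) = {of_real (Re l)}"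
      using sp.perturbed_spectrum [OF lc fl] lr by simp
    have uniq: "l' = Re l" if l': "l' \<in> {lambda0 - r<..<lambda0 + r}"
      "alg_simple_eigenvalue D (\<lambda>x. A x + B kc x) (of_real l')" for l'
    proof -
      obtain x where x: "x \<in> D" "x \<noteq> 0" "A x + B kc x = of_real l' *\<^sub>C x"
        using l'(2) by (auto simp: alg_simple_eigenvalue_def eigenvalue_def eigenvector_def)
      have l'c: "of_real l' \<in> cball (of_real lambda0 :: complex) r"
        using l'(1) by (auto simp: dist_norm simp flip: of_real_diff)
      from sp.eigenvalue_unique [OF l'c sp.eigenvector_imp(1) [OF l'c x] lc fl]
      show ?thesis by (metis Re_complex_of_real)
    qed
    show "let Ak = (\<lambda>x. A x + B (of_real k) x) in
      \<exists>l::real.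
        (l \<in> {lambda0 - r<..<lambda0 + r} \<and> alg_simple_eigenvalue D Ak (of_real l) \<and>
         (\<forall>l'\<in>{lambda0 - r<..<lambda0 + r}. alg_simple_eigenvalue D Ak (of_real l') \<longrightarrow> l' = l) \<and>
         (\<exists>v. eigenvector D Ak (of_real l) v \<and> v \<in> principal_ideal u) \<and>
         cball (of_real lambda0) r \<inter> spectrum D Ak = {of_real l}) \<and>
        (\<exists>v. eigenvector D Ak (of_real l) v \<and> v \<in> principal_ideal u \<and> (c / 2) *\<^sub>R u \<le> v)"
      unfolding Let_def kc_def [symmetric]
      using lin_int simp_l uniq ev v'i spec v'ge by blast
  qed
qed

end
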